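(* Let $X$ be a diffusion on $[0,\infty)$ on natural scale with speed measure $m$, absorbed at $0$, which comes down from infinity, and assume $$\int_0^1\frac1x\,\sup_{y\le x}\Big(\frac1y\int_{(0,y)}z^2\,m(dz)\Big)\,dx<\infty.$$ Then for every $t>0$ there exists $A_t<\infty$ such that $\mathbb{P}_x(t<\tau_\partial)\le A_t\,x$ for all $x>0$.
   Context: A diffusion on $[0,\infty)$ on natural scale with speed measure $m$ (locally finite positive measure on $(0,\infty)$ charging every nonempty open subset), absorbed at $0$: $X_t=B_{\sigma_t}$ for $t<\tau_\partial$, $X_t=0$ after, with $B$ standard Brownian motion, $A_s=\int L^y_s m(dy)$ ($L^y$ local times), $\sigma_t=\inf\{s:A_s>t\}$, $\tau_\partial$ the first hitting time of $0$. $X$ comes down from infinity iff $\int_1^\infty y\,m(dy)<\infty$. *)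

theory Defs
  imports "HOL-Probability.Probability"
begin

definition speed_measure :: "real measure \<Rightarrow> bool" where
  "speed_measure m \<longleftrightarrow>
     sets m = sets borel \<and>
     emeasure m {..0} = 0 \<and>
     (\<forall>K. compact K \<and> K \<subseteq> {0<..} \<longrightarrow> emeasure m K < \<infinity>) \<and>
     (\<forall>U. open U \<and> U \<subseteq> {0<..} \<and> U \<noteq> {} \<longrightarrow> emeasure m U > 0)"

definition comes_down_from_infinity :: "real measure \<Rightarrow> bool" where
  "comes_down_from_infinity m \<longleftrightarrow>
     (\<integral>\<^sup>+ y. ennreal y * indicator {1..} y \<partial>m) < \<infinity>"

definition brownian_motion_from ::
    "'a measure \<Rightarrow> real \<Rightarrow> (real \<Rightarrow> 'a \<Rightarrow> real) \<Rightarrow> bool" where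
  "brownian_motion_from M x B \<longleftrightarrow>
     prob_space M \<and>
     (\<forall>t. B t \<in> borel_measurable M) \<and>
     (\<forall>\<omega>\<in>space M. B 0 \<omega> = x) \<and>
     (\<forall>\<omega>\<in>space M. continuous_on {0..} (\<lambda>t. B t \<omega>)) \<and>
     (\<forall>(n::nat) (s::nat \<Rightarrow> real). 0 \<le> s 0 \<and> (\<forall>i<n. s i < s (Suc i)) \<longrightarrow>
        prob_space.indep_vars M (\<lambda>_. borel) (\<lambda>i \<omega>. B (s (Suc i)) \<omega> - B (s i) \<omega>) {..<n} \<and>
        (\<forall>i<n. distributed M lborel (\<lambda>\<omega>. B (s (Suc i)) \<omega> - B (s i) \<omega>)
                 (\<lambda>z. ennreal (normal_density 0 (sqrt (s (Suc i) - s i)) z))))"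

definition local_time_of ::
    "'a measure \<Rightarrow> (real \<Rightarrow> 'a \<Rightarrow> real) \<Rightarrow> (real \<Rightarrow> real \<Rightarrow> 'a \<Rightarrow> real) \<Rightarrow> bool" where
  "local_time_of M B L \<longleftrightarrow>
     (\<forall>\<omega>\<in>space M.
        continuous_on (UNIV \<times> {0..}) (\<lambda>(y, s). L y s \<omega>) \<and>
        (\<forall>y s. 0 \<le> s \<longrightarrow> 0 \<le> L y s \<omega>) \<and>
        (\<forall>s a b. 0 \<le> s \<and> a \<le> b \<longrightarrow>
           measure lborel {r \<in> {0..s}. B r \<omega> \<in> {a..b}} = integral {a..b} (\<lambda>y. L y s \<omega>)))"

definition additive_functional ::
    "real measure \<Rightarrow> (real \<Rightarrow> real \<Rightarrow> 'a \<Rightarrow> real) \<Rightarrow> real \<Rightarrow> 'a \<Rightarrow> ennreal" where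
  "additive_functional m L s \<omega> = (\<integral>\<^sup>+ y. ennreal (L y s \<omega>) \<partial>m)"

definition time_change ::
    "real measure \<Rightarrow> (real \<Rightarrow> real \<Rightarrow> 'a \<Rightarrow> real) \<Rightarrow> real \<Rightarrow> 'a \<Rightarrow> ereal" where
  "time_change m L t \<omega> =
     Inf {ereal s | s. 0 \<le> s \<and> additive_functional m L s \<omega> > ennreal t}"

text \<open>tau_partial: the first time u >= 0 with X_u = B_{sigma_u} = 0 (oo if never).\<close>
definition absorption_time ::
    "real measure \<Rightarrow> (real \<Rightarrow> 'a \<Rightarrow> real) \<Rightarrow> (real \<Rightarrow> real \<Rightarrow> 'a \<Rightarrow> real) \<Rightarrow> 'a \<Rightarrow> ereal" where
  "absorption_time m B L \<omega> =
     Inf {ereal u | u. 0 \<le> u \<and> time_change m L u \<omega> < \<infinity> \<and>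
                       B (real_of_ereal (time_change m L u \<omega>)) \<omega> = 0}"

end

theory Submission
  imports Defs
begin

text \<open>
  Survival up to time \<open>t\<close> means that the additive functional \<open>A\<close> exceeds \<open>t\<close> before \<open>B\<close> hits \<open>0\<close>.
  Split according to the dyadic level \<open>(a, 2a]\<close> of the maximum of \<open>B\<close> up to that moment. Reaching
  level \<open>a\<close> costs a factor \<open>x/a\<close>; surviving below \<open>2a\<close> costs a further factor
  \<open>exp (2lK - lt/12)\<close>, where \<open>K\<close> bounds \<open>\<integral>\<^sub>(\<^sub>0\<^sub>,\<^sub>2\<^sub>a\<^sub>) z m(dz)\<close> and the rate \<open>l\<close> may be of the order of
  the inverse of \<open>\<gamma> = sup\<^sub>y\<^sub>\<le>\<^sub>2\<^sub>a \<integral>\<^sub>(\<^sub>0\<^sub>,\<^sub>y\<^sub>) z\<^sup>2 m(dz) / y\<close>. The hypothesis says that \<open>\<gamma>\<close>, taken at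
  \<open>2a = 2\<^sup>-\<^sup>k\<close>, is summable over \<open>k\<close>; being decreasing it is \<open>o(1/k)\<close>, so \<open>l\<close> may grow like any multiple
  of \<open>k\<close>, which beats the factor \<open>2\<^sup>k\<close> coming from \<open>x/a\<close>.

  The exponential rate comes from explicit supersolutions \<open>w\<close> of \<open>w'' / 2 + \<theta> w f = 0\<close> for densities
  \<open>f\<close> approximating \<open>m\<close>. Evaluated along Brownian motion on a time grid they are supermartingales up to an
  error that vanishes with the mesh. This needs only the independence of the increments, and it
  yields measurable envelopes of the survival events.
\<close>

section \<open>Barrier functions\<close>

text \<open>That survival forces the clock past \<open>t\<close> before \<open>B\<close> hits
  \<open>0\<close> is not immediate: \<open>B\<close> is not stopped at \<open>0\<close>, local
  times are known only through continuity and the occupation identity, and the clock may become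
  infinite right after the first zero \<open>T\<close>. If the clock at \<open>T\<close> equals some
  \<open>u <= t\<close>, the time change of \<open>u\<close> may lie strictly after
  \<open>T\<close>; \<open>B\<close> vanishes there because a positive value would have raised the
  clock earlier and a negative one would leave it constant. For that time to be finite
  \<open>B\<close> must become positive again, hence the unboundedness of Brownian motion. The rate
  can be of order \<open>1 / \<gamma>\<close> because integration by parts turns a bound on second
  moments into logarithmic growth of \<open>l * k\<close>, so \<open>exp (l * k)\<close> varies
  slowly enough for \<open>u\<close> and \<open>v\<close> to be comparable with explicit functions.
  Taking \<open>l = 48 k / t\<close> at level \<open>k\<close>, half of the gain
  \<open>l t / 12\<close> absorbs \<open>2 l K\<close>, since \<open>K\<close> tends to
  \<open>0\<close>; the other half is \<open>2 k\<close>. Only levels below a fixed \<open>w\<close>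
  need this decay: paths exceeding \<open>w\<close> are charged a factor of order
  \<open>x / w\<close>, and starting points beyond \<open>w\<close> the trivial bound
  \<open>1\<close>.\<close>

lemma continuous_antiderivative:
  fixes g :: "real \<Rightarrow> real"
  assumes "continuous_on UNIV g"
  shows "\<exists>G. G c = 0 \<and> (\<forall>x. (G has_real_derivative g x) (at x))"
proof -
  obtain F where F: "\<And>x. (F has_vector_derivative g x) (at x)"
    using einterval_antiderivative[of "-\<infinity>" "\<infinity>" g] assms
    by (auto simp: continuous_on_eq_continuous_at)
  have "((\<lambda>x. F x - F c) has_real_derivative g x) (at x)" for x
    using F[of x] unfolding has_real_derivative_iff_has_vector_derivative
    by (auto intro!: derivative_eq_intros)
  then show ?thesis by (intro exI[of _ "\<lambda>x. F x - F c"]) auto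
qed

lemma antiderivative_eq_integral:
  fixes g :: "real \<Rightarrow> real"
  assumes "\<And>x. (G has_real_derivative g x) (at x)" "G 0 = 0" "0 \<le> x"
  shows "G x = integral {0..x} g"
  using fundamental_theorem_of_calculus[of 0 x G g] assms
  by (metis diff_zero integral_unique has_real_derivative_iff_has_vector_derivative has_vector_derivative_at_within)

lemma ex_deriv_nonpos:
  assumes "(g has_real_derivative d) F" "d = e" "e \<le> 0"
  shows "\<exists>d. (g has_real_derivative d) F \<and> d \<le> 0"
  using assms by blast

definition twice_diff :: "(real \<Rightarrow> real) \<Rightarrow> (real \<Rightarrow> real) \<Rightarrow> (real \<Rightarrow> real) \<Rightarrow> bool" where
  "twice_diff w w' q \<longleftrightarrow> (\<forall>x. (w has_real_derivative w' x) (at x)) \<and>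
     (\<forall>x. (w' has_real_derivative - q x) (at x)) \<and> continuous_on UNIV q"

text \<open>
  \<open>u\<close> vanishes linearly at \<open>0\<close> and controls the walk before it reaches a level, \<open>v\<close> is bounded
  below by \<open>1\<close> and takes over afterwards. Both are built from \<open>k x = \<integral>\<^sub>0\<^sup>x z f z dz\<close>:
  \<open>u' = exp (- l k)\<close> and \<open>v'' = - l f exp (l k)\<close>. The hypothesis \<open>V\<close> enters through \<open>key\<close>: \<open>exp (l k)\<close> grows
  at most like the square root.
\<close>
lemma barrier_functions:
  fixes f :: "real \<Rightarrow> real"
  assumes f: "continuous_on UNIV f" "\<And>z. 0 \<le> f z" "\<And>z. z \<notin> {0<..<b} \<Longrightarrow> f z = 0"
    and b: "0 < b" and l: "0 < l"
    and V: "\<And>x. 0 < x \<Longrightarrow> x \<le> b \<Longrightarrow> l * integral {0..x} (\<lambda>z. z\<^sup>2 * f z) \<le> x / 2"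
    and K: "integral {0..b} (\<lambda>z. z * f z) \<le> K"
  obtains u u' qu v v' qv where
    "twice_diff u u' qu" "twice_diff v v' qv"
    "\<And>x. 0 \<le> x \<Longrightarrow> x * exp (- l * K) \<le> u x \<and> u x \<le> x"
    "\<And>x. 0 \<le> x \<Longrightarrow> 1 \<le> v x \<and> v x \<le> 6 * exp (l * K)"
    "\<And>x. 0 < x \<Longrightarrow> x \<le> b \<Longrightarrow> l / 6 * f x * u x \<le> qu x"
    "\<And>x. 0 < x \<Longrightarrow> x \<le> b \<Longrightarrow> l / 6 * f x * v x \<le> qv x"
    "\<And>x. x \<notin> {0<..<b} \<Longrightarrow> qu x = 0 \<and> qv x = 0"
proof -
  have cf[continuous_intros]: "continuous_on S f" for S
    using f(1) continuous_on_subset by blast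
  have "continuous_on UNIV (\<lambda>x. x * f x)" by (intro continuous_intros)
  from continuous_antiderivative[OF this, of 0] obtain k where k: "k 0 = 0" "\<And>x. (k has_real_derivative x * f x) (at x)"
    by blast
  have "continuous_on UNIV (\<lambda>x. x\<^sup>2 * f x)" by (intro continuous_intros)
  from continuous_antiderivative[OF this, of 0] obtain W where W: "W 0 = 0" "\<And>x. (W has_real_derivative x\<^sup>2 * f x) (at x)"
    by blast
  have ck[continuous_intros]: "continuous_on S k" for S
    by (meson DERIV_continuous_on has_field_derivative_at_within k(2))
  have "continuous_on UNIV (\<lambda>x. exp (- l * k x))" by (intro continuous_intros)
  from continuous_antiderivative[OF this, of 0] obtain u where u: "u 0 = 0" "\<And>x. (u has_real_derivative exp (- l * k x)) (at x)"
    by blast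
  have "continuous_on UNIV (\<lambda>x. - l * exp (l * k x) * f x)" by (intro continuous_intros)
  from continuous_antiderivative[OF this, of b] obtain R where R: "R b = 0" "\<And>x. (R has_real_derivative - l * exp (l * k x) * f x) (at x)"
    by blast
  \<comment> \<open>Integration by parts in closed form: this is \<open>1\<close> plus the integral
    of \<open>R\<close> over \<open>(0, x)\<close>, so \<open>v' = R\<close> and
    \<open>v'' = - l f exp (l k)\<close>.\<close>
  define v where "v x = exp (l * k x) + x * R x" for x
  have zf: "0 \<le> x * f x" for x using f(2)[of x] f(3)[of x] by (cases "x \<le> 0") auto
  have kmono: "k x \<le> k y" if "x \<le> y" for x y
    using that by (intro DERIV_nonneg_imp_nondecreasing[of x y k]) (use k(2) zf in blast)+
  have k0: "0 \<le> k x" if "0 \<le> x" for x using kmono[OF that] k(1) by simp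
  have Kb: "k b \<le> K" using antiderivative_eq_integral[OF k(2,1)] b K by simp
  have kb: "k x = k b" if "b \<le> x" for x
  proof (rule antisym)
    show "k x \<le> k b"
      by (rule DERIV_nonpos_imp_nonincreasing[of b x k, OF that]) (metis f(3) greaterThanLessThan_iff k(2) mult_zero_right not_less order_refl)
  qed (rule kmono[OF that])
  have kK: "k x \<le> K" for x using kmono[of x b] kb[of x] Kb by (cases "x \<le> b") auto
  have W0: "0 \<le> W x" if "0 \<le> x" for x
  proof -
    have "W 0 \<le> W x"
    proof (rule DERIV_nonneg_imp_nondecreasing[of 0 x W, OF that])
      show "\<exists>d. (W has_real_derivative d) (at z) \<and> 0 \<le> d" for z
        using W(2)[of z] f(2)[of z] by (intro exI[of _ "z\<^sup>2 * f z"]) simp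
    qed
    then show ?thesis using W(1) by simp
  qed
  have lW: "l * W x \<le> x / 2" if "0 < x" "x \<le> b" for x
    using V[OF that] antiderivative_eq_integral[OF W(2,1), of x] that by simp
  \<comment> \<open>Since \<open>W' = x * k'\<close>, the difference \<open>k x - k y\<close> equals
    \<open>W x / x - W y / y\<close> plus the integral of \<open>W z / z^2\<close>. The derivative
    of \<open>?D\<close> has the right sign exactly by \<open>lW\<close>.\<close>
  have key: "l * (k x - k y) \<le> 1/2 + ln (x / y) / 2" if "0 < y" "y \<le> x" "x \<le> b" for x y
  proof -
    let ?D = "\<lambda>x. l * k x - l * W x / x - ln x / 2"
    have "?D x \<le> ?D y"
    proof (rule DERIV_nonpos_imp_nonincreasing[of y x ?D, OF \<open>y \<le> x\<close>])
      fix z assume z: "y \<le> z" "z \<le> x"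
      then have z0: "0 < z" using that by linarith
      have "(?D has_real_derivative l * (z * f z) - (l * (z\<^sup>2 * f z) * z - l * W z * 1) / (z * z) - 1 / z / 2) (at z)"
        using z0 by (auto intro!: derivative_eq_intros k W simp: field_simps)
      moreover have "l * (z * f z) - (l * (z\<^sup>2 * f z) * z - l * W z * 1) / (z * z) - 1 / z / 2 = (l * W z - z / 2) / (z * z)"
        using z0 by (simp add: field_simps power2_eq_square)
      moreover have "\<dots> \<le> 0" using lW[of z] z0 z that by (simp add: divide_nonpos_pos)
      ultimately show "\<exists>d. (?D has_real_derivative d) (at z) \<and> d \<le> 0" by (rule ex_deriv_nonpos)
    qed
    moreover have "l * W x / x \<le> 1/2" using lW[of x] that by (simp add: field_simps)
    moreover have "0 \<le> l * W y / y" using W0[of y] that l by simp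
    moreover have "ln (x / y) = ln x - ln y" using that by (simp add: ln_div)
    ultimately show ?thesis by (simp add: algebra_simps) argo
  qed
  have expkey: "exp (l * k x) \<le> 2 * sqrt (x / y) * exp (l * k y)" if "0 < y" "y \<le> x" "x \<le> b" for x y
  proof -
    have "exp (1/2::real) \<le> 2"
    proof -
      have "exp (1/2::real) ^ 2 \<le> 2 ^ 2" using exp_le by (simp flip: exp_of_nat_mult)
      then show ?thesis by (rule power2_le_imp_le) simp
    qed
    moreover have "exp (ln (x / y) / 2) = sqrt (x / y)"
    proof -
      have "exp (ln (x / y) / 2) = exp (ln (sqrt (x / y)))" using that by (subst ln_sqrt) auto
      then show ?thesis using that by simp
    qed
    moreover have "exp (l * k x) \<le> exp (1/2) * (exp (ln (x / y) / 2) * exp (l * k y))"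
      using key[OF that] by (simp add: exp_add[symmetric] algebra_simps)
    moreover have "exp (1/2) * (sqrt (x / y) * exp (l * k y)) \<le> 2 * (sqrt (x / y) * exp (l * k y))"
      using that calculation(1) by (intro mult_right_mono) auto
    ultimately show ?thesis by simp
  qed
  have u_lower: "x * exp (- l * K) \<le> u x" if "0 \<le> x" for x
  proof -
    let ?D = "\<lambda>x. u x - x * exp (- l * K)"
    have "?D 0 \<le> ?D x"
    proof (rule DERIV_nonneg_imp_nondecreasing[of 0 x ?D, OF that])
      fix z
      have "(?D has_real_derivative exp (- l * k z) - exp (- l * K)) (at z)"
        by (auto intro!: derivative_eq_intros u)
      moreover have "0 \<le> exp (- l * k z) - exp (- l * K)" using kK[of z] l by simp
      ultimately show "\<exists>y. (?D has_real_derivative y) (at z) \<and> 0 \<le> y" by blast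
    qed
    then show ?thesis using u(1) by simp
  qed
  have u_upper: "u x \<le> x" if "0 \<le> x" for x
  proof -
    let ?D = "\<lambda>x. u x - x"
    have "?D x \<le> ?D 0"
    proof (rule DERIV_nonpos_imp_nonincreasing[of 0 x ?D, OF that])
      fix z :: real assume "0 \<le> z"
      have "(?D has_real_derivative exp (- l * k z) - 1) (at z)"
        by (auto intro!: derivative_eq_intros u)
      moreover have "exp (- l * k z) - 1 \<le> 0" using k0[of z] \<open>0 \<le> z\<close> l by simp
      ultimately show "\<exists>y. (?D has_real_derivative y) (at z) \<and> y \<le> 0" by blast
    qed
    then show ?thesis using u(1) by simp
  qed
  have cu: "continuous_on S u" for S
    by (meson DERIV_continuous_on has_field_derivative_at_within u(2))
  have u4: "u x \<le> 4 * x * exp (- l * k x)" if x: "0 < x" "x \<le> b" for x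
  proof -
    \<comment> \<open>By \<open>expkey\<close>, \<open>u' y <= 2 sqrt (x / y) exp (- l k x)\<close>
      for \<open>y <= x\<close>; the first term of \<open>?D\<close> is the antiderivative of this
      bound, finite at \<open>0\<close> because a square root singularity is integrable.\<close>
    let ?D = "\<lambda>y. 4 * exp (- l * k x) * sqrt x * sqrt y - u y"
    have "?D 0 \<le> ?D x"
    proof (rule DERIV_nonneg_imp_increasing_open[of 0 x ?D])
      fix y assume y: "0 < y" "y < x"
      have "(?D has_real_derivative 4 * exp (- l * k x) * sqrt x * (inverse (sqrt y) / 2) - exp (- l * k y)) (at y)"
        using y by (auto intro!: derivative_eq_intros u)
      moreover have "exp (- l * k y) \<le> 4 * exp (- l * k x) * sqrt x * (inverse (sqrt y) / 2)"
        using expkey[of y x] x y by (simp add: exp_minus field_simps real_sqrt_divide)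
      ultimately show "\<exists>d. (?D has_real_derivative d) (at y) \<and> 0 \<le> d"
        by (intro exI[of _ "4 * exp (- l * k x) * sqrt x * (inverse (sqrt y) / 2) - exp (- l * k y)"]) simp
    qed (use x in \<open>auto intro!: continuous_intros cu\<close>)
    then have "u x \<le> 4 * exp (- l * k x) * (sqrt x * sqrt x)" using u(1) by (simp add: mult.assoc)
    then show ?thesis using x by (simp add: mult.assoc mult.commute mult.left_commute)
  qed
  have R0: "R x = 0" if "b \<le> x" for x
  proof -
    have "(R has_real_derivative 0) (at z)" if "b \<le> z" for z
      using R(2)[of z] f(3)[of z] that by simp
    then have "R x \<le> R b" "R b \<le> R x"
      by (auto intro: DERIV_nonpos_imp_nonincreasing[of b x R, OF that] DERIV_nonneg_imp_nondecreasing[of b x R, OF that])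
    then show ?thesis using R(1) by simp
  qed
  have Rnn: "0 \<le> R x" for x
  proof (cases "x \<le> b")
    case True
    have "R b \<le> R x"
      by (rule DERIV_nonpos_imp_nonincreasing[of x b R, OF True])
         (rule ex_deriv_nonpos[OF R(2) refl], use f(2) l in simp)
    then show ?thesis using R(1) by simp
  qed (use R0 in simp)
  have R5: "x * R x \<le> 5 * exp (l * k x)" if x: "0 < x" "x \<le> b" for x
  proof -
    let ?E = "\<lambda>x. exp (l * k x)"
    \<comment> \<open>By parts, \<open>R x = ?E b / b - ?E x / x\<close> plus the integral of
      \<open>?E z / z^2\<close> over \<open>(x, b)\<close>; by \<open>expkey\<close> that integral
      is at most \<open>4 ?E x / x\<close>. With \<open>?E b / b <= 2 ?E x / x\<close> the total is
      \<open>2 - 1 + 4 = 5\<close>.\<close>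
    let ?Q = "\<lambda>z. - R z - ?E z / z + 4 * ?E x / (sqrt x * sqrt z)"
    have "?Q b \<le> ?Q x"
    proof (rule DERIV_nonpos_imp_nonincreasing[of x b ?Q, OF x(2)])
      fix z assume z: "x \<le> z" "z \<le> b"
      then have z0: "0 < z" using x by linarith
      have "(?Q has_real_derivative - (- l * ?E z * f z) - (?E z * (l * (z * f z)) * z - ?E z) / (z * z)
             - 4 * ?E x * (sqrt x * (inverse (sqrt z) / 2)) / (sqrt x * sqrt z)\<^sup>2) (at z)"
        using z0 x by (auto intro!: derivative_eq_intros R k simp: power2_eq_square)
      moreover have "- (- l * ?E z * f z) - (?E z * (l * (z * f z)) * z - ?E z) / (z * z)
             - 4 * ?E x * (sqrt x * (inverse (sqrt z) / 2)) / (sqrt x * sqrt z)\<^sup>2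
           = (?E z - 2 * sqrt (z / x) * ?E x) / (z * z)"
      proof -
        have s: "sqrt z \<noteq> 0" "sqrt x \<noteq> 0" using z0 x by auto
        have zz: "z = sqrt z * sqrt z" "x = sqrt x * sqrt x" using z0 x by auto
        have "4 * ?E x * (sqrt x * (inverse (sqrt z) / 2)) / (sqrt x * sqrt z)\<^sup>2
            = 2 * ?E x / (sqrt x * (sqrt z * sqrt z * sqrt z))"
          using s by (simp add: field_simps power2_eq_square)
        also have "\<dots> = 2 * ?E x * sqrt z / (sqrt x * (z * z))"
          using s by (subst (3 4) zz(1)) (simp add: field_simps)
        finally show ?thesis using s z0 by (simp add: field_simps real_sqrt_divide)
      qed
      moreover have "(?E z - 2 * sqrt (z / x) * ?E x) / (z * z) \<le> 0"
        using expkey[of x z] x z z0 by (intro divide_nonpos_pos) auto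
      ultimately show "\<exists>d. (?Q has_real_derivative d) (at z) \<and> d \<le> 0" by (rule ex_deriv_nonpos)
    qed
    moreover have "0 \<le> 4 * ?E x / (sqrt x * sqrt b)" "sqrt x * sqrt x = x"
      using x b by auto
    ultimately have "R x \<le> ?E b / b - ?E x / x + 4 * ?E x / x"
      unfolding R(1) \<open>sqrt x * sqrt x = x\<close> by linarith
    moreover have "?E b / b \<le> 2 * ?E x / x"
    proof -
      have "1 \<le> b / x" using x by simp
      then have "b / x * 1 \<le> b / x * (b / x)" by (intro mult_left_mono) auto
      then have "sqrt (b / x) \<le> b / x"
        using \<open>1 \<le> b / x\<close> by (intro real_le_lsqrt) (auto simp: power2_eq_square)
      then have "2 * sqrt (b / x) * ?E x \<le> 2 * (b / x) * ?E x"
        by (intro mult_right_mono mult_left_mono) auto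
      then have "?E b \<le> 2 * (b / x) * ?E x" using expkey[of x b] x by simp
      then show ?thesis using x b by (simp add: field_simps)
    qed
    ultimately have "R x \<le> 5 * ?E x / x" by (simp add: field_simps)
    then show ?thesis using x by (simp add: field_simps)
  qed
  \<comment> \<open>This \<open>6 = 1 + 5\<close> determines the rate \<open>l / 6\<close>; for
    \<open>u\<close> the bound \<open>u4\<close> would even allow \<open>l / 4\<close>.\<close>
  have v6: "v x \<le> 6 * exp (l * k x)" if "0 \<le> x" for x
    using R5[of x] R0[of x] that unfolding v_def by (cases "x = 0"; cases "x \<le> b") auto
  have v1: "1 \<le> v x" if "0 \<le> x" for x
  proof -
    have "1 \<le> exp (l * k x)" "0 \<le> x * R x" using k0[OF that] l Rnn[of x] that by auto
    then show ?thesis unfolding v_def by linarith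
  qed
  have vd: "(v has_real_derivative R x) (at x)" for x
    unfolding v_def by (auto intro!: derivative_eq_intros k R simp: algebra_simps)
  show ?thesis
  proof (rule that[of u "\<lambda>x. exp (- l * k x)" "\<lambda>x. l * (x * f x) * exp (- l * k x)"
          v R "\<lambda>x. l * exp (l * k x) * f x"])
    show "twice_diff u (\<lambda>x. exp (- l * k x)) (\<lambda>x. l * (x * f x) * exp (- l * k x))"
      unfolding twice_diff_def using u(2)
      by (auto intro!: derivative_eq_intros k continuous_intros simp: algebra_simps)
    show "twice_diff v R (\<lambda>x. l * exp (l * k x) * f x)"
      unfolding twice_diff_def using vd R(2) by (auto intro!: continuous_intros)
    show "x * exp (- l * K) \<le> u x \<and> u x \<le> x" if "0 \<le> x" for x
      using u_lower u_upper that by blast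
    show "1 \<le> v x \<and> v x \<le> 6 * exp (l * K)" if "0 \<le> x" for x
    proof -
      have "exp (l * k x) \<le> exp (l * K)" using kK[of x] l by simp
      then show ?thesis using v1[OF that] v6[OF that] by linarith
    qed
    show "l / 6 * f x * u x \<le> l * (x * f x) * exp (- l * k x)" if "0 < x" "x \<le> b" for x
    proof -
      have "l / 6 * f x * u x \<le> l / 6 * f x * (4 * x * exp (- l * k x))"
        using u4[OF that] l f(2)[of x] by (intro mult_left_mono) auto
      also have "\<dots> = 4 / 6 * (l * (x * f x) * exp (- l * k x))" by simp
      also have "\<dots> \<le> l * (x * f x) * exp (- l * k x)"
        using zf[of x] l by (intro mult_left_le_one_le) (auto simp: mult_nonneg_nonneg)
      finally show ?thesis .
    qed
    show "l / 6 * f x * v x \<le> l * exp (l * k x) * f x" if "0 < x" "x \<le> b" for x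
      using mult_left_mono[OF v6[of x], of "l / 6 * f x"] l f(2)[of x] that by (simp add: algebra_simps)
    show "l * (x * f x) * exp (- l * k x) = 0 \<and> l * exp (l * k x) * f x = 0" if "x \<notin> {0<..<b}" for x
      using f(3)[OF that] by simp
  qed
qed

section \<open>One Gaussian step\<close>

lemma taylor_twice_diff:
  assumes "twice_diff w w' q"
  shows "\<exists>c. \<bar>c - y\<bar> \<le> \<bar>\<xi>\<bar> \<and> w (y + \<xi>) = w y + w' y * \<xi> - q c * \<xi>\<^sup>2 / 2"
proof (cases "\<xi> = 0")
  case False
  let ?D = "\<lambda>n::nat. if n = 0 then w else if n = 1 then w' else (\<lambda>x. - q x)"
  have "\<exists>t. (if y + \<xi> < y then y + \<xi> < t \<and> t < y else y < t \<and> t < y + \<xi>) \<and>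
     w (y + \<xi>) = (\<Sum>m<2. ?D m y / fact m * (y + \<xi> - y) ^ m) + ?D 2 t / fact 2 * (y + \<xi> - y) ^ 2"
  proof (rule Taylor[of 2 ?D w "min y (y + \<xi>)" "max y (y + \<xi>)" y "y + \<xi>"])
    show "\<forall>(m::nat) t. m < 2 \<and> min y (y + \<xi>) \<le> t \<and> t \<le> max y (y + \<xi>) \<longrightarrow>
        (?D m has_real_derivative ?D (Suc m) t) (at t)"
    proof (intro allI impI)
      fix m :: nat and t assume "m < 2 \<and> min y (y + \<xi>) \<le> t \<and> t \<le> max y (y + \<xi>)"
      then have "m = 0 \<or> m = 1" by linarith
      then show "(?D m has_real_derivative ?D (Suc m) t) (at t)"
        using assms by (elim disjE) (simp_all add: twice_diff_def)
    qed
  qed (use False in simp_all)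
  then obtain t where t: "if y + \<xi> < y then y + \<xi> < t \<and> t < y else y < t \<and> t < y + \<xi>"
      "w (y + \<xi>) = (\<Sum>m<2. ?D m y / fact m * (y + \<xi> - y) ^ m) + ?D 2 t / fact 2 * (y + \<xi> - y) ^ 2"
    by (elim exE conjE)
  have "(\<Sum>m<2. ?D m y / fact m * (y + \<xi> - y) ^ m) = w y + w' y * \<xi>"
    by (simp add: numeral_2_eq_2)
  moreover have "?D 2 t / fact 2 * (y + \<xi> - y) ^ 2 = - q t * \<xi>\<^sup>2 / 2" by simp
  ultimately have "w (y + \<xi>) = w y + w' y * \<xi> - q t * \<xi>\<^sup>2 / 2" using t(2) by linarith
  moreover have "\<bar>t - y\<bar> \<le> \<bar>\<xi>\<bar>" using t(1) by (simp split: if_splits)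
  ultimately show ?thesis by blast
next
  case True
  then show ?thesis by (intro exI[of _ y]) simp
qed

text \<open>A Gaussian increment may overshoot \<open>0\<close>, so \<open>w\<close> is read at
  \<open>max 0\<close>. Small increments cannot reach \<open>0\<close> from
  \<open>y >= \<epsilon>\<close> and cost \<open>\<eta> * \<xi>^2\<close> by uniform continuity of
  \<open>q\<close>; large ones are dominated by \<open>\<xi>^4\<close>, whose Gaussian mean is of
  order \<open>h^2\<close>, negligible against \<open>h\<close>.\<close>

lemma truncated_taylor_bound:
  assumes w: "twice_diff w w' q" and q0: "\<And>x. x \<notin> {0<..<b} \<Longrightarrow> q x = 0"
    and pos: "0 < \<epsilon>" "0 < \<eta>"
  shows "\<exists>C\<ge>0. \<forall>y\<in>{\<epsilon>..b}. \<forall>\<xi>.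
     w (max 0 (y + \<xi>)) \<le> w y + w' y * \<xi> - q y * \<xi>\<^sup>2 / 2 + \<eta> * \<xi>\<^sup>2 + C * \<xi> ^ 4"
proof -
  have cq: "continuous_on S q" for S
    using w continuous_on_subset unfolding twice_diff_def by blast
  have "bounded (q ` {0..b})" by (intro compact_imp_bounded compact_continuous_image cq) simp
  then obtain Q0 where "\<forall>x\<in>{0..b}. \<bar>q x\<bar> \<le> Q0" by (auto simp: bounded_iff)
  then have Q: "\<bar>q x\<bar> \<le> max Q0 0" for x
  proof (cases "x \<in> {0<..<b}")
    case True
    then have "\<bar>q x\<bar> \<le> Q0" using \<open>\<forall>x\<in>{0..b}. \<bar>q x\<bar> \<le> Q0\<close> by auto
    then show ?thesis by simp
  qed (use q0[of x] in simp)
  define Q where "Q = max Q0 0"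
  have cw': "continuous_on S w'" and cw: "continuous_on S w" for S
    using w unfolding twice_diff_def
    by (meson DERIV_continuous_on has_field_derivative_at_within)+
  have "bounded ((\<lambda>y. \<bar>w y\<bar> + \<bar>w' y\<bar>) ` {0..b})"
    by (intro compact_imp_bounded compact_continuous_image continuous_intros cw cw') simp
  then obtain D where "\<forall>z\<in>(\<lambda>y. \<bar>w y\<bar> + \<bar>w' y\<bar>) ` {0..b}. \<bar>z\<bar> \<le> D"
    unfolding bounded_iff real_norm_def by blast
  then have D: "\<bar>w y\<bar> + \<bar>w' y\<bar> \<le> D" if "y \<in> {0..b}" for y using that by fastforce
  have "uniformly_continuous_on {-1..b+1} q" by (intro compact_uniformly_continuous cq) simp
  then obtain d where d: "0 < d" "\<And>x y. x \<in> {-1..b+1} \<Longrightarrow> y \<in> {-1..b+1} \<Longrightarrow> dist x y < d \<Longrightarrow> dist (q x) (q y) < 2 * \<eta>"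
    unfolding uniformly_continuous_on_def using pos(2)
    by (elim allE[of _ "2 * \<eta>"]) (auto simp: dist_commute)
  \<comment> \<open>Below \<open>\<epsilon>\<close> to exclude truncation, below \<open>1\<close> to
    keep the Taylor point inside the interval of uniform continuity.\<close>
  define \<delta> where "\<delta> = min (min d 1) \<epsilon> / 2"
  have \<delta>: "0 < \<delta>" "\<delta> < d" "\<delta> < 1" "\<delta> < \<epsilon>" using d pos by (auto simp: \<delta>_def)
  \<comment> \<open>For increments beyond \<open>\<delta>\<close> the summands pay for the quadratic
    terms, for \<open>w 0 - w y\<close>, and for the linear term, in this order.\<close>
  define C where "C = Q / \<delta>\<^sup>2 + (\<bar>w 0\<bar> + \<bar>D\<bar>) / \<delta> ^ 4 + \<bar>D\<bar> / \<delta> ^ 3"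
  have C0: "0 \<le> C" using \<delta> unfolding C_def Q_def by auto
  have big: "\<xi>\<^sup>2 \<le> \<xi> ^ 4 / \<delta>\<^sup>2" "1 \<le> \<xi> ^ 4 / \<delta> ^ 4" "\<bar>\<xi>\<bar> \<le> \<xi> ^ 4 / \<delta> ^ 3" if "\<delta> \<le> \<bar>\<xi>\<bar>" for \<xi> :: real
  proof -
    have "\<delta>\<^sup>2 \<le> \<bar>\<xi>\<bar>\<^sup>2" "\<delta>^3 \<le> \<bar>\<xi>\<bar>^3" "\<delta>^4 \<le> \<bar>\<xi>\<bar>^4" using \<delta> that by (intro power_mono; simp)+
    then have "\<bar>\<xi>\<bar>\<^sup>2 * \<delta>\<^sup>2 \<le> \<bar>\<xi>\<bar>\<^sup>2 * \<bar>\<xi>\<bar>\<^sup>2" "\<bar>\<xi>\<bar> * \<delta>^3 \<le> \<bar>\<xi>\<bar> * \<bar>\<xi>\<bar>^3" "\<delta>^4 \<le> \<bar>\<xi>\<bar>^4"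
      by (auto intro!: mult_left_mono simp only: abs_ge_zero zero_le_power)
    then have *: "\<xi>\<^sup>2 * \<delta>\<^sup>2 \<le> \<xi>^4" "\<bar>\<xi>\<bar> * \<delta>^3 \<le> \<xi>^4" "\<delta>^4 \<le> \<xi>^4"
      by (simp_all flip: power_add power_Suc)
    show "\<xi>\<^sup>2 \<le> \<xi> ^ 4 / \<delta>\<^sup>2" "1 \<le> \<xi> ^ 4 / \<delta> ^ 4" "\<bar>\<xi>\<bar> \<le> \<xi> ^ 4 / \<delta> ^ 3"
      using * \<delta> by (auto simp: field_simps)
  qed
  show ?thesis
  proof (intro exI[of _ C] conjI C0 ballI allI)
    fix y \<xi> :: real assume y: "y \<in> {\<epsilon>..b}"
    have sgn: "0 \<le> \<xi> ^ 4" by simp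
    define P1 where "P1 = Q * (\<xi> ^ 4 / \<delta>\<^sup>2)"
    define P2 where "P2 = (\<bar>w 0\<bar> + \<bar>D\<bar>) * (\<xi> ^ 4 / \<delta> ^ 4)"
    define P3 where "P3 = \<bar>D\<bar> * (\<xi> ^ 4 / \<delta> ^ 3)"
    have parts: "C * \<xi> ^ 4 = P1 + P2 + P3"
      unfolding C_def P1_def P2_def P3_def by (simp add: algebra_simps)
    have p: "0 \<le> P1" "0 \<le> P2" "0 \<le> P3"
      using \<delta> by (auto simp: Q_def P1_def P2_def P3_def)
    have e: "0 \<le> \<eta> * \<xi>\<^sup>2" using pos by simp
    have Qb: "\<bar>q x\<bar> \<le> Q" for x using Q by (simp add: Q_def)
    show "w (max 0 (y + \<xi>)) \<le> w y + w' y * \<xi> - q y * \<xi>\<^sup>2 / 2 + \<eta> * \<xi>\<^sup>2 + C * \<xi> ^ 4"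
    proof (cases "0 \<le> y + \<xi>")
      case True
      obtain c where c: "\<bar>c - y\<bar> \<le> \<bar>\<xi>\<bar>" "w (y + \<xi>) = w y + w' y * \<xi> - q c * \<xi>\<^sup>2 / 2"
        using taylor_twice_diff[OF w] by blast
      define X where "X = (q y - q c) * \<xi>\<^sup>2"
      have "X / 2 \<le> \<eta> * \<xi>\<^sup>2 + C * \<xi> ^ 4"
      proof (cases "\<bar>\<xi>\<bar> < \<delta>")
        case True
        then have "dist (q y) (q c) < 2 * \<eta>"
          using c(1) y \<delta> pos by (intro d(2)) (auto simp: dist_real_def)
        then have "(q y - q c) / 2 * \<xi>\<^sup>2 \<le> \<eta> * \<xi>\<^sup>2"
          by (intro mult_right_mono) (auto simp: dist_real_def)
        then have "X / 2 \<le> \<eta> * \<xi>\<^sup>2" by (simp add: X_def)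
        moreover have "0 \<le> C * \<xi> ^ 4" using C0 sgn by (rule mult_nonneg_nonneg)
        ultimately show ?thesis by linarith
      next
        case False
        have "X \<le> 2 * Q * \<xi>\<^sup>2"
          unfolding X_def using Qb[of y] Qb[of c] by (intro mult_right_mono) auto
        also have "\<dots> \<le> 2 * P1"
          using mult_left_mono[OF big(1)[of \<xi>], of Q] False by (simp add: Q_def P1_def)
        finally show ?thesis using parts p e by linarith
      qed
      then show ?thesis using c(2) True by (simp add: X_def max_def algebra_simps)
    next
      case False
      then have x: "\<delta> \<le> \<bar>\<xi>\<bar>" using y \<delta> by auto
      have yD: "\<bar>w y\<bar> + \<bar>w' y\<bar> \<le> \<bar>D\<bar>" using D[of y] y pos by auto
      have "w 0 - w y \<le> (\<bar>w 0\<bar> + \<bar>D\<bar>) * 1" using yD by auto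
      also have "\<dots> \<le> P2"
        unfolding P2_def using big(2)[OF x] by (intro mult_left_mono) auto
      finally have 1: "w 0 - w y \<le> P2" .
      have "- (w' y * \<xi>) \<le> \<bar>w' y\<bar> * \<bar>\<xi>\<bar>" by (metis abs_ge_minus_self abs_mult)
      also have "\<dots> \<le> P3"
        unfolding P3_def using yD big(3)[OF x] by (intro mult_mono) auto
      finally have 2: "- (w' y * \<xi>) \<le> P3" .
      have "q y * \<xi>\<^sup>2 / 2 \<le> Q * \<xi>\<^sup>2"
        using mult_right_mono[of "q y" "2 * Q" "\<xi>\<^sup>2"] Qb[of y] by (simp add: algebra_simps)
      also have "\<dots> \<le> P1"
        unfolding P1_def using big(1)[OF x] by (intro mult_left_mono) (auto simp: Q_def)
      finally have 3: "q y * \<xi>\<^sup>2 / 2 \<le> P1" .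
      show ?thesis using 1 2 3 parts e False by (simp add: max_def)
    qed
  qed
qed

definition gauss :: "real \<Rightarrow> real measure" where
  "gauss h = density lborel (\<lambda>z. ennreal (normal_density 0 (sqrt h) z))"

lemma sets_gauss[measurable_cong, simp]: "sets (gauss h) = sets borel"
  and space_gauss[simp]: "space (gauss h) = UNIV"
  by (auto simp: gauss_def)

lemma prob_space_gauss: "0 < h \<Longrightarrow> prob_space (gauss h)"
  unfolding gauss_def by (intro prob_space_normal_density) simp

lemma gauss_moments:
  assumes h: "0 < h"
  shows "has_bochner_integral (gauss h) (\<lambda>z. c0 + c1 * z + c2 * z\<^sup>2 + c4 * z ^ 4) (c0 + c2 * h + 3 * c4 * h\<^sup>2)"
proof -
  interpret prob_space "gauss h" using prob_space_gauss[OF h] .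
  have i2: "has_bochner_integral (gauss h) (\<lambda>z. z ^ 2) h"
    unfolding gauss_def
    by (rule has_bochner_integral_density)
       (use normal_moment_even[of "sqrt h" 0 1] h in \<open>simp_all add: eval_nat_numeral\<close>)
  have i4: "has_bochner_integral (gauss h) (\<lambda>z. z ^ 4) (3 * h\<^sup>2)"
    unfolding gauss_def
    by (rule has_bochner_integral_density)
       (use normal_moment_even[of "sqrt h" 0 2] h in \<open>simp_all add: fact_numeral field_simps power2_eq_square\<close>)
  have i1: "has_bochner_integral (gauss h) (\<lambda>z. z) 0"
    unfolding gauss_def
    by (rule has_bochner_integral_density)
       (use normal_moment_odd[of "sqrt h" 0 0] h in \<open>simp_all\<close>)
  have i0: "has_bochner_integral (gauss h) (\<lambda>z. c0) c0"
    using prob_space by (simp add: has_bochner_integral_iff)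
  show ?thesis
    using has_bochner_integral_add[OF has_bochner_integral_add[OF has_bochner_integral_add[OF i0
      has_bochner_integral_mult_right[OF i1, of c1]] has_bochner_integral_mult_right[OF i2, of c2]]
      has_bochner_integral_mult_right[OF i4, of c4]]
    by (simp add: mult_ac)
qed

lemma gauss_step_bound:
  assumes h: "0 < h"
    and g: "g \<in> borel_measurable borel" "\<And>\<xi>. 0 \<le> g \<xi>"
    and le: "\<And>\<xi>. g \<xi> \<le> a0 + a1 * \<xi> - q * \<xi>\<^sup>2 / 2 + \<eta> * \<xi>\<^sup>2 + C * \<xi> ^ 4"
  shows "(\<integral>\<^sup>+ \<xi>. ennreal (g \<xi>) \<partial>gauss h) \<le> ennreal (a0 - q * h / 2 + \<eta> * h + 3 * C * h\<^sup>2)"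
proof -
  note gm = gauss_moments[OF h, of a0 a1 "\<eta> - q / 2" C, unfolded has_bochner_integral_iff]
  have "(\<integral>\<^sup>+ \<xi>. ennreal (g \<xi>) \<partial>gauss h) \<le> (\<integral>\<^sup>+ \<xi>. ennreal (a0 + a1 * \<xi> + (\<eta> - q / 2) * \<xi>\<^sup>2 + C * \<xi> ^ 4) \<partial>gauss h)"
    using le by (intro nn_integral_mono ennreal_leI) (simp add: algebra_simps)
  also have "\<dots> = ennreal (a0 + (\<eta> - q / 2) * h + 3 * C * h\<^sup>2)"
  proof (rule nn_integral_eq_integral[THEN trans])
    show "integrable (gauss h) (\<lambda>\<xi>. a0 + a1 * \<xi> + (\<eta> - q / 2) * \<xi>\<^sup>2 + C * \<xi> ^ 4)"
      by (rule gm[THEN conjunct1])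
    show "AE \<xi> in gauss h. 0 \<le> a0 + a1 * \<xi> + (\<eta> - q / 2) * \<xi>\<^sup>2 + C * \<xi> ^ 4"
      using order_trans[OF g(2) le] by (intro AE_I2) (simp add: algebra_simps)
    show "ennreal (integral\<^sup>L (gauss h) (\<lambda>\<xi>. a0 + a1 * \<xi> + (\<eta> - q / 2) * \<xi>\<^sup>2 + C * \<xi> ^ 4))
      = ennreal (a0 + (\<eta> - q / 2) * h + 3 * C * h\<^sup>2)"
      by (simp only: gm[THEN conjunct2])
  qed
  finally show ?thesis by (simp add: algebra_simps)
qed

section \<open>Discretisation tools\<close>

primrec iterate :: "('s \<times> real \<Rightarrow> 's) \<Rightarrow> 's \<Rightarrow> (nat \<Rightarrow> real) \<Rightarrow> nat \<Rightarrow> 's" where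
  "iterate F s0 e 0 = s0"
| "iterate F s0 e (Suc k) = F (iterate F s0 e k, e k)"

lemma iterate_cong: "(\<And>i. i < k \<Longrightarrow> e i = e' i) \<Longrightarrow> iterate F s0 e k = iterate F s0 e' k"
  by (induction k) auto

lemma measurable_iterate:
  assumes [measurable]: "F \<in> S \<Otimes>\<^sub>M borel \<rightarrow>\<^sub>M S" and s0: "s0 \<in> space S" and "k \<le> n"
  shows "(\<lambda>e. iterate F s0 e k) \<in> (\<Pi>\<^sub>M i\<in>{..<n}. borel) \<rightarrow>\<^sub>M S"
  using \<open>k \<le> n\<close>
proof (induction k)
  case (Suc k)
  then have [measurable]: "(\<lambda>e. iterate F s0 e k) \<in> (\<Pi>\<^sub>M i\<in>{..<n}. borel) \<rightarrow>\<^sub>M S"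
    "(\<lambda>e. e k) \<in> (\<Pi>\<^sub>M i\<in>{..<n}. borel) \<rightarrow>\<^sub>M borel"
    by (auto intro!: measurable_component_singleton)
  show ?case by simp
qed (use s0 in simp)

text \<open>A supermartingale estimate without conditional expectations: the state after
  \<open>k\<close> steps is a function of the increments below \<open>k\<close>, hence independent
  of increment \<open>k\<close>. Fubini integrates the latter with the state frozen, where
  \<open>step\<close> applies, and each step adds the error \<open>d\<close>.\<close>

lemma (in prob_space) nn_integral_iterate_le:
  assumes ind: "indep_vars (\<lambda>_. borel) \<xi> {..<n}"
    and distr: "\<And>i. i < n \<Longrightarrow> distr M borel (\<xi> i) = \<mu>" "prob_space \<mu>"
    and F[measurable]: "F \<in> S \<Otimes>\<^sub>M borel \<rightarrow>\<^sub>M S" and s0: "s0 \<in> space S"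
    and \<Phi>[measurable]: "\<Phi> \<in> borel_measurable S"
    and step: "\<And>s. s \<in> space S \<Longrightarrow> (\<integral>\<^sup>+ y. \<Phi> (F (s, y)) \<partial>\<mu>) \<le> \<Phi> s + (d::ennreal)"
    and "k \<le> n"
  shows "(\<integral>\<^sup>+ \<omega>. \<Phi> (iterate F s0 (\<lambda>i. \<xi> i \<omega>) k) \<partial>M) \<le> \<Phi> s0 + of_nat k * d"
  using \<open>k \<le> n\<close>
proof (induction k)
  case 0
  then show ?case by (simp add: emeasure_space_1)
next
  case (Suc k)
  have rv[measurable]: "\<xi> i \<in> borel_measurable M" if "i < n" for i
    using ind that by (auto simp: indep_vars_def)
  let ?A = "\<Pi>\<^sub>M i\<in>{..<k}. (borel :: real measure)" and ?B = "\<Pi>\<^sub>M i\<in>{k}. (borel :: real measure)"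
  define X where "X \<omega> = restrict (\<lambda>i. \<xi> i \<omega>) {..<k}" for \<omega>
  define Y where "Y \<omega> = restrict (\<lambda>i. \<xi> i \<omega>) {k}" for \<omega>
  have "indep_var ?A X ?B Y"
    unfolding X_def Y_def using Suc.prems by (intro indep_var_restrict[OF ind]) auto
  then have [measurable]: "X \<in> M \<rightarrow>\<^sub>M ?A" "Y \<in> M \<rightarrow>\<^sub>M ?B"
    and joint: "distr M ?A X \<Otimes>\<^sub>M distr M ?B Y = distr M (?A \<Otimes>\<^sub>M ?B) (\<lambda>\<omega>. (X \<omega>, Y \<omega>))"
    unfolding indep_var_distribution_eq by auto
  define G where "G e = iterate F s0 e k" for e
  have [measurable]: "G \<in> ?A \<rightarrow>\<^sub>M S" unfolding G_def by (rule measurable_iterate[OF F s0 order_refl])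
  have [measurable]: "(\<lambda>e. e k) \<in> ?B \<rightarrow>\<^sub>M borel" by (rule measurable_component_singleton) simp
  have G_eq: "iterate F s0 (\<lambda>i. \<xi> i \<omega>) k = G (X \<omega>)" for \<omega>
    unfolding G_def X_def by (rule iterate_cong) simp
  have dk: "distr M borel (\<xi> k) = \<mu>" using distr(1) Suc.prems by simp
  have [measurable]: "\<xi> k \<in> borel_measurable M" using rv Suc.prems by simp
  interpret Y: prob_space "distr M ?B Y" by (rule prob_space_distr) simp
  have inner: "(\<integral>\<^sup>+ y. \<Phi> (F (s, y k)) \<partial>distr M ?B Y) \<le> \<Phi> s + d" if [measurable]: "s \<in> space S" for s
  proof -
    have "(\<integral>\<^sup>+ y. \<Phi> (F (s, y k)) \<partial>distr M ?B Y) = (\<integral>\<^sup>+ \<omega>. \<Phi> (F (s, \<xi> k \<omega>)) \<partial>M)"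
      by (subst nn_integral_distr) (simp_all add: Y_def)
    also have "\<dots> = (\<integral>\<^sup>+ y. \<Phi> (F (s, y)) \<partial>\<mu>)"
      unfolding dk[symmetric] by (subst nn_integral_distr) simp_all
    finally show ?thesis using step[OF that] by simp
  qed
  have "(\<integral>\<^sup>+ \<omega>. \<Phi> (iterate F s0 (\<lambda>i. \<xi> i \<omega>) (Suc k)) \<partial>M) = (\<integral>\<^sup>+ \<omega>. \<Phi> (F (G (X \<omega>), Y \<omega> k)) \<partial>M)"
    by (simp add: G_eq Y_def)
  also have "\<dots> = (\<integral>\<^sup>+ p. \<Phi> (F (G (fst p), snd p k)) \<partial>distr M (?A \<Otimes>\<^sub>M ?B) (\<lambda>\<omega>. (X \<omega>, Y \<omega>)))"
    by (subst nn_integral_distr) simp_all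
  also have "\<dots> = (\<integral>\<^sup>+ x. \<integral>\<^sup>+ y. \<Phi> (F (G x, y k)) \<partial>distr M ?B Y \<partial>distr M ?A X)"
    unfolding joint[symmetric] by (subst Y.nn_integral_fst[symmetric]) simp_all
  also have "\<dots> \<le> (\<integral>\<^sup>+ x. \<Phi> (G x) + d \<partial>distr M ?A X)"
  proof (intro nn_integral_mono inner)
    show "G x \<in> space S" if "x \<in> space (distr M ?A X)" for x
      using that measurable_space[of G ?A S x] by simp
  qed
  also have "\<dots> = (\<integral>\<^sup>+ \<omega>. \<Phi> (G (X \<omega>)) + d \<partial>M)"
    by (rule nn_integral_distr) simp_all
  also have "\<dots> = (\<integral>\<^sup>+ \<omega>. \<Phi> (G (X \<omega>)) \<partial>M) + d"
    by (subst nn_integral_add) (simp_all add: emeasure_space_1)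
  also have "(\<integral>\<^sup>+ \<omega>. \<Phi> (G (X \<omega>)) \<partial>M) \<le> \<Phi> s0 + of_nat k * d" using Suc by (simp add: G_eq)
  finally show ?case by (simp add: algebra_simps)
qed

text \<open>With \<open>q = - w''\<close> the assumption is
  \<open>w'' / 2 + \<theta> g w <= 0\<close>. The mean decrease \<open>q h / 2\<close> of
  \<open>w\<close> compensates the growth \<open>exp (\<theta> h g)\<close> of the clock weight, by
  \<open>1 - r <= exp (- r)\<close>.\<close>

lemma weighted_step_le:
  fixes Z w q h \<theta> e g :: real
  assumes "0 \<le> Z" "Z \<le> 1" "Z \<le> exp z * exp (\<theta> * (h * g))" "0 \<le> w" "2 * \<theta> * g * w \<le> q" "0 < h" "0 \<le> e"
  shows "Z * (w - q * h / 2 + e) \<le> exp z * w + e"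
proof -
  have "Z * (w - q * h / 2) \<le> exp z * w"
  proof (cases "0 \<le> w - q * h / 2")
    case True
    have "\<theta> * g * w * h \<le> q * h / 2" using mult_right_mono[OF assms(5), of h] assms(6) by simp
    then have "w - q * h / 2 \<le> w * (1 - \<theta> * (h * g))" by (simp add: algebra_simps)
    also have "\<dots> \<le> w * exp (- (\<theta> * (h * g)))"
      using exp_ge_add_one_self[of "- (\<theta> * (h * g))"] assms(4) by (intro mult_left_mono) auto
    finally have "Z * (w - q * h / 2) \<le> (exp z * exp (\<theta> * (h * g))) * (w * exp (- (\<theta> * (h * g))))"
      using assms True by (intro mult_mono) auto
    also have "\<dots> = exp z * w" by (simp add: exp_minus)
    finally show ?thesis .
  next
    case False
    have "Z * (w - q * h / 2) \<le> 0" using False assms(1) by (simp add: mult_nonneg_nonpos)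
    also have "0 \<le> exp z * w" using assms(4) by simp
    finally show ?thesis .
  qed
  moreover have "Z * e \<le> e" using assms by (simp add: mult_left_le_one_le)
  ultimately show ?thesis by (simp add: distrib_left)
qed

text \<open>Discretised events are bounded only in the limit of fine meshes. Their set-theoretic
  lower limit inherits the limiting bound and serves as a measurable envelope.\<close>

lemma emeasure_eventually_le:
  assumes [measurable]: "\<And>n::nat. A n \<in> sets M"
    and le: "\<And>\<delta>. 0 < \<delta> \<Longrightarrow> \<forall>\<^sub>F n in sequentially. emeasure M (A n) \<le> p + ennreal \<delta>"
  shows "emeasure M (\<Union>m. \<Inter>n\<in>{m..}. A n) \<le> p"
proof -
  have "emeasure M (\<Inter>n\<in>{m..}. A n) \<le> p" for m
  proof (rule ennreal_le_epsilon)
    fix \<delta> :: real assume "0 < \<delta>"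
    then have "\<forall>\<^sub>F n in sequentially. m \<le> n \<and> emeasure M (A n) \<le> p + ennreal \<delta>"
      by (intro eventually_conj eventually_ge_at_top le)
    from eventually_happens[OF this] obtain n where "m \<le> n" "emeasure M (A n) \<le> p + ennreal \<delta>"
      by auto
    moreover have "emeasure M (\<Inter>n\<in>{m..}. A n) \<le> emeasure M (A n)"
      using \<open>m \<le> n\<close> by (intro emeasure_mono) auto
    ultimately show "emeasure M (\<Inter>n\<in>{m..}. A n) \<le> p + ennreal \<delta>" by order
  qed
  moreover have "emeasure M (\<Union>m. \<Inter>n\<in>{m..}. A n) = (SUP m. emeasure M (\<Inter>n\<in>{m..}. A n))"
    by (intro SUP_emeasure_incseq[symmetric]) (auto simp: incseq_def)
  ultimately show ?thesis by (simp add: SUP_le_iff)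
qed

text \<open>The clock of the discretised walk is a left Riemann sum and only has to reach
  \<open>t\<close>, so one direction suffices. The gap \<open>\<delta>\<close> is shared by the
  oscillation of \<open>g\<close> and the last incomplete cell.\<close>

lemma lower_riemann_sum_eventually:
  fixes g :: "real \<Rightarrow> real"
  assumes g: "continuous_on {0..s} g" and s: "0 \<le> s" and t: "t < integral {0..s} g"
  shows "\<forall>\<^sub>F N in sequentially. t \<le> (1 / real N) * (\<Sum>j<nat \<lfloor>s * real N\<rfloor>. g (real j / real N))"
proof -
  define \<delta> where "\<delta> = integral {0..s} g - t"
  have \<delta>: "0 < \<delta>" using t by (simp add: \<delta>_def)
  define \<eta> where "\<eta> = \<delta> / (2 * (s + 1))"
  have \<eta>: "0 < \<eta>" "\<eta> * s \<le> \<delta> / 2" using \<delta> s by (auto simp: \<eta>_def field_simps)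
  have "uniformly_continuous_on {0..s} g" by (intro compact_uniformly_continuous g) simp
  then obtain d where d: "0 < d" "\<And>x y. x \<in> {0..s} \<Longrightarrow> y \<in> {0..s} \<Longrightarrow> dist y x < d \<Longrightarrow> dist (g y) (g x) < \<eta>"
    unfolding uniformly_continuous_on_def using \<eta>(1) by blast
  have "bounded (g ` {0..s})" by (intro compact_imp_bounded compact_continuous_image g) simp
  then obtain G where G: "0 < G" "\<And>x. x \<in> {0..s} \<Longrightarrow> \<bar>g x\<bar> \<le> G" unfolding bounded_pos by auto
  have "\<forall>\<^sub>F N in sequentially. 0 < real N \<and> 1 / real N < d \<and> 1 / real N < \<delta> / (2 * G)"
  proof (intro eventually_conj)
    show "\<forall>\<^sub>F N in sequentially. 0 < real N" using eventually_gt_at_top[of 0] by eventually_elim simp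
    have L: "(\<lambda>N. 1 / real N) \<longlonglongrightarrow> 0" by (rule lim_1_over_n)
    show "\<forall>\<^sub>F N in sequentially. 1 / real N < d" using order_tendstoD(2)[OF L d(1)] .
    show "\<forall>\<^sub>F N in sequentially. 1 / real N < \<delta> / (2 * G)"
      using order_tendstoD(2)[OF L, of "\<delta> / (2 * G)"] \<delta> G by simp
  qed
  then show ?thesis
  proof eventually_elim
    case (elim N)
    define n where "n = nat \<lfloor>s * real N\<rfloor>"
    have N: "0 < real N" using elim by simp
    have n: "real n \<le> s * real N" "s * real N < real n + 1"
      using s N unfolding n_def by (auto simp: of_nat_nat)
    then have ns: "real n / real N \<le> s" "s < (real n + 1) / real N" using N by (auto simp: field_simps)
    have gi: "g integrable_on {x..y}" if "0 \<le> x" "y \<le> s" for x y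
      by (rule integrable_continuous_real) (use g that in \<open>auto elim!: continuous_on_subset\<close>)
    have "integral {0..real k / real N} g \<le> (1 / real N) * (\<Sum>j<k. g (real j / real N)) + real k / real N * \<eta>" if "k \<le> n" for k
      using that
    proof (induction k)
      case (Suc k)
      have ks: "real (Suc k) / real N \<le> s"
      proof -
        have "real (Suc k) / real N \<le> real n / real N"
          using Suc.prems N by (intro divide_right_mono) auto
        then show ?thesis by (rule order_trans[OF _ ns(1)])
      qed
      have kk: "real k / real N \<le> real (Suc k) / real N" using N by (simp add: field_simps)
      have "integral {real k / real N..real (Suc k) / real N} g
          \<le> integral {real k / real N..real (Suc k) / real N} (\<lambda>_. g (real k / real N) + \<eta>)"
      proof (rule integral_le)
        fix x assume x: "x \<in> {real k / real N..real (Suc k) / real N}"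
        then have "dist x (real k / real N) < d"
          using elim by (auto simp: dist_real_def add_divide_distrib)
        moreover have "real k / real N \<ge> 0" by simp
        then have "0 \<le> x" using x unfolding atLeastAtMost_iff by linarith
        ultimately have "dist (g x) (g (real k / real N)) < \<eta>"
          using x ks kk by (intro d(2)) auto
        then show "g x \<le> g (real k / real N) + \<eta>" by (auto simp: dist_real_def)
      qed (use gi ks in auto)
      also have "\<dots> = (1 / real N) * (g (real k / real N) + \<eta>)"
        using N by (simp add: field_simps)
      finally have "integral {real k / real N..real (Suc k) / real N} g \<le> (1 / real N) * (g (real k / real N) + \<eta>)" .
      moreover have "integral {0..real (Suc k) / real N} g
          = integral {0..real k / real N} g + integral {real k / real N..real (Suc k) / real N} g"
        using kk ks by (intro Henstock_Kurzweil_Integration.integral_combine[symmetric] gi) auto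
      moreover have "integral {0..real k / real N} g \<le> (1 / real N) * (\<Sum>j<k. g (real j / real N)) + real k / real N * \<eta>"
        using Suc by simp
      moreover have "(1 / real N) * (\<Sum>j<k. g (real j / real N)) + real k / real N * \<eta> + (1 / real N) * (g (real k / real N) + \<eta>)
          = (1 / real N) * (\<Sum>j<Suc k. g (real j / real N)) + real (Suc k) / real N * \<eta>"
        by (simp add: algebra_simps add_divide_distrib)
      moreover have "\<And>i i1 i2 a b c :: real. i2 \<le> b \<Longrightarrow> i = i1 + i2 \<Longrightarrow> i1 \<le> a \<Longrightarrow> a + b = c \<Longrightarrow> i \<le> c"
        by linarith
      ultimately show ?case by blast
    qed simp
    from this[OF order_refl]
    have 1: "integral {0..real n / real N} g \<le> (1 / real N) * (\<Sum>j<n. g (real j / real N)) + real n / real N * \<eta>" .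
    have "integral {real n / real N..s} g \<le> integral {real n / real N..s} (\<lambda>_. G)"
    proof (intro integral_le gi)
      fix x assume "x \<in> {real n / real N..s}"
      moreover have "0 \<le> real n / real N" by simp
      ultimately have "x \<in> {0..s}" unfolding atLeastAtMost_iff by linarith
      then show "g x \<le> G" using G(2)[of x] by linarith
    qed (simp_all add: integrable_const_ivl)
    also have "\<dots> = (s - real n / real N) * G" using ns by simp
    also have "\<dots> \<le> (1 / real N) * G"
      using ns G by (intro mult_right_mono) (auto simp: add_divide_distrib)
    also have "\<dots> \<le> \<delta> / (2 * G) * G" using elim G by (intro mult_right_mono) auto
    also have "\<dots> = \<delta> / 2" using G by simp
    finally have 2: "integral {real n / real N..s} g \<le> \<delta> / 2" .
    have 3: "real n / real N * \<eta> \<le> \<delta> / 2"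
      using mult_right_mono[OF ns(1), of \<eta>] \<eta> by (simp add: mult.commute)
    have "integral {0..s} g = integral {0..real n / real N} g + integral {real n / real N..s} g"
      using ns by (intro Henstock_Kurzweil_Integration.integral_combine[symmetric] gi) auto
    moreover have "t = integral {0..s} g - \<delta>" by (simp add: \<delta>_def)
    moreover have "\<And>i i1 i2 a b D t' :: real. i = i1 + i2 \<Longrightarrow> t' = i - D \<Longrightarrow> i1 \<le> a + b \<Longrightarrow> i2 \<le> D / 2 \<Longrightarrow> b \<le> D / 2 \<Longrightarrow> t' \<le> a"
      by linarith
    ultimately show ?case unfolding n_def[symmetric] using 1 2 3 by blast
  qed
qed

section \<open>Stopped Gaussian walks and Brownian paths\<close>

text \<open>As \<open>qU = - U''\<close> and \<open>qv = - v''\<close>, the last two inequalities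
  say \<open>w'' / 2 + \<theta> f w <= 0\<close>. The comparison \<open>v_le_U\<close> makes the
  switch from \<open>U\<close> to \<open>v\<close> at level \<open>a\<close> a decrease.\<close>

locale barrier =
  fixes f U U' qU v v' qv :: "real \<Rightarrow> real" and \<epsilon> a b t \<theta> :: real
  assumes U: "twice_diff U U' qU" and v: "twice_diff v v' qv"
    and vanish: "\<And>x. x \<notin> {0<..<b} \<Longrightarrow> qU x = 0 \<and> qv x = 0"
    and U_nonneg: "\<And>x. 0 \<le> x \<Longrightarrow> 0 \<le> U x"
    and v_ge_1: "\<And>x. 0 \<le> x \<Longrightarrow> 1 \<le> v x"
    and v_le_U: "\<And>x. 0 \<le> x \<Longrightarrow> a \<le> x \<Longrightarrow> v x \<le> U x"
    and U_super: "\<And>x. 0 < x \<Longrightarrow> x \<le> b \<Longrightarrow> 2 * \<theta> * f x * U x \<le> qU x"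
    and v_super: "\<And>x. 0 < x \<Longrightarrow> x \<le> b \<Longrightarrow> 2 * \<theta> * f x * v x \<le> qv x"
    and f: "continuous_on UNIV f" "\<And>x. 0 \<le> f x"
    and \<theta>: "0 \<le> \<theta>" and \<epsilon>: "0 < \<epsilon>"
begin

text \<open>
  A state is (position, clock, running maximum). The clock is capped at \<open>t\<close>, so that the weight
  \<open>exp (\<theta> * (clock - t))\<close> stays at most \<open>1\<close>; the walk is frozen when it leaves \<open>(\<epsilon>, b]\<close>, or when it has
  both reached level \<open>a\<close> and exhausted the clock.
\<close>
definition running :: "real \<times> real \<times> real \<Rightarrow> bool" where
  "running s \<longleftrightarrow> \<epsilon> < fst s \<and> fst s \<le> b \<and> \<not> (a \<le> snd (snd s) \<and> t \<le> fst (snd s))"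

definition move :: "real \<Rightarrow> (real \<times> real \<times> real) \<times> real \<Rightarrow> real \<times> real \<times> real" where
  "move h p = (if running (fst p)
     then (fst (fst p) + snd p, min t (fst (snd (fst p)) + h * f (fst (fst p))),
           max (snd (snd (fst p))) (fst (fst p) + snd p))
     else fst p)"

text \<open>The cut \<open>max 0\<close> only matters after an overshoot below \<open>0\<close>,
  where the walk is already frozen.\<close>

definition potential :: "real \<times> real \<times> real \<Rightarrow> real" where
  "potential s = exp (\<theta> * (fst (snd s) - t)) *
     (if a \<le> snd (snd s) then v (max 0 (fst s)) else U (max 0 (fst s)))"

lemma measurable_barrier[measurable]:
  "f \<in> borel_measurable borel" "U \<in> borel_measurable borel" "v \<in> borel_measurable borel"
proof -
  have "continuous_on UNIV U" "continuous_on UNIV v"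
    using U v unfolding twice_diff_def by (meson DERIV_continuous_on)+
  then show "U \<in> borel_measurable borel" "v \<in> borel_measurable borel" "f \<in> borel_measurable borel"
    using f(1) by (simp_all add: borel_measurable_continuous_onI)
qed

lemma measurable_move[measurable]: "move h \<in> borel \<Otimes>\<^sub>M borel \<rightarrow>\<^sub>M borel"
proof -
  have "move h \<in> (borel \<Otimes>\<^sub>M borel \<Otimes>\<^sub>M borel) \<Otimes>\<^sub>M borel \<rightarrow>\<^sub>M borel \<Otimes>\<^sub>M borel \<Otimes>\<^sub>M borel"
    unfolding move_def running_def by measurable
  then show ?thesis by (simp add: borel_prod)
qed

lemma measurable_potential[measurable]: "potential \<in> borel_measurable borel"
proof -
  have "potential \<in> borel_measurable (borel \<Otimes>\<^sub>M borel \<Otimes>\<^sub>M borel)"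
    unfolding potential_def by measurable
  then show ?thesis by (simp add: borel_prod)
qed

lemma potential_ge_1:
  assumes "a \<le> snd (snd s)" "t \<le> fst (snd s)"
  shows "1 \<le> potential s"
proof -
  have "1 * 1 \<le> exp (\<theta> * (fst (snd s) - t)) * v (max 0 (fst s))"
    using assms \<theta> by (intro mult_mono v_ge_1) auto
  then show ?thesis using assms by (simp add: potential_def)
qed

text \<open>\<open>C\<close> does not depend on the state because moves start only from positions in
  \<open>(\<epsilon>, b]\<close>. Over a horizon \<open>S\<close>, that is \<open>S / h\<close>
  steps, the errors add up to \<open>S (\<eta> + 3 C h)\<close>, which can be made arbitrarily
  small.\<close>

lemma potential_step:
  assumes \<eta>: "0 < \<eta>"
  shows "\<exists>C\<ge>0. \<forall>h>0. \<forall>s. (\<integral>\<^sup>+ \<xi>. ennreal (potential (move h (s, \<xi>))) \<partial>gauss h)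
     \<le> ennreal (potential s) + ennreal (\<eta> * h + 3 * C * h\<^sup>2)"
proof -
  obtain CU where CU: "0 \<le> CU" "\<And>y \<xi>. \<epsilon> \<le> y \<Longrightarrow> y \<le> b \<Longrightarrow>
      U (max 0 (y + \<xi>)) \<le> U y + U' y * \<xi> - qU y * \<xi>\<^sup>2 / 2 + \<eta> * \<xi>\<^sup>2 + CU * \<xi> ^ 4"
    using truncated_taylor_bound[OF U _ \<epsilon> \<eta>, of b] vanish by (meson atLeastAtMost_iff)
  obtain Cv where Cv: "0 \<le> Cv" "\<And>y \<xi>. \<epsilon> \<le> y \<Longrightarrow> y \<le> b \<Longrightarrow>
      v (max 0 (y + \<xi>)) \<le> v y + v' y * \<xi> - qv y * \<xi>\<^sup>2 / 2 + \<eta> * \<xi>\<^sup>2 + Cv * \<xi> ^ 4"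
    using truncated_taylor_bound[OF v _ \<epsilon> \<eta>, of b] vanish by (meson atLeastAtMost_iff)
  define C where "C = max CU Cv"
  have C: "0 \<le> C" "CU \<le> C" "Cv \<le> C" using CU Cv by (auto simp: C_def)
  show ?thesis
  proof (intro exI[of _ C] conjI C allI impI)
    fix h :: real and s assume h: "0 < h"
    interpret G: prob_space "gauss h" by (rule prob_space_gauss[OF h])
    show "(\<integral>\<^sup>+ \<xi>. ennreal (potential (move h (s, \<xi>))) \<partial>gauss h)
       \<le> ennreal (potential s) + ennreal (\<eta> * h + 3 * C * h\<^sup>2)"
    proof (cases "running s")
      case False
      then show ?thesis by (simp add: move_def G.emeasure_space_1[simplified])
    next
      case True
      define y c r where "y = fst s" and "c = fst (snd s)" and "r = snd (snd s)"
      have y: "\<epsilon> < y" "y \<le> b" using True by (auto simp: running_def y_def)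
      define Z where "Z = exp (\<theta> * (min t (c + h * f y) - t))"
      have Z: "0 \<le> Z" "Z \<le> 1" "Z \<le> exp (\<theta> * (c - t)) * exp (\<theta> * (h * f y))"
        using \<theta> by (auto simp: Z_def mult_nonneg_nonpos simp flip: exp_add distrib_left intro!: mult_left_mono)
      define e where "e = \<eta> * h + 3 * C * h\<^sup>2"
      have e: "0 \<le> e" using \<eta> h C by (simp add: e_def)
      have bound: "(\<integral>\<^sup>+ \<xi>. ennreal (potential (move h (s, \<xi>))) \<partial>gauss h) \<le> ennreal (potential s) + ennreal e"
        if pot: "\<And>\<xi>. potential (move h (s, \<xi>)) \<le> Z * w (max 0 (y + \<xi>))"
          and pots: "potential s = exp (\<theta> * (c - t)) * w y"
          and w0: "\<And>x. 0 \<le> x \<Longrightarrow> 0 \<le> w x" and [measurable]: "w \<in> borel_measurable borel"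
          and super: "2 * \<theta> * f y * w y \<le> q"
          and le: "\<And>\<xi>. w (max 0 (y + \<xi>)) \<le> w y + d * \<xi> - q * \<xi>\<^sup>2 / 2 + \<eta> * \<xi>\<^sup>2 + C * \<xi> ^ 4"
        for w d q
      proof -
        have "(\<integral>\<^sup>+ \<xi>. ennreal (potential (move h (s, \<xi>))) \<partial>gauss h)
            \<le> (\<integral>\<^sup>+ \<xi>. ennreal Z * ennreal (w (max 0 (y + \<xi>))) \<partial>gauss h)"
          using pot Z(1) w0 by (intro nn_integral_mono) (simp add: ennreal_leI flip: ennreal_mult)
        also have "\<dots> = ennreal Z * (\<integral>\<^sup>+ \<xi>. ennreal (w (max 0 (y + \<xi>))) \<partial>gauss h)"
          by (intro nn_integral_cmult) simp
        also have "\<dots> \<le> ennreal Z * ennreal (w y - q * h / 2 + \<eta> * h + 3 * C * h\<^sup>2)"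
          by (intro mult_left_mono gauss_step_bound[OF h _ _ le] w0) simp_all
        also have "\<dots> = ennreal (Z * (w y - q * h / 2 + e))"
          using Z(1) by (simp add: ennreal_mult' e_def add.assoc)
        also have "\<dots> \<le> ennreal (exp (\<theta> * (c - t)) * w y + e)"
          using y \<epsilon> by (intro ennreal_leI weighted_step_le[OF Z _ super h e] w0) auto
        also have "\<dots> = ennreal (potential s) + ennreal e"
          using w0[of y] y \<epsilon> e by (simp add: pots ennreal_plus)
        finally show ?thesis .
      qed
      have C4: "CU * \<xi> ^ 4 \<le> C * \<xi> ^ 4" "Cv * \<xi> ^ 4 \<le> C * \<xi> ^ 4" for \<xi> :: real
        using C by (auto intro!: mult_right_mono)
      show ?thesis
      proof (cases "a \<le> r")
        case r: True
        show ?thesis unfolding e_def[symmetric]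
        proof (rule bound[of v "qv y" "v' y"])
          show "potential (move h (s, \<xi>)) \<le> Z * v (max 0 (y + \<xi>))" for \<xi>
            using True r by (simp add: move_def potential_def y_def c_def r_def Z_def le_max_iff_disj)
          show "potential s = exp (\<theta> * (c - t)) * v y"
            using r y \<epsilon> by (simp add: potential_def y_def c_def r_def)
          show "0 \<le> v x" if "0 \<le> x" for x using v_ge_1[OF that] by simp
          show "2 * \<theta> * f y * v y \<le> qv y" using y \<epsilon> by (intro v_super) auto
          show "v (max 0 (y + \<xi>)) \<le> v y + v' y * \<xi> - qv y * \<xi>\<^sup>2 / 2 + \<eta> * \<xi>\<^sup>2 + C * \<xi> ^ 4" for \<xi>
            using Cv(2)[of y \<xi>] y C4(2)[of \<xi>] by simp
        qed measurable
      next
        case r: False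
        show ?thesis unfolding e_def[symmetric]
        proof (rule bound[of U "qU y" "U' y"])
          show "potential (move h (s, \<xi>)) \<le> Z * U (max 0 (y + \<xi>))" for \<xi>
          proof -
            \<comment> \<open>As the old maximum is below \<open>a\<close>, a step that lifts the
              maximum to \<open>a\<close> must itself land at or above \<open>a\<close>, where
              \<open>v_le_U\<close> is available.\<close>
            have "a \<le> max 0 (y + \<xi>)" if "a \<le> max r (y + \<xi>)" using that r by auto
            then have "(if a \<le> max r (y + \<xi>) then v (max 0 (y + \<xi>)) else U (max 0 (y + \<xi>))) \<le> U (max 0 (y + \<xi>))"
              using v_le_U[of "max 0 (y + \<xi>)"] by simp
            moreover have "potential (move h (s, \<xi>)) = Z * (if a \<le> max r (y + \<xi>) then v (max 0 (y + \<xi>)) else U (max 0 (y + \<xi>)))"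
              using True by (simp add: move_def potential_def y_def c_def r_def Z_def)
            ultimately show ?thesis using Z(1) by (simp only: mult_left_mono)
          qed
          show "potential s = exp (\<theta> * (c - t)) * U y"
            using r y \<epsilon> by (simp add: potential_def y_def c_def r_def)
          show "0 \<le> U x" if "0 \<le> x" for x using U_nonneg[OF that] .
          show "2 * \<theta> * f y * U y \<le> qU y" using y \<epsilon> by (intro U_super) auto
          show "U (max 0 (y + \<xi>)) \<le> U y + U' y * \<xi> - qU y * \<xi>\<^sup>2 / 2 + \<eta> * \<xi>\<^sup>2 + C * \<xi> ^ 4" for \<xi>
            using CU(2)[of y \<xi>] y C4(1)[of \<xi>] by simp
        qed measurable
      qed
    qed
  qed
qed

definition done_state :: "real \<times> real \<times> real \<Rightarrow> bool" where
  "done_state s \<longleftrightarrow> a \<le> snd (snd s) \<and> t \<le> fst (snd s)"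

lemma move_done: "done_state s \<Longrightarrow> move h (s, \<xi>) = s"
  by (simp add: move_def running_def done_state_def)

text \<open>Success is absorbing, so it can be read off at the deterministic final index instead of
  a random one.\<close>

lemma iterate_done:
  assumes "done_state (iterate (move h) s0 e n)" "n \<le> m"
  shows "iterate (move h) s0 e m = iterate (move h) s0 e n"
  using assms(2)
proof (induction m rule: dec_induct)
  case (step m)
  then show ?case using move_done[OF assms(1)] by simp
qed simp

lemma iterate_path:
  assumes path: "\<And>j. j \<le> n \<Longrightarrow> \<epsilon> < y j \<and> y j \<le> b" and h: "0 \<le> h"
    and reach: "j \<le> n" "a \<le> y j" and clock: "t \<le> h * (\<Sum>j<n. f (y j))" and "n \<le> m"
  shows "1 \<le> potential (iterate (move h) (y 0, 0, y 0) (\<lambda>i. y (Suc i) - y i) m)"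
proof -
  define s where "s k = iterate (move h) (y 0, 0, y 0) (\<lambda>i. y (Suc i) - y i) k" for k
  \<comment> \<open>Invariant: until success the walk copies the path, its clock dominates the
    Riemann sum capped at \<open>t\<close>, and its maximum dominates all visited grid
    values.\<close>
  have "done_state (s k) \<or> (fst (s k) = y k \<and> min t (h * (\<Sum>j<k. f (y j))) \<le> fst (snd (s k)) \<and>
      (\<forall>j\<le>k. y j \<le> snd (snd (s k))))" if "k \<le> n" for k
    using that
  proof (induction k)
    case 0
    then show ?case by (simp add: s_def)
  next
    case (Suc k)
    have s_Suc: "s (Suc k) = move h (s k, y (Suc k) - y k)" by (simp add: s_def)
    show ?case
    proof (cases "done_state (s k)")
      case True
      then have "s (Suc k) = s k" unfolding s_Suc by (rule move_done)
      then show ?thesis using True by simp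
    next
      case False
      then have IH: "fst (s k) = y k" "min t (h * (\<Sum>j<k. f (y j))) \<le> fst (snd (s k))"
        "\<forall>j\<le>k. y j \<le> snd (snd (s k))" using Suc by auto
      have "running (s k)" using False IH(1) path[of k] Suc.prems by (simp add: running_def done_state_def)
      then have e: "s (Suc k) = (y (Suc k), min t (fst (snd (s k)) + h * f (y k)), max (snd (snd (s k))) (y (Suc k)))"
        unfolding s_Suc using IH(1) by (simp add: move_def)
      have "0 \<le> h * f (y k)" using h f(2) by simp
      then have "min t (h * (\<Sum>j<Suc k. f (y j))) \<le> min t (fst (snd (s k)) + h * f (y k))"
        using IH(2) by (simp add: algebra_simps min_def split: if_splits)
      then show ?thesis using IH(3) unfolding e by (auto simp: le_Suc_eq max.coboundedI1)
    qed
  qed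
  from this[of n] have "done_state (s n)" using reach clock unfolding done_state_def by fastforce
  moreover from this have "s m = s n" unfolding s_def by (rule iterate_done[OF _ \<open>n \<le> m\<close>])
  ultimately show ?thesis unfolding s_def[symmetric] done_state_def by (metis potential_ge_1)
qed

lemma measurable_iterate_move:
  assumes [measurable]: "\<And>i. e i \<in> borel_measurable M"
  shows "(\<lambda>\<omega>. iterate (move h) s0 (\<lambda>i. e i \<omega>) k) \<in> M \<rightarrow>\<^sub>M borel"
  by (induction k) simp_all

text \<open>The event ranges over uncountably many times, hence an envelope. Its strict inequalities
  leave room for the grid: on every sufficiently fine mesh some grid value reaches \<open>a\<close>
  and the Riemann sum reaches \<open>t\<close>, so the event lies in the lower limit of the sets
  \<open>A N\<close>. The horizon \<open>S\<close> keeps the number of steps, and with it the total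
  error, under control.\<close>

lemma path_bound:
  assumes BM: "brownian_motion_from M x B"
  shows "\<exists>E\<in>sets M. {\<omega>\<in>space M. \<exists>s\<in>{0..real S}. (\<forall>r\<in>{0..s}. \<epsilon> < B r \<omega> \<and> B r \<omega> \<le> b) \<and>
        (\<exists>r\<in>{0..s}. a < B r \<omega>) \<and> t < integral {0..s} (\<lambda>r. f (B r \<omega>))} \<subseteq> E \<and>
     emeasure M E \<le> ennreal (potential (x, 0, x))"
proof -
  interpret prob_space M using BM by (simp add: brownian_motion_from_def)
  have B[measurable]: "B r \<in> borel_measurable M" for r using BM by (simp add: brownian_motion_from_def)
  have B0: "B 0 \<omega> = x" and cont: "continuous_on {0..} (\<lambda>r. B r \<omega>)" if "\<omega> \<in> space M" for \<omega>
    using BM that by (auto simp: brownian_motion_from_def)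
  define \<xi> where "\<xi> N i \<omega> = B (real (Suc i) / real N) \<omega> - B (real i / real N) \<omega>" for N i \<omega>
  define Y where "Y N \<omega> = iterate (move (1 / real N)) (x, 0, x) (\<lambda>i. \<xi> N i \<omega>) (S * N)" for N \<omega>
  have [measurable]: "\<xi> N i \<in> borel_measurable M" for N i unfolding \<xi>_def by measurable
  have [measurable]: "Y N \<in> M \<rightarrow>\<^sub>M borel" for N
    unfolding Y_def by (rule measurable_iterate_move) simp
  \<comment> \<open>The shift to \<open>Suc N\<close> avoids the meaningless mesh
    \<open>1 / 0\<close>.\<close>
  define A where "A N = {\<omega>\<in>space M. 1 \<le> potential (Y (Suc N) \<omega>)}" for N
  have A[measurable]: "A N \<in> sets M" for N unfolding A_def by measurable
  have est: "emeasure M (A N) \<le> ennreal (potential (x, 0, x)) + of_nat (S * Suc N) * d"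
    if step: "\<And>s. (\<integral>\<^sup>+ y. ennreal (potential (move (1 / real (Suc N)) (s, y))) \<partial>gauss (1 / real (Suc N))) \<le> ennreal (potential s) + d" for N d
  proof -
    let ?n = "S * Suc N" and ?s = "\<lambda>i. real i / real (Suc N)"
    have inc: "0 \<le> ?s 0 \<and> (\<forall>i<?n. ?s i < ?s (Suc i))" by (simp add: divide_strict_right_mono)
    have ind: "indep_vars (\<lambda>_. borel) (\<xi> (Suc N)) {..<?n}"
      and dis: "\<forall>i<?n. distributed M lborel (\<xi> (Suc N) i) (\<lambda>z. ennreal (normal_density 0 (sqrt (?s (Suc i) - ?s i)) z))"
      using BM[unfolded brownian_motion_from_def, THEN conjunct2, THEN conjunct2, THEN conjunct2, THEN conjunct2, rule_format, OF inc]
      unfolding \<xi>_def by blast+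
    have gauss: "distr M borel (\<xi> (Suc N) i) = gauss (1 / real (Suc N))" if "i < ?n" for i
    proof -
      have "?s (Suc i) - ?s i = 1 / real (Suc N)" by (simp add: add_divide_distrib)
      then have "distr M lborel (\<xi> (Suc N) i) = gauss (1 / real (Suc N))"
        using dis that unfolding distributed_def gauss_def by simp
      moreover have "distr M lborel (\<xi> (Suc N) i) = distr M borel (\<xi> (Suc N) i)"
        by (rule distr_cong) simp_all
      ultimately show ?thesis by simp
    qed
    have "emeasure M (A N) = (\<integral>\<^sup>+ \<omega>. indicator (A N) \<omega> \<partial>M)" by simp
    also have "\<dots> \<le> (\<integral>\<^sup>+ \<omega>. ennreal (potential (Y (Suc N) \<omega>)) \<partial>M)"
      by (intro nn_integral_mono) (auto simp: A_def indicator_def)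
    also have "\<dots> \<le> ennreal (potential (x, 0, x)) + of_nat ?n * d"
      unfolding Y_def
      by (rule nn_integral_iterate_le[OF ind gauss prob_space_gauss, where S = borel]) (simp_all add: step del: of_nat_Suc)
    finally show ?thesis .
  qed
  have small: "\<forall>\<^sub>F N in sequentially. emeasure M (A N) \<le> ennreal (potential (x, 0, x)) + ennreal \<delta>" if \<delta>: "0 < \<delta>" for \<delta>
  proof -
    define \<eta> where "\<eta> = \<delta> / (2 * (real S + 1))"
    have \<eta>: "0 < \<eta>" "real S * \<eta> \<le> \<delta> / 2" using \<delta> by (auto simp: \<eta>_def field_simps)
    obtain C where C: "0 \<le> C" "\<And>h s. 0 < h \<Longrightarrow> (\<integral>\<^sup>+ \<xi>. ennreal (potential (move h (s, \<xi>))) \<partial>gauss h)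
       \<le> ennreal (potential s) + ennreal (\<eta> * h + 3 * C * h\<^sup>2)"
      using potential_step[OF \<eta>(1)] by blast
    have "(\<lambda>N. 3 * C * real S * (1 / real N)) \<longlonglongrightarrow> 3 * C * real S * 0"
      by (intro tendsto_intros lim_1_over_n)
    then have "\<forall>\<^sub>F N in sequentially. 3 * C * real S * (1 / real N) < \<delta> / 2"
      using \<delta> by (intro order_tendstoD(2)) auto
    then have "\<forall>\<^sub>F N in sequentially. 3 * C * real S * (1 / real (Suc N)) < \<delta> / 2"
      by (subst eventually_sequentially_Suc)
    then show ?thesis
    proof eventually_elim
      case (elim N)
      let ?h = "1 / real (Suc N)"
      have "emeasure M (A N) \<le> ennreal (potential (x, 0, x)) + of_nat (S * Suc N) * ennreal (\<eta> * ?h + 3 * C * ?h\<^sup>2)"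
        by (rule est) (rule C(2), simp)
      also have "of_nat (S * Suc N) * ennreal (\<eta> * ?h + 3 * C * ?h\<^sup>2) = ennreal (real (S * Suc N) * (\<eta> * ?h + 3 * C * ?h\<^sup>2))"
        by (simp only: ennreal_of_nat_eq_real_of_nat ennreal_mult' of_nat_0_le_iff)
      also have "real (S * Suc N) * (\<eta> * ?h + 3 * C * ?h\<^sup>2) = real S * \<eta> + 3 * C * real S * ?h"
      proof -
        have "real (Suc N) * ?h = 1" by simp
        then have "real S * (real (Suc N) * ?h) * (\<eta> + 3 * C * ?h) = real S * (\<eta> + 3 * C * ?h)" by simp
        then show ?thesis by (simp only: of_nat_mult power2_eq_square algebra_simps)
      qed
      also have "ennreal (real S * \<eta> + 3 * C * real S * ?h) \<le> ennreal \<delta>"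
        using elim \<eta>(2) by (intro ennreal_leI) linarith
      finally show ?case by simp
    qed
  qed
  show ?thesis
  proof (intro bexI[of _ "\<Union>m. \<Inter>N\<in>{m..}. A N"] conjI emeasure_eventually_le A small subsetI)
    fix \<omega> assume "\<omega> \<in> {\<omega>\<in>space M. \<exists>s\<in>{0..real S}. (\<forall>r\<in>{0..s}. \<epsilon> < B r \<omega> \<and> B r \<omega> \<le> b) \<and>
        (\<exists>r\<in>{0..s}. a < B r \<omega>) \<and> t < integral {0..s} (\<lambda>r. f (B r \<omega>))}"
    then obtain s r where \<omega>: "\<omega> \<in> space M" and s: "0 \<le> s" "s \<le> real S"
      and path: "\<And>r. 0 \<le> r \<Longrightarrow> r \<le> s \<Longrightarrow> \<epsilon> < B r \<omega> \<and> B r \<omega> \<le> b"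
      and r: "0 \<le> r" "r \<le> s" "a < B r \<omega>" and clock: "t < integral {0..s} (\<lambda>r. f (B r \<omega>))"
      by auto
    have "continuous_on {0..s} (\<lambda>r. f (B r \<omega>))"
      by (rule continuous_on_compose2[OF f(1) continuous_on_subset[OF cont[OF \<omega>]]]) auto
    from lower_riemann_sum_eventually[OF this s(1) clock]
    have ev1: "\<forall>\<^sub>F N in sequentially. t \<le> (1 / real N) * (\<Sum>j<nat \<lfloor>s * real N\<rfloor>. f (B (real j / real N) \<omega>))" .
    have "\<forall>\<^sub>F r' in at r within {0..}. a < B r' \<omega>"
      using cont[OF \<omega>] r by (intro order_tendstoD(1)[OF _ r(3)]) (auto simp: continuous_on_def)
    then obtain d where d: "0 < d" "\<And>r'. 0 \<le> r' \<Longrightarrow> dist r' r < d \<Longrightarrow> a < B r' \<omega>"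
      using r unfolding eventually_at by (metis atLeast_iff)
    have ev2: "\<forall>\<^sub>F N in sequentially. 1 / real N < d"
      using order_tendstoD(2)[OF lim_1_over_n d(1)] .
    have "\<forall>\<^sub>F N in sequentially. 0 < N \<and> 1 \<le> potential (Y N \<omega>)"
      using ev1 ev2 eventually_gt_at_top[of 0]
    proof eventually_elim
      case (elim N)
      define n j where "n = nat \<lfloor>s * real N\<rfloor>" and "j = nat \<lfloor>r * real N\<rfloor>"
      have N: "0 < real N" using elim by simp
      have n: "real n \<le> s * real N" using s N by (simp add: n_def)
      have j: "real j \<le> r * real N" "r * real N < real j + 1" using r N by (auto simp: j_def)
      have "r * real N \<le> s * real N" using r N by simp
      then have jn: "j \<le> n" unfolding j_def n_def by (intro nat_mono floor_mono)
      have "s * real N \<le> real (S * N)" using s N by simp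
      then have "n \<le> S * N" using n by linarith
      have "dist (real j / real N) r < d"
      proof -
        have "real j / real N \<le> r" "r < (real j + 1) / real N" using j N by (auto simp: field_simps)
        then show ?thesis using elim(2) by (simp add: dist_real_def add_divide_distrib)
      qed
      then have aj: "a \<le> B (real j / real N) \<omega>" using d(2)[of "real j / real N"] by simp
      have pn: "\<epsilon> < B (real i / real N) \<omega> \<and> B (real i / real N) \<omega> \<le> b" if "i \<le> n" for i
      proof (rule path)
        have "real i \<le> s * real N" using n that by linarith
        then show "real i / real N \<le> s" using N by (simp add: field_simps)
      qed simp
      have "1 \<le> potential (iterate (move (1 / real N)) (B (real 0 / real N) \<omega>, 0, B (real 0 / real N) \<omega>)
          (\<lambda>i. B (real (Suc i) / real N) \<omega> - B (real i / real N) \<omega>) (S * N))"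
        using pn jn aj elim(1) \<open>n \<le> S * N\<close>
        by (intro iterate_path[where n = n and j = j and y = "\<lambda>i. B (real i / real N) \<omega>"]) (auto simp: n_def)
      then show ?case using elim(3) B0[OF \<omega>] by (simp add: Y_def \<xi>_def)
    qed
    then obtain m where m: "\<And>N. m \<le> N \<Longrightarrow> 1 \<le> potential (Y N \<omega>)" unfolding eventually_sequentially by blast
    have "\<omega> \<in> A N" if "m \<le> N" for N using m[of "Suc N"] that \<omega> by (simp add: A_def)
    then show "\<omega> \<in> (\<Union>m. \<Inter>N\<in>{m..}. A N)" by blast
  qed auto
qed

end

section \<open>Local times of a single path\<close>

lemma nn_integral_Icc_eq_integral:
  fixes g :: "real \<Rightarrow> real"
  assumes "continuous_on {a..b} g" "\<And>x. x \<in> {a..b} \<Longrightarrow> 0 \<le> g x"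
  shows "(\<integral>\<^sup>+x. ennreal (g x) * indicator {a..b} x \<partial>lborel) = ennreal (integral {a..b} g)"
proof -
  have i: "set_integrable lborel {a..b} g" by (rule borel_integrable_atLeastAtMost'[OF assms(1)])
  have "(\<integral>\<^sup>+x. ennreal (g x) * indicator {a..b} x \<partial>lborel) = (\<integral>\<^sup>+x. ennreal (indicator {a..b} x *\<^sub>R g x) \<partial>lborel)"
    by (intro nn_integral_cong) (simp add: indicator_def)
  also have "\<dots> = ennreal (LINT x:{a..b}|lborel. g x)"
    unfolding set_lebesgue_integral_def
    using i assms(2) by (intro nn_integral_eq_integral) (auto simp: set_integrable_def indicator_def)
  also have "(LINT x:{a..b}|lborel. g x) = integral {a..b} g"
    by (rule set_borel_integral_eq_integral(2)[OF i])
  finally show ?thesis .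
qed

text \<open>The occupation identity sees local times only through integrals over level intervals;
  continuity in the level turns such information into pointwise statements.\<close>

lemma nonpos_if_local_integrals_nonpos:
  fixes g :: "real \<Rightarrow> real"
  assumes g: "continuous_on UNIV g" and e: "0 < e"
    and int: "\<And>a b. y - e < a \<Longrightarrow> a \<le> b \<Longrightarrow> b < y + e \<Longrightarrow> integral {a..b} g \<le> 0"
  shows "g y \<le> 0"
proof (rule ccontr)
  assume "\<not> g y \<le> 0"
  then have gy: "0 < g y" by simp
  have "\<forall>\<^sub>F x in at y. g y / 2 < g x"
    using g gy by (intro order_tendstoD(1)[of g "g y"]) (auto simp: continuous_on_def)
  then obtain d where d: "0 < d" "\<And>x. x \<noteq> y \<Longrightarrow> dist x y < d \<Longrightarrow> g y / 2 < g x"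
    unfolding eventually_at by blast
  define \<delta> where "\<delta> = min d e / 2"
  have \<delta>: "0 < \<delta>" "\<delta> < d" "\<delta> < e" using d e by (auto simp: \<delta>_def)
  have "integral {y - \<delta>..y + \<delta>} (\<lambda>_. g y / 2) \<le> integral {y - \<delta>..y + \<delta>} g"
  proof (intro integral_le integrable_continuous_real)
    fix x assume "x \<in> {y - \<delta>..y + \<delta>}"
    then have "dist x y < d" using \<delta> by (auto simp: dist_real_def)
    then show "g y / 2 \<le> g x" using d(2)[of x] gy by (cases "x = y") auto
  qed (use g continuous_on_subset in \<open>auto\<close>)
  also have "\<dots> \<le> 0" using \<delta> by (intro int) auto
  finally show False using \<delta> gy by (simp add: mult_le_0_iff)
qed

locale path_local_time =
  fixes \<beta> :: "real \<Rightarrow> real" and l :: "real \<Rightarrow> real \<Rightarrow> real"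
  assumes path_cont: "continuous_on {0..} \<beta>"
    and l_cont: "continuous_on (UNIV \<times> {0..}) (\<lambda>(y, s). l y s)"
    and l_nonneg: "\<And>y s. 0 \<le> s \<Longrightarrow> 0 \<le> l y s"
    and occupation: "\<And>s a b. 0 \<le> s \<Longrightarrow> a \<le> b \<Longrightarrow>
      measure lborel {r \<in> {0..s}. \<beta> r \<in> {a..b}} = integral {a..b} (\<lambda>y. l y s)"
begin

lemma l_cont_space:
  assumes "0 \<le> s" shows "continuous_on X (\<lambda>y. l y s)"
proof -
  have "continuous_on X (\<lambda>y. case (y, s) of (y, s) \<Rightarrow> l y s)"
    by (rule continuous_on_compose2[OF l_cont]) (use assms in \<open>auto intro!: continuous_intros\<close>)
  then show ?thesis by simp
qed

lemma l_cont_time: "continuous_on {0..} (\<lambda>s. l y s)"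
proof -
  have "continuous_on {0..} (\<lambda>s. case (y, s) of (y, s) \<Rightarrow> l y s)"
    by (rule continuous_on_compose2[OF l_cont]) (auto intro!: continuous_intros)
  then show ?thesis by simp
qed

definition sojourn :: "real \<Rightarrow> real \<Rightarrow> real \<Rightarrow> real set" where
  "sojourn s a b = {r \<in> {0..s}. \<beta> r \<in> {a..b}}"

lemma sojourn_fmeasurable: "sojourn s a b \<in> fmeasurable lborel"
proof -
  have "closed ({0..s} \<inter> \<beta> -` {a..b})"
    using path_cont by (intro continuous_closed_preimage) (auto elim: continuous_on_subset)
  then have "compact ({0..s} \<inter> \<beta> -` {a..b})"
    by (simp add: compact_eq_bounded_closed bounded_Int)
  moreover have "sojourn s a b = {0..s} \<inter> \<beta> -` {a..b}" by (auto simp: sojourn_def)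
  ultimately show ?thesis by (metis fmeasurable_compact)
qed

lemma measure_sojourn: "0 \<le> s \<Longrightarrow> a \<le> b \<Longrightarrow> measure lborel (sojourn s a b) = integral {a..b} (\<lambda>y. l y s)"
  using occupation by (simp only: sojourn_def)

lemma sojourn_mono: "s \<le> s' \<Longrightarrow> sojourn s a b \<subseteq> sojourn s' a b"
  by (auto simp: sojourn_def)

lemma integral_l_diff:
  assumes "0 \<le> s" "s \<le> s'" "a \<le> b"
  shows "integral {a..b} (\<lambda>y. l y s' - l y s) = measure lborel (sojourn s' a b) - measure lborel (sojourn s a b)"
  using assms by (subst Henstock_Kurzweil_Integration.integral_diff)
    (auto simp: measure_sojourn intro!: integrable_continuous_real l_cont_space)

lemma l_mono:
  assumes "0 \<le> s" "s \<le> s'" shows "l y s \<le> l y s'"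
proof -
  have "l y s - l y s' \<le> 0"
  proof (rule nonpos_if_local_integrals_nonpos[of "\<lambda>y. l y s - l y s'" 1])
    show "continuous_on UNIV (\<lambda>y. l y s - l y s')"
      using assms by (intro continuous_intros l_cont_space) auto
    fix a b :: real assume "a \<le> b"
    have "measure lborel (sojourn s a b) \<le> measure lborel (sojourn s' a b)"
      using assms by (intro measure_mono_fmeasurable sojourn_mono sojourn_fmeasurable fmeasurableD) auto
    then have "0 \<le> integral {a..b} (\<lambda>y. l y s' - l y s)"
      using integral_l_diff[OF assms \<open>a \<le> b\<close>] by simp
    then show "integral {a..b} (\<lambda>y. l y s - l y s') \<le> 0"
      using Henstock_Kurzweil_Integration.integral_neg[of "{a..b}" "\<lambda>y. l y s' - l y s"] by simp
  qed simp
  then show ?thesis by simp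
qed

text \<open>On the compact interval \<open>{s..s'}\<close> the path keeps a positive distance from
  \<open>y\<close>, so small level intervals around \<open>y\<close> gain no occupation
  time.\<close>

lemma l_const:
  assumes s: "0 \<le> s" "s \<le> s'" and avoid: "\<And>r. s \<le> r \<Longrightarrow> r \<le> s' \<Longrightarrow> \<beta> r \<noteq> y"
  shows "l y s' = l y s"
proof (rule antisym)
  have "compact (\<beta> ` {s..s'})" using s path_cont
    by (intro compact_continuous_image) (auto elim: continuous_on_subset)
  then have "closed (\<beta> ` {s..s'})" by (rule compact_imp_closed)
  then have "open (- \<beta> ` {s..s'})" by (rule open_Compl)
  moreover have "y \<in> - \<beta> ` {s..s'}"
  proof
    assume "y \<in> \<beta> ` {s..s'}"
    then obtain r where "s \<le> r" "r \<le> s'" "y = \<beta> r" by auto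
    then show False using avoid[of r] by simp
  qed
  ultimately obtain e where e: "0 < e" "\<And>z. dist z y < e \<Longrightarrow> z \<in> - \<beta> ` {s..s'}"
    unfolding open_dist by blast
  have "l y s' - l y s \<le> 0"
  proof (rule nonpos_if_local_integrals_nonpos[of "\<lambda>y. l y s' - l y s" e])
    show "continuous_on UNIV (\<lambda>y. l y s' - l y s)"
      using s by (intro continuous_intros l_cont_space) auto
    fix a b assume ab: "y - e < a" "a \<le> b" "b < y + e"
    have "\<beta> r \<notin> {a..b}" if "s \<le> r" "r \<le> s'" for r
    proof
      assume "\<beta> r \<in> {a..b}"
      then have "dist (\<beta> r) y < e" using ab by (auto simp: dist_real_def)
      then show False using e(2)[of "\<beta> r"] that by simp
    qed
    then have "x \<in> sojourn s' a b \<longleftrightarrow> x \<in> sojourn s a b" for x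
      using s by (cases "s \<le> x") (auto simp: sojourn_def simp del: atLeastAtMost_iff[of "\<beta> _"])
    then have "sojourn s' a b = sojourn s a b" by blast
    then show "integral {a..b} (\<lambda>y. l y s' - l y s) \<le> 0"
      using integral_l_diff[OF s ab(2)] by simp
  qed (rule e)
  then show "l y s' \<le> l y s" by simp
qed (rule l_mono[OF s])

lemma l_0: "l y 0 = 0"
proof -
  have "l y 0 \<le> 0"
  proof (rule nonpos_if_local_integrals_nonpos[of "\<lambda>y. l y 0" 1])
    fix a b :: real assume "a \<le> b"
    have "measure lborel (sojourn 0 a b) \<le> measure lborel {0..0::real}"
      by (intro measure_mono_fmeasurable fmeasurableD sojourn_fmeasurable fmeasurable_compact)
        (auto simp: sojourn_def)
    then show "integral {a..b} (\<lambda>y. l y 0) \<le> 0" using measure_sojourn[of 0 a b] \<open>a \<le> b\<close> by simp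
  qed (auto intro: l_cont_space)
  then show ?thesis using l_nonneg[of 0 y] by simp
qed

lemma l_eq_0:
  assumes "0 \<le> s" "\<And>r. 0 \<le> r \<Longrightarrow> r \<le> s \<Longrightarrow> \<beta> r \<noteq> y"
  shows "l y s = 0"
  using l_const[of 0 s y] l_0 assms by simp

text \<open>Shortly before \<open>r\<close> the path stays near \<open>\<beta> r\<close>, so the
  occupation time of \<open>[\<beta> r / 2, 2 \<beta> r]\<close> grows strictly. Hence some positive
  level gains local time, and by continuity so does an open set of levels, which a speed measure
  charges.\<close>

lemma l_increases:
  assumes s: "0 \<le> s" "s < r" "r \<le> s'" and \<beta>: "0 < \<beta> r"
  shows "\<exists>W. open W \<and> W \<noteq> {} \<and> W \<subseteq> {0<..} \<and> (\<forall>y\<in>W. l y s < l y s')"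
proof -
  let ?a = "\<beta> r / 2" and ?b = "2 * \<beta> r"
  have "\<forall>\<^sub>F x in at r within {0..}. \<beta> x \<in> {?a<..<?b}"
    using path_cont s \<beta> by (intro topological_tendstoD[where l = "\<beta> r"]) (auto simp: continuous_on_def)
  then obtain d where d: "0 < d" "\<And>x. 0 \<le> x \<Longrightarrow> x \<noteq> r \<Longrightarrow> dist x r < d \<Longrightarrow> \<beta> x \<in> {?a<..<?b}"
    unfolding eventually_at by (auto simp: Ball_def)
  define c where "c = max s (r - d)"
  have c: "s \<le> c" "c < r" "r - d \<le> c" using s d by (auto simp: c_def)
  let ?O = "\<lambda>s. sojourn s ?a ?b"
  have sub: "?O s \<union> {c<..<r} \<subseteq> ?O s'"
  proof (intro Un_least sojourn_mono subsetI)
    fix x assume x: "x \<in> {c<..<r}"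
    then have "dist x r < d" using c by (auto simp: dist_real_def)
    then show "x \<in> ?O s'" using d(2)[of x] x s c by (auto simp: sojourn_def)
  qed (use s in auto)
  have disj: "?O s \<inter> {c<..<r} = {}" using c by (auto simp: sojourn_def)
  have I: "{c<..<r} \<in> fmeasurable lborel" using c by (intro fmeasurableI) simp_all
  have "measure lborel (?O s \<union> {c<..<r}) \<le> measure lborel (?O s')"
    using sub by (intro measure_mono_fmeasurable sojourn_fmeasurable fmeasurableD fmeasurable.Un I)
  moreover have "measure lborel (?O s \<union> {c<..<r}) = measure lborel (?O s) + measure lborel {c<..<r}"
    using measure_Un3[OF sojourn_fmeasurable I] disj by simp
  ultimately have "0 < integral {?a..?b} (\<lambda>y. l y s' - l y s)"
    using integral_l_diff[of s s' ?a ?b] s \<beta> c by simp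
  moreover have "integral {?a..?b} (\<lambda>y. l y s' - l y s) \<le> 0" if "\<And>y. y \<in> {?a..?b} \<Longrightarrow> l y s' - l y s \<le> 0"
  proof -
    have "integral {?a..?b} (\<lambda>y. l y s' - l y s) \<le> integral {?a..?b} (\<lambda>y. 0)"
      using s that by (intro integral_le integrable_continuous_real continuous_intros l_cont_space) auto
    then show ?thesis by simp
  qed
  ultimately obtain y where y: "y \<in> {?a..?b}" "l y s < l y s'" by force
  let ?W = "{y. l y s < l y s'} \<inter> {0<..}"
  have "open {y. l y s < l y s'}" using s by (intro open_Collect_less l_cont_space) auto
  then have "open ?W" by (intro open_Int) auto
  moreover have "y \<in> ?W" using y \<beta> by auto
  ultimately show ?thesis by (intro exI[of _ ?W]) auto
qed

text \<open>The image \<open>\<mu>\<close> of Lebesgue measure on \<open>{0..s}\<close> under the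
  path and the measure \<open>\<nu>\<close> with density \<open>l y s\<close> agree on compact
  intervals, an intersection-stable generator of the Borel sets.\<close>

lemma occupation_formula:
  assumes s: "0 \<le> s" and f: "continuous_on UNIV f" "\<And>y. 0 \<le> f y"
  shows "(\<integral>\<^sup>+y. ennreal (f y) * ennreal (l y s) \<partial>lborel) = ennreal (integral {0..s} (\<lambda>r. f (\<beta> r)))"
proof -
  \<comment> \<open>Continuous extension to negative times, which makes the path Borel measurable on
    the whole line.\<close>
  define \<gamma> where "\<gamma> r = \<beta> (max 0 r)" for r
  have "continuous_on UNIV \<gamma>"
    unfolding \<gamma>_def by (rule continuous_on_compose2[OF path_cont]) (auto intro!: continuous_intros)
  then have [measurable]: "\<gamma> \<in> borel_measurable borel" by (rule borel_measurable_continuous_onI)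
  have [measurable]: "(\<lambda>y. l y s) \<in> borel_measurable borel" "f \<in> borel_measurable borel"
    using l_cont_space[OF s] f(1) by (auto intro: borel_measurable_continuous_onI)
  define \<mu> where "\<mu> = distr (density lborel (indicator {0..s})) borel \<gamma>"
  define \<nu> where "\<nu> = density lborel (\<lambda>y. ennreal (l y s))"
  have fin: "emeasure \<mu> {a..b} = ennreal (measure lborel (sojourn s a b))" for a b
  proof -
    have [measurable]: "\<gamma> -` {a..b} \<in> sets borel" using measurable_sets_borel[of \<gamma> borel "{a..b}"] by simp
    have "emeasure \<mu> {a..b} = emeasure (density lborel (indicator {0..s})) (\<gamma> -` {a..b})"
      unfolding \<mu>_def by (simp add: emeasure_distr)
    also have "\<dots> = (\<integral>\<^sup>+r. indicator {0..s} r * indicator (\<gamma> -` {a..b}) r \<partial>lborel)"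
      by (rule emeasure_density) simp_all
    also have "\<dots> = (\<integral>\<^sup>+r. indicator (sojourn s a b) r \<partial>lborel)"
      by (intro nn_integral_cong) (auto simp: indicator_def \<gamma>_def max_def sojourn_def)
    also have "\<dots> = emeasure lborel (sojourn s a b)"
      using fmeasurableD[OF sojourn_fmeasurable] by simp
    also have "\<dots> = ennreal (measure lborel (sojourn s a b))"
      using fmeasurableD2[OF sojourn_fmeasurable] by (simp add: emeasure_eq_ennreal_measure)
    finally show ?thesis .
  qed
  have "\<mu> = \<nu>"
  proof (rule measure_eqI_generator_eq[where E = "range (\<lambda>(a, b). {a..b::real})" and \<Omega> = UNIV and A = "\<lambda>n. {- real n..real n}"])
    show "Int_stable (range (\<lambda>(a, b). {a..b::real}))" by (auto simp: Int_stable_def)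
    show "emeasure \<mu> X = emeasure \<nu> X" if X: "X \<in> range (\<lambda>(a, b). {a..b::real})" for X
    proof -
      obtain a b where X: "X = {a..b}" using X by auto
      show ?thesis
      proof (cases "a \<le> b")
        case True
        have "emeasure \<nu> {a..b} = (\<integral>\<^sup>+y. ennreal (l y s) * indicator {a..b} y \<partial>lborel)"
          unfolding \<nu>_def by (simp add: emeasure_density)
        also have "\<dots> = ennreal (integral {a..b} (\<lambda>y. l y s))"
          by (intro nn_integral_Icc_eq_integral l_cont_space l_nonneg s)
        finally show ?thesis unfolding X fin measure_sojourn[OF s True] by simp
      qed (simp add: X)
    qed
    have "sets (borel :: real measure) = sigma_sets UNIV (range (\<lambda>(a, b). {a..b}))"
      by (subst borel_eq_atLeastAtMost) (simp add: sets_measure_of)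
    then show "sets \<mu> = sigma_sets UNIV (range (\<lambda>(a, b). {a..b}))" "sets \<nu> = sigma_sets UNIV (range (\<lambda>(a, b). {a..b}))"
      by (simp_all add: \<mu>_def \<nu>_def)
    show "(\<Union>n. {- real n..real n}) = UNIV"
    proof -
      have "x \<in> (\<Union>n. {- real n..real n})" for x :: real
      proof -
        obtain n :: nat where "\<bar>x\<bar> \<le> real n" using real_arch_simple by blast
        then have "x \<in> {- real n..real n}" by auto
        then show ?thesis by blast
      qed
      then show ?thesis by blast
    qed
  qed (auto simp: fin)
  have "(\<integral>\<^sup>+y. ennreal (f y) * ennreal (l y s) \<partial>lborel) = (\<integral>\<^sup>+y. ennreal (f y) \<partial>\<nu>)"
    unfolding \<nu>_def by (simp add: nn_integral_density mult.commute)
  also have "\<dots> = (\<integral>\<^sup>+y. ennreal (f y) \<partial>\<mu>)" using \<open>\<mu> = \<nu>\<close> by simp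
  also have "\<dots> = (\<integral>\<^sup>+r. indicator {0..s} r * ennreal (f (\<gamma> r)) \<partial>lborel)"
    unfolding \<mu>_def by (simp add: nn_integral_distr nn_integral_density)
  also have "\<dots> = (\<integral>\<^sup>+r. ennreal (f (\<beta> r)) * indicator {0..s} r \<partial>lborel)"
    by (intro nn_integral_cong) (auto simp: indicator_def \<gamma>_def max_def)
  also have "\<dots> = ennreal (integral {0..s} (\<lambda>r. f (\<beta> r)))"
    using f by (intro nn_integral_Icc_eq_integral continuous_on_compose2[OF f(1) continuous_on_subset[OF path_cont]]) auto
  finally show ?thesis .
qed

end

section \<open>Absorption of a single path\<close>

lemma level_bound_density:
  fixes f :: "real \<Rightarrow> real"
  assumes f: "continuous_on UNIV f" "\<And>z. 0 \<le> f z" "\<And>z. z \<notin> {0<..<2 * a} \<Longrightarrow> f z = 0"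
    and a: "0 < a" and l: "0 < l" and \<epsilon>: "0 < \<epsilon>"
    and V: "\<And>x. 0 < x \<Longrightarrow> x \<le> 2 * a \<Longrightarrow> l * integral {0..x} (\<lambda>z. z\<^sup>2 * f z) \<le> x / 2"
    and K: "integral {0..2 * a} (\<lambda>z. z * f z) \<le> K"
    and BM: "brownian_motion_from M x B" and x: "0 < x"
  shows "\<exists>E\<in>sets M. {\<omega>\<in>space M. \<exists>s\<in>{0..real S}. (\<forall>r\<in>{0..s}. \<epsilon> < B r \<omega> \<and> B r \<omega> \<le> 2 * a) \<and>
        (\<exists>r\<in>{0..s}. a < B r \<omega>) \<and> t < integral {0..s} (\<lambda>r. f (B r \<omega>))} \<subseteq> E \<and>
     emeasure M E \<le> ennreal (6 * exp (2 * l * K - l * t / 12) * (x / a))"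
proof -
  have b: "0 < 2 * a" using a by simp
  have K0: "0 \<le> K"
  proof -
    have "0 \<le> integral {0..2 * a} (\<lambda>z. z * f z)"
      using f by (intro integral_nonneg integrable_continuous_real continuous_intros continuous_on_subset[OF f(1)]) auto
    then show ?thesis using K by simp
  qed
  obtain u u' qu v v' qv where *:
    "twice_diff u u' qu" "twice_diff v v' qv"
    "\<And>x. 0 \<le> x \<Longrightarrow> x * exp (- l * K) \<le> u x \<and> u x \<le> x"
    "\<And>x. 0 \<le> x \<Longrightarrow> 1 \<le> v x \<and> v x \<le> 6 * exp (l * K)"
    "\<And>x. 0 < x \<Longrightarrow> x \<le> 2 * a \<Longrightarrow> l / 6 * f x * u x \<le> qu x"
    "\<And>x. 0 < x \<Longrightarrow> x \<le> 2 * a \<Longrightarrow> l / 6 * f x * v x \<le> qv x"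
    "\<And>x. x \<notin> {0<..<2 * a} \<Longrightarrow> qu x = 0 \<and> qv x = 0"
    using barrier_functions[OF f b l V K] by blast
  \<comment> \<open>Chosen so that \<open>\<alpha> * a * exp (- l * K) = 6 * exp (l * K)\<close>:
    the lower bound of \<open>\<alpha> * u\<close> at \<open>a\<close> matches the upper bound of
    \<open>v\<close>.\<close>
  define \<alpha> where "\<alpha> = 6 * exp (2 * l * K) / a"
  have \<alpha>: "0 < \<alpha>" using a by (simp add: \<alpha>_def)
  \<comment> \<open>The rate \<open>l / 12\<close> is half of \<open>l / 6\<close>, the other factor
    \<open>2\<close> coming from the generator \<open>w'' / 2\<close>.\<close>
  interpret barrier f "\<lambda>x. \<alpha> * u x" "\<lambda>x. \<alpha> * u' x" "\<lambda>x. \<alpha> * qu x" v v' qv \<epsilon> a "2 * a" t "l / 12"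
  proof
    show "twice_diff (\<lambda>x. \<alpha> * u x) (\<lambda>x. \<alpha> * u' x) (\<lambda>x. \<alpha> * qu x)"
      unfolding twice_diff_def
    proof (intro conjI allI)
      fix x
      show "((\<lambda>x. \<alpha> * u x) has_real_derivative \<alpha> * u' x) (at x)"
        using *(1) unfolding twice_diff_def by (intro DERIV_cmult) blast
      have "(u' has_real_derivative - qu x) (at x)" using *(1) unfolding twice_diff_def by blast
      then show "((\<lambda>x. \<alpha> * u' x) has_real_derivative - (\<alpha> * qu x)) (at x)"
        using DERIV_cmult[of u' "- qu x" x UNIV \<alpha>] by simp
      show "continuous_on UNIV (\<lambda>x. \<alpha> * qu x)"
        using *(1) unfolding twice_diff_def by (intro continuous_on_mult_left) blast
    qed
    show "0 \<le> \<alpha> * u x" if "0 \<le> x" for x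
    proof -
      have "0 \<le> x * exp (- l * K)" using that by simp
      then have "0 \<le> u x" using *(3)[OF that] by linarith
      then show ?thesis using \<alpha> by simp
    qed
    show "v x \<le> \<alpha> * u x" if "0 \<le> x" "a \<le> x" for x
    proof -
      have "6 * exp (l * K) = \<alpha> * (a * exp (- l * K))"
        using a by (simp add: \<alpha>_def exp_minus field_simps flip: exp_add)
      also have "\<dots> \<le> \<alpha> * (x * exp (- l * K))" using \<alpha> that by simp
      also have "\<dots> \<le> \<alpha> * u x" using \<alpha> *(3)[OF that(1)] by simp
      finally show ?thesis using *(4)[OF that(1)] by linarith
    qed
    show "2 * (l / 12) * f x * (\<alpha> * u x) \<le> \<alpha> * qu x" if "0 < x" "x \<le> 2 * a" for x
      using mult_left_mono[OF *(5)[OF that], of \<alpha>] \<alpha> by (simp add: mult_ac)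
    show "2 * (l / 12) * f x * v x \<le> qv x" if "0 < x" "x \<le> 2 * a" for x
      using *(6)[OF that] by simp
  qed (use * f l \<epsilon> in auto)
  \<comment> \<open>Below \<open>a\<close> the factor \<open>x / a\<close> comes from
    \<open>u x <= x\<close>; from \<open>a\<close> on it is at least \<open>1\<close> and the bound
    on \<open>v\<close> suffices.\<close>
  have "potential (x, 0, x) \<le> 6 * exp (2 * l * K - l * t / 12) * (x / a)"
  proof -
    have "(if a \<le> x then v x else \<alpha> * u x) \<le> 6 * exp (2 * l * K) * (x / a)"
    proof (cases "a \<le> x")
      case True
      have "v x \<le> 6 * exp (l * K) * 1" using *(4)[of x] x by simp
      also have "\<dots> \<le> 6 * exp (2 * l * K) * (x / a)"
        using True a l K0 by (intro mult_mono) auto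
      finally show ?thesis using True by simp
    next
      case False
      have "\<alpha> * u x \<le> \<alpha> * x" using \<alpha> *(3)[of x] x by simp
      then show ?thesis using False by (simp add: \<alpha>_def)
    qed
    then have "exp (- l * t / 12) * (if a \<le> x then v x else \<alpha> * u x) \<le> exp (- l * t / 12) * (6 * exp (2 * l * K) * (x / a))"
      by (intro mult_left_mono) auto
    also have "\<dots> = 6 * (exp (2 * l * K) * exp (- l * t / 12)) * (x / a)" by (simp add: mult_ac)
    also have "exp (2 * l * K) * exp (- l * t / 12) = exp (2 * l * K - l * t / 12)"
      by (simp flip: exp_add)
    finally show ?thesis using x by (simp add: potential_def split: if_splits)
  qed
  then have le: "ennreal (potential (x, 0, x)) \<le> ennreal (6 * exp (2 * l * K - l * t / 12) * (x / a))"
    by (rule ennreal_leI)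
  have mono: "\<exists>E\<in>\<S>. P E \<and> emeasure M E \<le> q"
    if "\<exists>E\<in>\<S>. P E \<and> emeasure M E \<le> p" "p \<le> q" for \<S> P p q
  proof -
    from that(1) obtain E where "E \<in> \<S>" "P E" "emeasure M E \<le> p" by blast
    then show ?thesis using order_trans[OF _ that(2)] by blast
  qed
  show ?thesis by (rule mono[OF path_bound[OF BM, of S] le])
qed

lemma first_zero:
  fixes \<beta> :: "real \<Rightarrow> real"
  assumes path_cont: "continuous_on {0..} \<beta>" and "0 < \<beta> 0" "0 \<le> R" "\<beta> R \<le> 0"
  obtains T where "0 < T" "\<beta> T = 0" "\<And>r. 0 \<le> r \<Longrightarrow> r < T \<Longrightarrow> 0 < \<beta> r"
proof -
  let ?Z = "{0..R} \<inter> \<beta> -` {..0}"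
  have "closed ?Z" using path_cont
    by (intro continuous_closed_preimage) (auto elim: continuous_on_subset)
  then have "compact ?Z" by (simp add: compact_eq_bounded_closed bounded_Int)
  moreover have "?Z \<noteq> {}" using assms by auto
  ultimately obtain T where T: "T \<in> ?Z" "\<And>r. r \<in> ?Z \<Longrightarrow> T \<le> r"
    using compact_attains_inf[of ?Z] by blast
  have pos: "0 < \<beta> r" if "0 \<le> r" "r < T" for r
  proof (rule ccontr)
    assume "\<not> 0 < \<beta> r"
    then have "r \<in> ?Z" using that T(1) by auto
    then show False using T(2)[of r] that by simp
  qed
  have "T \<noteq> 0" using T(1) assms(2) by auto
  then have T0: "0 < T" using T(1) by auto
  have "\<exists>r\<ge>0. r \<le> T \<and> \<beta> r = 0"
    using T(1) assms(2) T0 path_cont by (intro IVT2') (auto elim: continuous_on_subset)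
  then obtain r where "0 \<le> r" "r \<le> T" "\<beta> r = 0" by blast
  then have "\<beta> T = 0" using pos[of r] by (cases "r = T") auto
  then show ?thesis using that T0 pos by blast
qed

context path_local_time
begin

definition clock :: "real measure \<Rightarrow> real \<Rightarrow> ennreal" where
  "clock m s = (\<integral>\<^sup>+y. ennreal (l y s) \<partial>m)"

lemma clock_mono: "0 \<le> s \<Longrightarrow> s \<le> s' \<Longrightarrow> clock m s \<le> clock m s'"
  unfolding clock_def by (intro nn_integral_mono ennreal_leI l_mono)

text \<open>Every positive level is avoided, so its local time is frozen, and the remaining levels
  carry no mass of \<open>m\<close>.\<close>

lemma clock_const:
  assumes m: "speed_measure m" and s: "0 \<le> s" "s \<le> s'"
    and neg: "\<And>r. s \<le> r \<Longrightarrow> r \<le> s' \<Longrightarrow> \<beta> r \<le> 0"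
  shows "clock m s' = clock m s"
proof -
  have "{..0} \<in> null_sets m" using m by (auto simp: speed_measure_def null_sets_def)
  then have "AE y in m. y \<notin> {..0}" by (rule AE_not_in)
  then have "AE y in m. ennreal (l y s') = ennreal (l y s)"
  proof eventually_elim
    case (elim y)
    then have "\<beta> r \<noteq> y" if "s \<le> r" "r \<le> s'" for r using neg[OF that] by auto
    then show ?case using l_const[OF s, of y] by simp
  qed
  then show ?thesis unfolding clock_def by (rule nn_integral_cong_AE)
qed

lemma clock_increases:
  assumes m: "speed_measure m" and s: "0 \<le> s" "s < r" "r \<le> s'" and \<beta>: "0 < \<beta> r"
    and fin: "clock m s < \<infinity>"
  shows "clock m s < clock m s'"
proof -
  have [measurable_cong, simp]: "sets m = sets borel" using m by (simp add: speed_measure_def)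
  have [measurable]: "(\<lambda>y. l y s) \<in> borel_measurable borel" "(\<lambda>y. l y s') \<in> borel_measurable borel"
    using s by (auto intro!: borel_measurable_continuous_onI l_cont_space)
  obtain W where W: "open W" "W \<noteq> {}" "W \<subseteq> {0<..}" "\<And>y. y \<in> W \<Longrightarrow> l y s < l y s'"
    using l_increases[OF s \<beta>] by blast
  have "0 < emeasure m W" using m W by (auto simp: speed_measure_def)
  have "(\<integral>\<^sup>+y. ennreal (l y s' - l y s) \<partial>m) \<noteq> 0"
  proof
    assume "(\<integral>\<^sup>+y. ennreal (l y s' - l y s) \<partial>m) = 0"
    then have "AE y in m. ennreal (l y s' - l y s) = 0"
      by (subst (asm) nn_integral_0_iff_AE) simp_all
    then have "AE y in m. y \<notin> W"
    proof eventually_elim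
      case (elim y)
      then show ?case using W(4)[of y] by (auto simp: ennreal_eq_0_iff)
    qed
    then have "W \<in> null_sets m" using W(1) by (subst AE_iff_null_sets) simp_all
    then show False using \<open>0 < emeasure m W\<close> by (simp add: null_sets_def)
  qed
  moreover have "clock m s' = clock m s + (\<integral>\<^sup>+y. ennreal (l y s' - l y s) \<partial>m)"
  proof -
    have "ennreal (l y s') = ennreal (l y s) + ennreal (l y s' - l y s)" for y
      using l_mono[of s s' y] l_nonneg[of s y] s by (simp flip: ennreal_plus)
    then have "clock m s' = (\<integral>\<^sup>+y. ennreal (l y s) + ennreal (l y s' - l y s) \<partial>m)"
      unfolding clock_def by (intro nn_integral_cong)
    also have "\<dots> = clock m s + (\<integral>\<^sup>+y. ennreal (l y s' - l y s) \<partial>m)"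
      unfolding clock_def by (rule nn_integral_add) simp_all
    finally show ?thesis .
  qed
  ultimately show ?thesis using fin
    by (metis add.right_neutral ennreal_add_left_cancel_less infinity_ennreal_def less_irrefl not_gr_zero top.not_eq_extremum)
qed

lemma absorption_le:
  assumes m: "speed_measure m" and t: "0 \<le> t"
    and start: "0 < \<beta> 0" and hit: "0 \<le> R" "\<beta> R \<le> 0"
    and recur: "\<And>T. 0 \<le> T \<Longrightarrow> \<exists>r>T. 0 < \<beta> r"
    and clock: "\<And>s. 0 \<le> s \<Longrightarrow> (\<And>r. 0 \<le> r \<Longrightarrow> r \<le> s \<Longrightarrow> 0 < \<beta> r) \<Longrightarrow> clock m s \<le> ennreal t"
  shows "\<exists>u. 0 \<le> u \<and> u \<le> t \<and> (\<exists>s. Inf {ereal s | s. 0 \<le> s \<and> clock m s > ennreal u} = ereal s \<and> \<beta> s = 0)"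
proof -
  have [measurable_cong, simp]: "sets m = sets borel" using m by (simp add: speed_measure_def)
  have l_meas[measurable]: "(\<lambda>y. l y s) \<in> borel_measurable m" if "0 \<le> s" for s
    using borel_measurable_continuous_onI[OF l_cont_space[OF that]] by simp
  obtain T where T: "0 < T" "\<beta> T = 0" "\<And>r. 0 \<le> r \<Longrightarrow> r < T \<Longrightarrow> 0 < \<beta> r"
    using first_zero[OF path_cont start hit] by blast
  define \<tau> where "\<tau> n = T - T / real (Suc n)" for n
  have \<tau>: "0 \<le> \<tau> n" "\<tau> n < T" for n
    using T(1) by (auto simp: \<tau>_def field_simps)
  have lim: "\<tau> \<longlonglongrightarrow> T"
    unfolding \<tau>_def using tendsto_diff[OF tendsto_const LIMSEQ_Suc[OF lim_const_over_n[of T]], of T] by simp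
  \<comment> \<open>The bound \<open>t\<close> is assumed only while the path is positive; Fatou
    along times increasing to \<open>T\<close> carries it over to \<open>T\<close>.\<close>
  have "clock m T = (\<integral>\<^sup>+y. liminf (\<lambda>n. ennreal (l y (\<tau> n))) \<partial>m)"
    unfolding clock_def
  proof (rule nn_integral_cong)
    fix y
    have "(\<lambda>n. l y (\<tau> n)) \<longlonglongrightarrow> l y T"
      by (rule continuous_on_tendsto_compose[OF l_cont_time lim]) (use T \<tau> in auto)
    then have "(\<lambda>n. ennreal (l y (\<tau> n))) \<longlonglongrightarrow> ennreal (l y T)" by (rule tendsto_ennrealI)
    then show "ennreal (l y T) = liminf (\<lambda>n. ennreal (l y (\<tau> n)))"
      by (intro lim_imp_Liminf[symmetric]) auto
  qed
  also have "\<dots> \<le> liminf (\<lambda>n. clock m (\<tau> n))"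
    unfolding clock_def by (rule nn_integral_liminf) (simp add: \<tau>)
  also have "\<dots> \<le> liminf (\<lambda>n. ennreal t)"
  proof (intro Liminf_mono always_eventually allI clock)
    show "0 < \<beta> r" if "0 \<le> r" "r \<le> \<tau> n" for r n using T(3)[of r] \<tau>(2)[of n] that by auto
  qed (rule \<tau>)
  also have "\<dots> = ennreal t" by (simp add: Liminf_const)
  finally have AT: "clock m T \<le> ennreal t" .
  then have fin: "clock m T < \<infinity>" by (simp add: le_less_trans)
  define u where "u = enn2real (clock m T)"
  have u: "ennreal u = clock m T" "0 \<le> u" using fin by (auto simp: u_def)
  have ut: "u \<le> t" using AT t u(2) unfolding u(1)[symmetric] by (simp add: ennreal_le_iff)
  define S where "S = {s. 0 \<le> s \<and> clock m s > ennreal u}"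
  define s0 where "s0 = Inf S"
  have ST: "T \<le> s" if "s \<in> S" for s
  proof (rule ccontr)
    assume "\<not> T \<le> s"
    then have "clock m s \<le> clock m T" using that by (intro clock_mono) (auto simp: S_def)
    then show False using that u by (auto simp: S_def)
  qed
  have inc: "s \<in> S" if "T < r" "r \<le> s" "0 < \<beta> r" for r s
    using clock_increases[OF m _ that fin] T(1) that by (simp add: S_def u)
  obtain r where "T < r" "0 < \<beta> r" using recur[of T] T(1) by auto
  then have Sne: "S \<noteq> {}" using inc[of r r] by auto
  have bdd: "bdd_below S" using ST by (rule bdd_belowI)
  have Ts0: "T \<le> s0" unfolding s0_def using Sne ST by (rule cInf_greatest)
  have below: "s \<notin> S" if "s < s0" for s
    using that cInf_lower[OF _ bdd, of s] unfolding s0_def by (auto simp: not_le[symmetric])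
  have above: "s \<in> S" if "s0 < s" for s
  proof -
    have "\<exists>s'\<in>S. s' < s" using that cInf_lessD[OF Sne, of s] unfolding s0_def by blast
    then obtain s' where "s' \<in> S" "s' < s" by blast
    then show ?thesis using clock_mono[of s' s m] unfolding S_def by (auto intro: less_le_trans)
  qed
  \<comment> \<open>Possibly \<open>s0 > T\<close>, if the path stays nonpositive after
    \<open>T\<close>. A positive value at \<open>s0\<close> would have raised the clock before
    \<open>s0\<close>; a negative one would keep the clock constant across \<open>s0\<close>. Both
    contradict that \<open>s0\<close> is the infimum of \<open>S\<close>.\<close>
  have "\<beta> s0 = 0"
  proof (rule ccontr)
    assume nz: "\<beta> s0 \<noteq> 0"
    then have Ts: "T < s0" using Ts0 T(2) by (cases "T = s0") auto
    have "continuous (at s0 within {0..}) \<beta>"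
      using path_cont Ts T(1) by (simp add: continuous_on_eq_continuous_within)
    then obtain d where d: "0 < d" "\<And>r. 0 \<le> r \<Longrightarrow> dist r s0 < d \<Longrightarrow> dist (\<beta> r) (\<beta> s0) < \<bar>\<beta> s0\<bar>"
      unfolding continuous_within_eps_delta using nz by (metis atLeast_iff zero_less_abs_iff)
    define s1 where "s1 = max ((T + s0) / 2) (s0 - d / 2)"
    have s1: "T < s1" "s1 < s0" "s0 - d < s1" using Ts d(1) by (auto simp: s1_def max_def)
    consider "0 < \<beta> s0" | "\<beta> s0 < 0" using nz by linarith
    then show False
    proof cases
      case 1
      have "0 < \<beta> s1" using d(2)[of s1] s1 T(1) 1 by (auto simp: dist_real_def)
      then show False using inc[of s1 s1] s1 below[of s1] by auto
    next
      case 2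
      have "\<beta> r \<le> 0" if "s1 \<le> r" "r \<le> s0 + d / 2" for r
      proof -
        have "dist r s0 < d" using s1 d(1) that unfolding dist_real_def by linarith
        then have "dist (\<beta> r) (\<beta> s0) < \<bar>\<beta> s0\<bar>" using s1 T(1) that by (intro d(2)) auto
        then show ?thesis using 2 unfolding dist_real_def by linarith
      qed
      then have "clock m (s0 + d / 2) = clock m s1"
        using s1 T(1) d(1) by (intro clock_const[OF m]) auto
      then show False using above[of "s0 + d / 2"] below[of s1] s1 T(1) d(1) by (auto simp: S_def)
    qed
  qed
  moreover have "Inf {ereal s | s. 0 \<le> s \<and> clock m s > ennreal u} = ereal s0"
  proof -
    have "{ereal s | s. 0 \<le> s \<and> clock m s > ennreal u} = ereal ` S" by (auto simp: S_def)
    then show ?thesis unfolding s0_def using ereal_Inf'[OF bdd Sne] by simp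
  qed
  ultimately show ?thesis using u(2) ut by blast
qed

end

section \<open>Mollified speed measures\<close>

text \<open>The support \<open>[0, 1/n]\<close> is one-sided and \<open>m\<close> is cut off at \<open>1/n\<close>: mass only moves to the right, by
  a factor of at most \<open>2\<close>, so moments over \<open>(0, x)\<close> grow at most by a factor \<open>2\<^sup>p\<close>.\<close>
definition bump :: "nat \<Rightarrow> real \<Rightarrow> real" where
  "bump n r = real n * (6 * max 0 (real n * r * (1 - real n * r)))"

lemma bump_nonneg: "0 \<le> bump n r"
  by (simp add: bump_def)

lemma bump_le: "bump n r \<le> 6 * real n"
proof -
  have "x * (1 - x) \<le> 1" for x :: real
    using zero_le_power2[of "x - 1 / 2"] by (simp add: power2_eq_square algebra_simps)
  then have "max 0 (real n * r * (1 - real n * r)) \<le> 1" by simp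
  then have "real n * (6 * max 0 (real n * r * (1 - real n * r))) \<le> real n * (6 * 1)"
    by (intro mult_left_mono) auto
  then show ?thesis by (simp add: bump_def)
qed

lemma continuous_on_bump[continuous_intros]:
  "continuous_on S g \<Longrightarrow> continuous_on S (\<lambda>x. bump n (g x))"
  unfolding bump_def by (intro continuous_intros)

lemma measurable_bump[measurable]: "bump n \<in> borel_measurable borel"
  unfolding bump_def by measurable

lemma bump_eq_0:
  assumes "r \<le> 0 \<or> 1 / real n \<le> r"
  shows "bump n r = 0"
proof (cases "n = 0")
  case False
  have "real n * r * (1 - real n * r) \<le> 0"
    using assms
  proof
    assume r: "r \<le> 0"
    then have "real n * r \<le> 0" by (simp add: mult_nonneg_nonpos)
    then show ?thesis by (rule mult_nonpos_nonneg) (use \<open>real n * r \<le> 0\<close> in linarith)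
  next
    assume "1 / real n \<le> r"
    then have "1 \<le> real n * r" using False by (simp add: field_simps)
    then show ?thesis by (intro mult_nonneg_nonpos) linarith+
  qed
  then show ?thesis by (simp add: bump_def)
qed (simp add: bump_def)

lemma nn_integral_bump:
  assumes n: "0 < n"
  shows "(\<integral>\<^sup>+y. ennreal (bump n (y - z)) \<partial>lborel) = 1"
proof -
  have "((\<lambda>x::real. 6 * (x * (1 - x))) has_integral (3 * 1\<^sup>2 - 2 * 1 ^ 3) - (3 * 0\<^sup>2 - 2 * 0 ^ 3)) {0..1}"
    by (rule fundamental_theorem_of_calculus)
       (auto intro!: derivative_eq_intros simp: has_real_derivative_iff_has_vector_derivative[symmetric] power2_eq_square algebra_simps)
  from integral_unique[OF this] have "integral {0..1} (\<lambda>x::real. 6 * (x * (1 - x))) = 1"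
    by (rule trans) simp
  moreover have "(\<integral>\<^sup>+x. ennreal (6 * (x * (1 - x))) * indicator {0..1} x \<partial>lborel) = ennreal (integral {0..1} (\<lambda>x::real. 6 * (x * (1 - x))))"
    by (rule nn_integral_Icc_eq_integral) (auto intro!: continuous_intros)
  moreover have "(\<integral>\<^sup>+x. ennreal (6 * max 0 (x * (1 - x))) \<partial>lborel) = (\<integral>\<^sup>+x. ennreal (6 * (x * (1 - x))) * indicator {0..1} x \<partial>lborel)"
  proof (intro nn_integral_cong)
    fix x :: real
    have "x * (1 - x) \<le> 0" if "x \<notin> {0..1}"
      using that by (cases "x < 0") (auto intro: mult_nonpos_nonneg mult_nonneg_nonpos)
    then show "ennreal (6 * max 0 (x * (1 - x))) = ennreal (6 * (x * (1 - x))) * indicator {0..1} x"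
      by (cases "x \<in> {0..1}") (auto simp: max_def)
  qed
  ultimately have 1: "(\<integral>\<^sup>+x. ennreal (6 * max 0 (x * (1 - x))) \<partial>lborel) = 1" by simp
  have "(\<integral>\<^sup>+y. ennreal (bump n (y - z)) \<partial>lborel)
      = \<bar>1 / real n\<bar> * (\<integral>\<^sup>+x. ennreal (bump n (z + 1 / real n * x - z)) \<partial>lborel)"
    by (rule nn_integral_real_affine) (use n in auto)
  also have "\<dots> = \<bar>1 / real n\<bar> * (\<integral>\<^sup>+x. ennreal (real n) * ennreal (6 * max 0 (x * (1 - x))) \<partial>lborel)"
    using n by (simp add: bump_def ennreal_mult)
  also have "\<dots> = \<bar>1 / real n\<bar> * (ennreal (real n) * 1)"
    by (subst nn_integral_cmult) (simp_all add: 1)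
  also have "\<dots> = 1" using n by (simp flip: ennreal_mult)
  finally show ?thesis .
qed

text \<open>The upper cut-off \<open>b - 1 / n\<close> leaves space for the spreading to the right,
  so the density vanishes outside \<open>(0, b)\<close>, as the barrier functions require.\<close>

definition mollified :: "real measure \<Rightarrow> real \<Rightarrow> nat \<Rightarrow> real \<Rightarrow> real" where
  "mollified m b n y = (LINT z|m. bump n (y - z) * indicator {1 / real n..b - 1 / real n} z)"

locale mollifier =
  fixes m :: "real measure" and b :: real and n :: nat
  assumes m: "speed_measure m" and n: "0 < n"
begin

lemma sets_speed[measurable_cong, simp]: "sets m = sets borel"
  using m by (simp add: speed_measure_def)

lemma space_speed[simp]: "space m = UNIV"
  using sets_eq_imp_space_eq[OF sets_speed] by simp

lemma emeasure_core: "emeasure m {1 / real n..b - 1 / real n} < \<infinity>"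
proof -
  have "{1 / real n..b - 1 / real n} \<subseteq> {0<..}" using n by (auto intro: less_le_trans[of 0 "1 / real n"])
  then show ?thesis using m by (auto simp: speed_measure_def)
qed

lemma integrable_mollified: "integrable m (\<lambda>z. bump n (y - z) * indicator {1 / real n..b - 1 / real n} z)"
proof (rule Bochner_Integration.integrable_bound)
  show "integrable m (\<lambda>z. 6 * real n * indicator {1 / real n..b - 1 / real n} z)"
    using emeasure_core by (intro integrable_mult_right integrable_real_indicator) auto
  show "AE z in m. norm (bump n (y - z) * indicator {1 / real n..b - 1 / real n} z)
      \<le> norm (6 * real n * indicator {1 / real n..b - 1 / real n} z)"
    using bump_nonneg bump_le by (intro AE_I2) (auto simp: indicator_def)
qed measurable

lemma mollified_nonneg: "0 \<le> mollified m b n y"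
  unfolding mollified_def using bump_nonneg by (intro integral_nonneg_AE AE_I2) (simp add: indicator_def)

lemma ennreal_mollified:
  "ennreal (mollified m b n y) = (\<integral>\<^sup>+z. ennreal (bump n (y - z)) * indicator {1 / real n..b - 1 / real n} z \<partial>m)"
proof -
  have "ennreal (mollified m b n y) = (\<integral>\<^sup>+z. ennreal (bump n (y - z) * indicator {1 / real n..b - 1 / real n} z) \<partial>m)"
    unfolding mollified_def using bump_nonneg
    by (intro nn_integral_eq_integral[symmetric] integrable_mollified AE_I2) (simp add: indicator_def)
  also have "\<dots> = (\<integral>\<^sup>+z. ennreal (bump n (y - z)) * indicator {1 / real n..b - 1 / real n} z \<partial>m)"
    by (intro nn_integral_cong) (simp add: indicator_def)
  finally show ?thesis .
qed

lemma mollified_eq_0: "y \<notin> {0<..<b} \<Longrightarrow> mollified m b n y = 0"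
proof -
  assume y: "y \<notin> {0<..<b}"
  have "bump n (y - z) * indicator {1 / real n..b - 1 / real n} z = 0" for z
  proof (cases "z \<in> {1 / real n..b - 1 / real n}")
    case True
    moreover have "0 < 1 / real n" using n by simp
    ultimately have "y - z \<le> 0 \<or> 1 / real n \<le> y - z" using y by auto
    then show ?thesis using bump_eq_0 by simp
  qed simp
  then have "mollified m b n y = (LINT z|m. 0)"
    unfolding mollified_def by (intro Bochner_Integration.integral_cong refl)
  then show ?thesis by simp
qed

lemma continuous_mollified: "continuous_on UNIV (mollified m b n)"
proof -
  have "isCont (mollified m b n) y" for y
  proof (rule continuous_at_sequentiallyI)
    fix u assume u: "u \<longlonglongrightarrow> y"
    show "(\<lambda>k. mollified m b n (u k)) \<longlonglongrightarrow> mollified m b n y"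
      unfolding mollified_def
    proof (rule integral_dominated_convergence[where w = "\<lambda>z. 6 * real n * indicator {1 / real n..b - 1 / real n} z"])
      show "integrable m (\<lambda>z. 6 * real n * indicator {1 / real n..b - 1 / real n} z)"
        using emeasure_core by (intro integrable_mult_right integrable_real_indicator) auto
      show "AE z in m. (\<lambda>k. bump n (u k - z) * indicator {1 / real n..b - 1 / real n} z)
          \<longlonglongrightarrow> bump n (y - z) * indicator {1 / real n..b - 1 / real n} z"
      proof (intro AE_I2 tendsto_mult_right)
        fix z
        have "continuous_on UNIV (\<lambda>x. bump n (x - z))" by (intro continuous_intros)
        then show "(\<lambda>k. bump n (u k - z)) \<longlonglongrightarrow> bump n (y - z)"
          using u by (rule continuous_on_tendsto_compose) auto
      qed
      show "AE z in m. norm (bump n (u k - z) * indicator {1 / real n..b - 1 / real n} z)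
          \<le> 6 * real n * indicator {1 / real n..b - 1 / real n} z" for k
        using bump_nonneg bump_le by (intro AE_I2) (auto simp: indicator_def)
    qed measurable
  qed
  then show ?thesis by (simp add: continuous_on_eq_continuous_at)
qed

lemma sigma_finite_speed: "sigma_finite_measure m"
proof
  \<comment> \<open>\<open>m\<close> is finite only on compact subsets of the open half line; the
    null set \<open>{..0}\<close> covers the rest.\<close>
  let ?A = "insert {..0} (range (\<lambda>k. {1 / real (Suc k)..real k}))"
  have "x \<in> \<Union> ?A" for x :: real
  proof (cases "x \<le> 0")
    case False
    obtain k1 where k1: "1 / real (Suc k1) < x" using False nat_approx_posE by (metis not_le)
    obtain k2 where k2: "x \<le> real k2" using real_arch_simple by blast
    have "1 / real (Suc (max k1 k2)) \<le> 1 / real (Suc k1)" by (intro divide_left_mono) auto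
    then have "x \<in> {1 / real (Suc (max k1 k2))..real (max k1 k2)}" using k1 k2 by auto
    then show ?thesis by blast
  qed simp
  moreover have "emeasure m X \<noteq> \<infinity>" if "X \<in> ?A" for X
  proof -
    have "{1 / real (Suc k)..real k} \<subseteq> {0<..}" for k by (auto intro: less_le_trans[of 0 "1 / real (Suc k)"])
    then have "emeasure m {1 / real (Suc k)..real k} < \<infinity>" for k
      using m by (auto simp: speed_measure_def)
    then show ?thesis using that m by (auto simp: speed_measure_def less_top)
  qed
  ultimately show "\<exists>A. countable A \<and> A \<subseteq> sets m \<and> \<Union> A = space m \<and> (\<forall>a\<in>A. emeasure m a \<noteq> \<infinity>)"
  proof (intro exI[of _ ?A] conjI ballI)
    show "\<Union> ?A = space m" unfolding space_speed using \<open>\<And>x. x \<in> \<Union> ?A\<close> by blast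
    show "?A \<subseteq> sets m" by (intro subsetI) auto
  qed simp_all
qed

lemma nn_integral_mollified:
  assumes [measurable]: "g \<in> borel_measurable borel"
  shows "(\<integral>\<^sup>+y. g y * ennreal (mollified m b n y) \<partial>lborel)
    = (\<integral>\<^sup>+z. (\<integral>\<^sup>+y. g y * ennreal (bump n (y - z)) \<partial>lborel) * indicator {1 / real n..b - 1 / real n} z \<partial>m)"
proof -
  interpret m: sigma_finite_measure m by (rule sigma_finite_speed)
  interpret pair_sigma_finite lborel m ..
  have "(\<integral>\<^sup>+y. g y * ennreal (mollified m b n y) \<partial>lborel)
      = (\<integral>\<^sup>+y. \<integral>\<^sup>+z. g y * (ennreal (bump n (y - z)) * indicator {1 / real n..b - 1 / real n} z) \<partial>m \<partial>lborel)"
    by (subst nn_integral_cmult) (simp_all add: ennreal_mollified)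
  also have "\<dots> = (\<integral>\<^sup>+z. \<integral>\<^sup>+y. g y * (ennreal (bump n (y - z)) * indicator {1 / real n..b - 1 / real n} z) \<partial>lborel \<partial>m)"
    by (rule Fubini'[symmetric]) simp
  also have "\<dots> = (\<integral>\<^sup>+z. (\<integral>\<^sup>+y. g y * ennreal (bump n (y - z)) \<partial>lborel) * indicator {1 / real n..b - 1 / real n} z \<partial>m)"
    by (intro nn_integral_cong) (auto simp: nn_integral_multc mult.assoc[symmetric])
  finally show ?thesis .
qed

lemma mollified_moment_le:
  assumes x: "x \<le> b"
  shows "ennreal (integral {0..x} (\<lambda>y. y ^ p * mollified m b n y)) \<le> 2 ^ p * (\<integral>\<^sup>+z. ennreal (z ^ p) * indicator {0<..<x} z \<partial>m)"
proof -
  have "ennreal (integral {0..x} (\<lambda>y. y ^ p * mollified m b n y))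
      = (\<integral>\<^sup>+y. ennreal (y ^ p * mollified m b n y) * indicator {0..x} y \<partial>lborel)"
    using mollified_nonneg
    by (intro nn_integral_Icc_eq_integral[symmetric] continuous_intros continuous_on_subset[OF continuous_mollified]) auto
  also have "\<dots> = (\<integral>\<^sup>+y. (ennreal (y ^ p) * indicator {0..x} y) * ennreal (mollified m b n y) \<partial>lborel)"
    by (intro nn_integral_cong) (simp add: indicator_def ennreal_mult mollified_nonneg)
  also have "\<dots> = (\<integral>\<^sup>+z. (\<integral>\<^sup>+y. (ennreal (y ^ p) * indicator {0..x} y) * ennreal (bump n (y - z)) \<partial>lborel)
      * indicator {1 / real n..b - 1 / real n} z \<partial>m)"
    by (rule nn_integral_mollified) simp
  also have "\<dots> \<le> (\<integral>\<^sup>+z. 2 ^ p * (ennreal (z ^ p) * indicator {0<..<x} z) \<partial>m)"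
  proof (intro nn_integral_mono)
    fix z
    show "(\<integral>\<^sup>+y. (ennreal (y ^ p) * indicator {0..x} y) * ennreal (bump n (y - z)) \<partial>lborel)
      * indicator {1 / real n..b - 1 / real n} z \<le> 2 ^ p * (ennreal (z ^ p) * indicator {0<..<x} z)"
    proof (cases "z \<in> {1 / real n..b - 1 / real n}")
      case True
      have z: "0 < z" "1 / real n \<le> z" using True n by (auto intro: less_le_trans[of 0 "1 / real n"])
      have "(ennreal (y ^ p) * indicator {0..x} y) * ennreal (bump n (y - z))
          \<le> (2 ^ p * (ennreal (z ^ p) * indicator {0<..<x} z)) * ennreal (bump n (y - z))" for y
      proof (cases "z < y \<and> y < z + 1 / real n \<and> y \<le> x")
        case y: True
        have "y ^ p \<le> (2 * z) ^ p" using y z by (intro power_mono) auto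
        then have "ennreal (y ^ p) \<le> ennreal ((2 * z) ^ p)" by (rule ennreal_leI)
        also have "\<dots> = ennreal (2 ^ p) * ennreal (z ^ p)"
          using z by (simp add: power_mult_distrib ennreal_mult)
        also have "ennreal (2 ^ p) = 2 ^ p" using ennreal_power[of 2 p] by simp
        finally have "ennreal (y ^ p) \<le> 2 ^ p * ennreal (z ^ p)" .
        then show ?thesis using y z by (intro mult_right_mono) (auto simp: indicator_def)
      next
        case False
        then have "bump n (y - z) = 0 \<or> indicator {0..x} y = (0::ennreal)"
          using bump_eq_0[of "y - z" n] by (auto simp: indicator_def)
        then show ?thesis by auto
      qed
      then have "(\<integral>\<^sup>+y. (ennreal (y ^ p) * indicator {0..x} y) * ennreal (bump n (y - z)) \<partial>lborel)
          \<le> (\<integral>\<^sup>+y. (2 ^ p * (ennreal (z ^ p) * indicator {0<..<x} z)) * ennreal (bump n (y - z)) \<partial>lborel)"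
        by (intro nn_integral_mono)
      also have "\<dots> = 2 ^ p * (ennreal (z ^ p) * indicator {0<..<x} z)"
        by (subst nn_integral_cmult) (simp_all add: nn_integral_bump[OF n])
      finally show ?thesis using True by simp
    qed simp
  qed
  also have "\<dots> = 2 ^ p * (\<integral>\<^sup>+z. ennreal (z ^ p) * indicator {0<..<x} z \<partial>m)"
    by (rule nn_integral_cmult) simp
  finally show ?thesis .
qed

end

text \<open>Fatou is enough, since the approximating clocks only have to exceed \<open>t\<close>
  when the true one does. Every \<open>z\<close> in \<open>(0, b)\<close> eventually lies in the
  cut-off window, and beyond \<open>b\<close> nothing is lost because \<open>g\<close> vanishes
  there.\<close>

lemma nn_integral_le_liminf_mollified:
  assumes m: "speed_measure m" and g: "continuous_on UNIV g" "\<And>y. 0 \<le> g y" "\<And>y. b \<le> y \<Longrightarrow> g y = 0"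
  shows "(\<integral>\<^sup>+z. ennreal (g z) \<partial>m) \<le> liminf (\<lambda>n. \<integral>\<^sup>+y. ennreal (g y) * ennreal (mollified m b (Suc n) y) \<partial>lborel)"
proof -
  have [measurable_cong, simp]: "sets m = sets borel" using m by (simp add: speed_measure_def)
  have [measurable]: "g \<in> borel_measurable borel" by (rule borel_measurable_continuous_onI[OF g(1)])
  define F where "F k z = (\<integral>\<^sup>+y. ennreal (g y) * ennreal (bump k (y - z)) \<partial>lborel)
     * indicator {1 / real k..b - 1 / real k} z" for k z
  have [measurable]: "F k \<in> borel_measurable m" for k unfolding F_def by measurable
  have "{..0} \<in> null_sets m" using m by (auto simp: speed_measure_def null_sets_def)
  then have "AE z in m. z \<notin> {..0}" by (rule AE_not_in)
  then have "AE z in m. ennreal (g z) \<le> liminf (\<lambda>n. F (Suc n) z)"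
  proof eventually_elim
    case (elim z)
    show ?case
    proof (cases "b \<le> z")
      case True
      then show ?thesis using g(3) by simp
    next
      case False
      show ?thesis
      proof (rule ennreal_le_epsilon)
        fix e :: real assume e: "0 < e"
        have "\<forall>\<^sub>F y in at z. g z - e < g y"
          using g(1) e by (intro order_tendstoD(1)[of g "g z"]) (auto simp: continuous_on_def)
        then obtain d where d: "0 < d" "\<And>y. y \<noteq> z \<Longrightarrow> dist y z < d \<Longrightarrow> g z - e < g y"
          unfolding eventually_at by blast
        have L: "(\<lambda>n. 1 / real (Suc n)) \<longlonglongrightarrow> 0" by (rule LIMSEQ_Suc[OF lim_1_over_n])
        have "\<forall>\<^sub>F n in sequentially. 1 / real (Suc n) < min d (min z (b - z))"
          using d elim False by (intro order_tendstoD(2)[OF L]) auto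
        then have "\<forall>\<^sub>F n in sequentially. ennreal (g z - e) \<le> F (Suc n) z"
        proof eventually_elim
          case (elim n)
          have "ennreal (g z - e) * ennreal (bump (Suc n) (y - z)) \<le> ennreal (g y) * ennreal (bump (Suc n) (y - z))" for y
          proof (cases "z < y \<and> y < z + 1 / real (Suc n)")
            case True
            then have "g z - e < g y" using d(2)[of y] elim by (auto simp: dist_real_def)
            then show ?thesis by (intro mult_right_mono ennreal_leI) auto
          next
            case False
            then have "bump (Suc n) (y - z) = 0" by (intro bump_eq_0) auto
            then show ?thesis by simp
          qed
          then have "(\<integral>\<^sup>+y. ennreal (g z - e) * ennreal (bump (Suc n) (y - z)) \<partial>lborel)
              \<le> (\<integral>\<^sup>+y. ennreal (g y) * ennreal (bump (Suc n) (y - z)) \<partial>lborel)"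
            by (intro nn_integral_mono)
          moreover have "(\<integral>\<^sup>+y. ennreal (g z - e) * ennreal (bump (Suc n) (y - z)) \<partial>lborel) = ennreal (g z - e)"
            by (subst nn_integral_cmult) (simp_all add: nn_integral_bump)
          ultimately show ?case using elim unfolding F_def by simp
        qed
        then have "ennreal (g z - e) \<le> liminf (\<lambda>n. F (Suc n) z)" by (rule Liminf_bounded)
        then have "ennreal (g z - e) + ennreal e \<le> liminf (\<lambda>n. F (Suc n) z) + ennreal e" by (rule add_right_mono)
        moreover have "ennreal (g z) \<le> ennreal (g z - e) + ennreal e"
          using e g(2)[of z] by (cases "g z \<le> e") (auto simp: ennreal_neg ennreal_leI simp flip: ennreal_plus)
        ultimately show "ennreal (g z) \<le> liminf (\<lambda>n. F (Suc n) z) + ennreal e" by (rule order_trans[rotated])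
      qed
    qed
  qed
  then have "(\<integral>\<^sup>+z. ennreal (g z) \<partial>m) \<le> (\<integral>\<^sup>+z. liminf (\<lambda>n. F (Suc n) z) \<partial>m)" by (rule nn_integral_mono_AE)
  also have "\<dots> \<le> liminf (\<lambda>n. \<integral>\<^sup>+z. F (Suc n) z \<partial>m)" by (rule nn_integral_liminf) simp
  also have "(\<lambda>n. \<integral>\<^sup>+z. F (Suc n) z \<partial>m) = (\<lambda>n. \<integral>\<^sup>+y. ennreal (g y) * ennreal (mollified m b (Suc n) y) \<partial>lborel)"
    unfolding F_def by (intro ext mollifier.nn_integral_mollified[OF mollifier.intro, symmetric]) (simp_all add: m)
  finally show ?thesis .
qed

section \<open>Survival within one dyadic level\<close>

lemma path_local_time_of:
  assumes "brownian_motion_from M x B" "local_time_of M B L" "\<omega> \<in> space M"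
  shows "path_local_time (\<lambda>r. B r \<omega>) (\<lambda>y s. L y s \<omega>)"
proof
  show "continuous_on {0..} (\<lambda>r. B r \<omega>)" using assms by (simp add: brownian_motion_from_def)
  show "continuous_on (UNIV \<times> {0..}) (\<lambda>(y, s). L y s \<omega>)"
    using assms by (auto simp: local_time_of_def)
  show "0 \<le> L y s \<omega>" if "0 \<le> s" for y s
    using assms that by (auto simp: local_time_of_def)
  show "measure lborel {r \<in> {0..s}. B r \<omega> \<in> {a..b}} = integral {a..b} (\<lambda>y. L y s \<omega>)" if "0 \<le> s" "a \<le> b" for s a b
    using assms that unfolding local_time_of_def by blast
qed

text \<open>The factors \<open>4\<close> and \<open>2\<close> in the moment conditions are the
  growth \<open>2^2\<close> and \<open>2^1\<close> of second and first moments under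
  mollification.\<close>

lemma level_bound:
  assumes m: "speed_measure m" and a: "0 < a" and l: "0 < l" and t: "0 \<le> t" and K0: "0 \<le> K"
    and V: "\<And>x. 0 < x \<Longrightarrow> x \<le> 2 * a \<Longrightarrow>
      ennreal (4 * l) * (\<integral>\<^sup>+z. ennreal (z\<^sup>2) * indicator {0<..<x} z \<partial>m) \<le> ennreal (x / 2)"
    and K: "2 * (\<integral>\<^sup>+z. ennreal z * indicator {0<..<2 * a} z \<partial>m) \<le> ennreal K"
    and BM: "brownian_motion_from M x B" and L: "local_time_of M B L" and x: "0 < x"
  shows "\<exists>E\<in>sets M. {\<omega>\<in>space M. \<exists>s\<ge>0. (\<forall>r\<in>{0..s}. 0 < B r \<omega> \<and> B r \<omega> \<le> 2 * a) \<and>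
        (\<exists>r\<in>{0..s}. a < B r \<omega>) \<and> ennreal t < additive_functional m L s \<omega>} \<subseteq> E \<and>
     emeasure M E \<le> ennreal (6 * exp (2 * l * K - l * t / 12) * (x / a))"
proof -
  define f where "f k = mollified m (2 * a) (Suc k)" for k
  define p where "p = ennreal (6 * exp (2 * l * K - l * t / 12) * (x / a))"
  have mol: "mollifier m (Suc k)" for k using m by (simp add: mollifier_def)
  have f: "continuous_on UNIV (f k)" "0 \<le> f k z" "z \<notin> {0<..<2 * a} \<Longrightarrow> f k z = 0" for k z
    unfolding f_def using mollifier.continuous_mollified[OF mol] mollifier.mollified_nonneg[OF mol]
      mollifier.mollified_eq_0[OF mol] by auto
  have fV: "l * integral {0..y} (\<lambda>z. z\<^sup>2 * f k z) \<le> y / 2" if "0 < y" "y \<le> 2 * a" for k y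
  proof -
    have "ennreal (l * integral {0..y} (\<lambda>z. z\<^sup>2 * f k z)) = ennreal l * ennreal (integral {0..y} (\<lambda>z. z\<^sup>2 * f k z))"
      using l by (simp add: ennreal_mult')
    also have "\<dots> \<le> ennreal l * (2\<^sup>2 * (\<integral>\<^sup>+z. ennreal (z\<^sup>2) * indicator {0<..<y} z \<partial>m))"
      unfolding f_def by (intro mult_left_mono mollifier.mollified_moment_le[OF mol] that) simp
    also have "\<dots> = ennreal (4 * l) * (\<integral>\<^sup>+z. ennreal (z\<^sup>2) * indicator {0<..<y} z \<partial>m)"
      using l by (simp add: ennreal_mult' mult_ac)
    also have "\<dots> \<le> ennreal (y / 2)" by (rule V[OF that])
    finally show ?thesis using that by (subst (asm) ennreal_le_iff) auto
  qed
  have fK: "integral {0..2 * a} (\<lambda>z. z * f k z) \<le> K" for k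
  proof -
    have "ennreal (integral {0..2 * a} (\<lambda>z. z ^ 1 * f k z)) \<le> 2 ^ 1 * (\<integral>\<^sup>+z. ennreal (z ^ 1) * indicator {0<..<2 * a} z \<partial>m)"
      unfolding f_def by (intro mollifier.mollified_moment_le[OF mol]) simp
    also have "\<dots> \<le> ennreal K" using K by simp
    finally show ?thesis using K0 by (subst (asm) ennreal_le_iff) auto
  qed
  \<comment> \<open>One index governs the lower barrier, the time horizon and the density. A path in
    the target event belongs to \<open>Ev k\<close> for all large \<open>k\<close>: it has a
    positive minimum, a finite time and, by Fatou, large enough approximate clocks.\<close>
  define Ev where "Ev k = {\<omega>\<in>space M. \<exists>s\<in>{0..real k}. (\<forall>r\<in>{0..s}. 1 / real (Suc k) < B r \<omega> \<and> B r \<omega> \<le> 2 * a) \<and>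
        (\<exists>r\<in>{0..s}. a < B r \<omega>) \<and> t < integral {0..s} (\<lambda>r. f k (B r \<omega>))}" for k
  have "\<exists>E\<in>sets M. Ev k \<subseteq> E \<and> emeasure M E \<le> p" for k
    unfolding p_def Ev_def by (rule level_bound_density[OF f a l _ fV fK BM x]) simp_all
  then obtain E where E: "\<And>k. E k \<in> sets M" "\<And>k. emeasure M (E k) \<le> p"
    and sub: "\<And>k. Ev k \<subseteq> E k"
    unfolding Bex_def by metis
  have "emeasure M (\<Union>n. \<Inter>k\<in>{n..}. E k) \<le> p"
    by (rule emeasure_eventually_le[OF E(1)]) (auto intro!: always_eventually order_trans[OF E(2)])
  moreover have "(\<Union>n. \<Inter>k\<in>{n..}. E k) \<in> sets M" using E(1) by auto
  moreover have "{\<omega>\<in>space M. \<exists>s\<ge>0. (\<forall>r\<in>{0..s}. 0 < B r \<omega> \<and> B r \<omega> \<le> 2 * a) \<and>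
        (\<exists>r\<in>{0..s}. a < B r \<omega>) \<and> ennreal t < additive_functional m L s \<omega>} \<subseteq> (\<Union>n. \<Inter>k\<in>{n..}. E k)"
  proof
    fix \<omega> assume "\<omega> \<in> {\<omega>\<in>space M. \<exists>s\<ge>0. (\<forall>r\<in>{0..s}. 0 < B r \<omega> \<and> B r \<omega> \<le> 2 * a) \<and>
        (\<exists>r\<in>{0..s}. a < B r \<omega>) \<and> ennreal t < additive_functional m L s \<omega>}"
    then obtain s where \<omega>: "\<omega> \<in> space M" and s: "0 \<le> s"
      and path: "\<forall>r\<in>{0..s}. 0 < B r \<omega> \<and> B r \<omega> \<le> 2 * a"
      and reach: "\<exists>r\<in>{0..s}. a < B r \<omega>" and clock: "ennreal t < additive_functional m L s \<omega>"
      by blast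
    interpret path_local_time "\<lambda>r. B r \<omega>" "\<lambda>y s. L y s \<omega>"
      by (rule path_local_time_of[OF BM L \<omega>])
    have above: "L y s \<omega> = 0" if "2 * a < y" for y
    proof (rule l_eq_0[OF s])
      fix r assume "0 \<le> r" "r \<le> s"
      then have "B r \<omega> \<le> 2 * a" using path by simp
      then show "B r \<omega> \<noteq> y" using that by simp
    qed
    \<comment> \<open>The path may touch \<open>2 * a\<close> itself, so that level is treated as a
      limit of levels above it.\<close>
    have L0: "L y s \<omega> = 0" if "2 * a \<le> y" for y
    proof (cases "y = 2 * a")
      case True
      have "(\<lambda>n. y + 1 / real (Suc n)) \<longlonglongrightarrow> y + 0"
        by (intro tendsto_add tendsto_const LIMSEQ_Suc[OF lim_1_over_n])
      then have lim: "(\<lambda>n. y + 1 / real (Suc n)) \<longlonglongrightarrow> y" by (simp only: add_0_right)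
      have "(\<lambda>n. L (y + 1 / real (Suc n)) s \<omega>) \<longlonglongrightarrow> L y s \<omega>"
        by (rule continuous_on_tendsto_compose[OF l_cont_space[OF s, of UNIV] lim]) auto
      moreover have "(\<lambda>n. L (y + 1 / real (Suc n)) s \<omega>) = (\<lambda>n. 0)"
        using True by (intro ext above) simp
      ultimately have "(\<lambda>n::nat. 0) \<longlonglongrightarrow> L y s \<omega>" by (simp only:)
      then show ?thesis using LIMSEQ_unique[OF tendsto_const] by metis
    qed (use above that in auto)
    have "additive_functional m L s \<omega> \<le> liminf (\<lambda>k. \<integral>\<^sup>+y. ennreal (L y s \<omega>) * ennreal (f k y) \<partial>lborel)"
      unfolding additive_functional_def f_def
      by (rule nn_integral_le_liminf_mollified[OF m l_cont_space[OF s] l_nonneg[OF s] L0])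
    also have "(\<lambda>k. \<integral>\<^sup>+y. ennreal (L y s \<omega>) * ennreal (f k y) \<partial>lborel) = (\<lambda>k. ennreal (integral {0..s} (\<lambda>r. f k (B r \<omega>))))"
      using occupation_formula[OF s f(1,2)] by (simp add: mult.commute)
    finally have "ennreal t < liminf (\<lambda>k. ennreal (integral {0..s} (\<lambda>r. f k (B r \<omega>))))"
      using clock by (rule less_le_trans[rotated])
    then have ev1: "\<forall>\<^sub>F k in sequentially. ennreal t < ennreal (integral {0..s} (\<lambda>r. f k (B r \<omega>)))"
      by (rule less_LiminfD)
    have "continuous_on {0..s} (\<lambda>r. B r \<omega>)" using path_cont by (rule continuous_on_subset) auto
    then obtain r0 where r0: "r0 \<in> {0..s}" "\<And>r. r \<in> {0..s} \<Longrightarrow> B r0 \<omega> \<le> B r \<omega>"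
      using continuous_attains_inf[of "{0..s}" "\<lambda>r. B r \<omega>"] s by auto
    have "0 < B r0 \<omega>" using path r0(1) by blast
    then have ev2: "\<forall>\<^sub>F k in sequentially. 1 / real (Suc k) < B r0 \<omega>"
      by (rule order_tendstoD(2)[OF LIMSEQ_Suc[OF lim_1_over_n]])
    obtain k0 :: nat where "s \<le> real k0" using real_arch_simple by blast
    have "\<forall>\<^sub>F k in sequentially. \<omega> \<in> E k"
      using ev1 ev2 eventually_ge_at_top[of k0]
    proof eventually_elim
      case (elim k)
      have "t < integral {0..s} (\<lambda>r. f k (B r \<omega>))"
        using elim(1) t by (simp add: ennreal_less_iff)
      moreover have "s \<in> {0..real k}" using elim(3) \<open>s \<le> real k0\<close> s by simp
      moreover have "\<forall>r\<in>{0..s}. 1 / real (Suc k) < B r \<omega> \<and> B r \<omega> \<le> 2 * a"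
        using elim(2) r0(2) path by (auto intro: less_le_trans)
      ultimately have "\<omega> \<in> Ev k"
        unfolding Ev_def using \<omega> reach by blast
      then show ?case using sub by blast
    qed
    then show "\<omega> \<in> (\<Union>n. \<Inter>k\<in>{n..}. E k)" unfolding eventually_sequentially by auto
  qed
  ultimately show ?thesis unfolding p_def by blast
qed

section \<open>Gaussian tail estimates\<close>

lemma gauss_tail_scale:
  assumes h: "0 < h"
  shows "emeasure (gauss h) {z. sqrt h \<le> \<sigma> * z} = emeasure (gauss 1) {z. 1 \<le> \<sigma> * z}"
proof -
  have 1: "emeasure (gauss h) {z. sqrt h \<le> \<sigma> * z}
      = (\<integral>\<^sup>+z. ennreal (normal_density 0 (sqrt h) z) * indicator {z. sqrt h \<le> \<sigma> * z} z \<partial>lborel)" for h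
    unfolding gauss_def by (rule emeasure_density) simp_all
  have "(\<integral>\<^sup>+z. ennreal (normal_density 0 (sqrt h) z) * indicator {z. sqrt h \<le> \<sigma> * z} z \<partial>lborel)
      = \<bar>sqrt h\<bar> * (\<integral>\<^sup>+y. ennreal (normal_density 0 (sqrt h) (0 + sqrt h * y)) * indicator {z. sqrt h \<le> \<sigma> * z} (0 + sqrt h * y) \<partial>lborel)"
    using h by (intro nn_integral_real_affine) simp_all
  also have "\<dots> = (\<integral>\<^sup>+y. ennreal (sqrt h) * (ennreal (normal_density 0 (sqrt h) (sqrt h * y)) * indicator {z. sqrt h \<le> \<sigma> * z} (sqrt h * y)) \<partial>lborel)"
    using h by (subst nn_integral_cmult) simp_all
  also have "\<dots> = (\<integral>\<^sup>+z. ennreal (normal_density 0 (sqrt 1) z) * indicator {z. sqrt 1 \<le> \<sigma> * z} z \<partial>lborel)"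
  proof (rule nn_integral_cong)
    fix y
    have "sqrt h \<le> \<sigma> * (sqrt h * y) \<longleftrightarrow> sqrt h * 1 \<le> sqrt h * (\<sigma> * y)" by (simp add: mult_ac)
    also have "\<dots> \<longleftrightarrow> 1 \<le> \<sigma> * y" using h by (subst mult_le_cancel_left_pos) auto
    finally have i: "indicator {z. sqrt h \<le> \<sigma> * z} (sqrt h * y) = (indicator {z. sqrt 1 \<le> \<sigma> * z} y :: ennreal)"
      by (simp add: indicator_def)
    have "sqrt h * normal_density 0 (sqrt h) (sqrt h * y) = normal_density 0 (sqrt 1) y"
      using h by (simp add: normal_density_def power_mult_distrib real_sqrt_mult)
    then have "ennreal (sqrt h) * ennreal (normal_density 0 (sqrt h) (sqrt h * y)) = ennreal (normal_density 0 (sqrt 1) y)"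
      using h by (simp flip: ennreal_mult')
    then show "ennreal (sqrt h) * (ennreal (normal_density 0 (sqrt h) (sqrt h * y)) * indicator {z. sqrt h \<le> \<sigma> * z} (sqrt h * y))
        = ennreal (normal_density 0 (sqrt 1) y) * indicator {z. sqrt 1 \<le> \<sigma> * z} y"
      unfolding i mult.assoc[symmetric] by (simp only:)
  qed
  finally show ?thesis unfolding 1 using 1[of 1] by simp
qed

lemma gauss_tail_pos:
  assumes \<sigma>: "\<sigma> = 1 \<or> \<sigma> = -1"
  shows "0 < emeasure (gauss 1) {z. 1 \<le> \<sigma> * z}"
proof (rule ccontr)
  assume "\<not> 0 < emeasure (gauss 1) {z. 1 \<le> \<sigma> * z}"
  then have "{z. 1 \<le> \<sigma> * z} \<in> null_sets (gauss 1)" by (intro null_setsI) simp_all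
  then have "AE z in lborel. z \<in> {z. 1 \<le> \<sigma> * z} \<longrightarrow> ennreal (normal_density 0 (sqrt 1) z) = 0"
    unfolding gauss_def by (subst (asm) null_sets_density_iff) simp_all
  then have "AE z in lborel. z \<notin> {z. 1 \<le> \<sigma> * z}"
  proof eventually_elim
    case (elim z)
    moreover have "0 < normal_density 0 (sqrt 1) z" by (intro normal_density_pos) simp
    ultimately show ?case by (simp add: ennreal_eq_0_iff)
  qed
  then have N: "{z. 1 \<le> \<sigma> * z} \<in> null_sets lborel" by (subst AE_iff_null_sets) simp_all
  obtain c :: real where c: "{c..c + 1} \<subseteq> {z. 1 \<le> \<sigma> * z}"
    using \<sigma> by (elim disjE) (auto intro: that[of 1] that[of "-2"])
  have "{c..c + 1} \<in> null_sets lborel" by (rule null_sets_subset[OF N _ c]) simp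
  then show False by (simp add: null_sets_def)
qed

lemma gauss_chebyshev:
  assumes h: "0 < h" and c: "0 < c"
  shows "emeasure (gauss h) {z. c \<le> \<bar>z\<bar>} \<le> ennreal (h / c\<^sup>2)"
proof -
  note gm = gauss_moments[OF h, of 0 0 "1 / c\<^sup>2" 0, unfolded has_bochner_integral_iff]
  have "emeasure (gauss h) {z. c \<le> \<bar>z\<bar>} = (\<integral>\<^sup>+z. indicator {z. c \<le> \<bar>z\<bar>} z \<partial>gauss h)" by simp
  also have "\<dots> \<le> (\<integral>\<^sup>+z. ennreal (0 + 0 * z + 1 / c\<^sup>2 * z\<^sup>2 + 0 * z ^ 4) \<partial>gauss h)"
  proof (intro nn_integral_mono)
    fix z :: real
    have "1 \<le> 1 / c\<^sup>2 * z\<^sup>2" if "c \<le> \<bar>z\<bar>"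
      using power_mono[OF that, of 2] c by (simp add: field_simps)
    then show "indicator {z. c \<le> \<bar>z\<bar>} z \<le> ennreal (0 + 0 * z + 1 / c\<^sup>2 * z\<^sup>2 + 0 * z ^ 4)"
      by (auto simp: indicator_def)
  qed
  also have "\<dots> = ennreal (h / c\<^sup>2)"
    using gm c by (subst nn_integral_eq_integral) simp_all
  finally show ?thesis .
qed

section \<open>Brownian motion is unbounded in both directions\<close>

lemma brownian_increment_distr:
  assumes BM: "brownian_motion_from M x B" and "0 \<le> r" "r < s"
  shows "distr M borel (\<lambda>\<omega>. B s \<omega> - B r \<omega>) = gauss (s - r)"
proof -
  define q :: "nat \<Rightarrow> real" where "q i = (if i = 0 then r else s)" for i
  have "0 \<le> q 0 \<and> (\<forall>i<1. q i < q (Suc i))" using assms by (simp add: q_def)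
  then have "\<forall>i<1. distributed M lborel (\<lambda>\<omega>. B (q (Suc i)) \<omega> - B (q i) \<omega>)
      (\<lambda>z. ennreal (normal_density 0 (sqrt (q (Suc i) - q i)) z))"
    using BM unfolding brownian_motion_from_def by blast
  then have "distr M lborel (\<lambda>\<omega>. B s \<omega> - B r \<omega>) = gauss (s - r)"
    by (simp add: q_def distributed_def gauss_def)
  moreover have "distr M lborel (\<lambda>\<omega>. B s \<omega> - B r \<omega>) = distr M borel (\<lambda>\<omega>. B s \<omega> - B r \<omega>)"
    by (rule distr_cong) simp_all
  ultimately show ?thesis by simp
qed

lemma sum_quarter_powers_le: "(\<Sum>i\<in>{J..<J + n}. (1 / 4 :: real) ^ i) \<le> 2 * (1 / 4) ^ J"
proof -
  have "(\<Sum>i\<in>{J..<J + n}. (1 / 4 :: real) ^ i) = 4 / 3 * ((1 / 4) ^ J - (1 / 4) ^ (J + n))"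
    by (induction n) (simp_all add: algebra_simps)
  also have "\<dots> \<le> 2 * (1 / 4) ^ J" by (simp add: algebra_simps)
  finally show ?thesis .
qed

text \<open>Provides the zero and the later positive values on which the absorption argument relies.
  Independent increments exceed one standard deviation in direction \<open>\<sigma>\<close> with a
  fixed probability \<open>p\<close>, so avoiding this \<open>N\<close> times costs
  \<open>(1 - p) ^ N\<close>; elementary bounds replace a zero-one law.\<close>

lemma brownian_unbounded:
  assumes BM: "brownian_motion_from M x B" and \<sigma>: "\<sigma> = 1 \<or> \<sigma> = (-1::real)"
  shows "AE \<omega> in M. \<forall>n::nat. \<exists>r\<ge>real n. 0 < \<sigma> * B r \<omega>"
proof -
  interpret prob_space M using BM by (simp add: brownian_motion_from_def)
  have B[measurable]: "B r \<in> borel_measurable M" for r using BM by (simp add: brownian_motion_from_def)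
  have B0: "B 0 \<omega> = x" if "\<omega> \<in> space M" for \<omega>
    using BM that by (auto simp: brownian_motion_from_def)
  \<comment> \<open>So sparse that a single typical increment outweighs everything before it.\<close>
  define s :: "nat \<Rightarrow> real" where "s i = 4 ^ (i\<^sup>2)" for i
  have s_Suc: "s (Suc i) = 4 * 4 ^ (i\<^sup>2 + 2 * i)" for i
  proof -
    have "(Suc i)\<^sup>2 = Suc (i\<^sup>2 + 2 * i)" by (simp add: power2_eq_square)
    then show ?thesis unfolding s_def by (simp only: power_Suc)
  qed
  have four: "(2 ^ n)\<^sup>2 = (4::real) ^ n" for n
    by (simp add: power2_eq_square flip: power_mult_distrib)
  have s_le: "s i \<le> 4 ^ (i\<^sup>2 + 2 * i)" for i unfolding s_def by (rule power_increasing) auto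
  have s_inc: "s i < s (Suc i)" for i unfolding s_Suc by (rule le_less_trans[OF s_le]) simp
  have s_pos: "0 < s i" for i by (simp add: s_def)
  have sqrt_s: "2 ^ (i\<^sup>2 + 2 * i) \<le> sqrt (s (Suc i) - s i)" for i
  proof (rule real_le_rsqrt)
    show "(2 ^ (i\<^sup>2 + 2 * i))\<^sup>2 \<le> s (Suc i) - s i"
      using s_le[of i] zero_le_power[of "4::real" "i\<^sup>2 + 2 * i"] unfolding s_Suc four by linarith
  qed
  define D where "D i \<omega> = B (s (Suc i)) \<omega> - B (s i) \<omega>" for i \<omega>
  have [measurable]: "D i \<in> borel_measurable M" for i unfolding D_def by measurable
  define p where "p = measure (gauss 1) {z. 1 \<le> \<sigma> * z}"
  interpret g1: prob_space "gauss 1" by (rule prob_space_gauss) simp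
  have p: "0 < p" "p \<le> 1"
    using gauss_tail_pos[OF \<sigma>] unfolding p_def g1.emeasure_eq_measure by simp_all
  define H where "H i = {z. sqrt (s (Suc i) - s i) \<le> \<sigma> * z}" for i
  have H[measurable]: "H i \<in> sets borel" for i unfolding H_def by measurable
  have pH: "prob (D i -` (- H i) \<inter> space M) = 1 - p" for i
  proof -
    have "0 < s (Suc i) - s i" using s_inc[of i] by simp
    have d: "distr M borel (D i) = gauss (s (Suc i) - s i)"
      unfolding D_def using s_pos[of i] s_inc[of i] by (intro brownian_increment_distr[OF BM]) auto
    have "emeasure M (D i -` H i \<inter> space M) = emeasure (distr M borel (D i)) (H i)"
      by (simp add: emeasure_distr)
    also have "\<dots> = emeasure (gauss 1) {z. 1 \<le> \<sigma> * z}"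
      unfolding d H_def by (rule gauss_tail_scale) fact
    finally have "prob (D i -` H i \<inter> space M) = p"
      by (simp add: p_def measure_def)
    moreover have "D i -` (- H i) \<inter> space M = space M - (D i -` H i \<inter> space M)" by auto
    ultimately show ?thesis by (simp add: prob_compl)
  qed
  \<comment> \<open>The variance at time \<open>s i\<close> is \<open>4 ^ (i^2)\<close>, so
    Chebyshev at height \<open>2 ^ (i^2 + i)\<close> gives probability at most
    \<open>4 ^ (- i)\<close>.\<close>
  define far where "far i = {\<omega> \<in> space M. 2 ^ (i\<^sup>2 + i) \<le> \<bar>B (s i) \<omega> - x\<bar>}" for i
  have [measurable]: "far i \<in> sets M" for i unfolding far_def by measurable
  have pfar: "prob (far i) \<le> (1 / 4) ^ i" for i
  proof -
    have d: "distr M borel (\<lambda>\<omega>. B (s i) \<omega> - B 0 \<omega>) = gauss (s i)"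
      using brownian_increment_distr[OF BM, of 0 "s i"] s_pos[of i] by simp
    have "emeasure M (far i) = emeasure (distr M borel (\<lambda>\<omega>. B (s i) \<omega> - B 0 \<omega>)) {z. 2 ^ (i\<^sup>2 + i) \<le> \<bar>z\<bar>}"
      by (subst emeasure_distr) (auto simp: far_def B0 intro!: arg_cong[where f = "emeasure M"])
    also have "\<dots> \<le> ennreal (s i / (2 ^ (i\<^sup>2 + i))\<^sup>2)"
      unfolding d by (rule gauss_chebyshev[OF s_pos]) simp
    also have "(2 ^ (i\<^sup>2 + i))\<^sup>2 = (4::real) ^ (i\<^sup>2 + i)"
      by (rule four)
    also have "s i / 4 ^ (i\<^sup>2 + i) = (1 / 4) ^ i"
      by (simp add: s_def power_add power_one_over divide_simps)
    finally show ?thesis by (simp add: emeasure_eq_measure)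
  qed
  define bad where "bad n = {\<omega> \<in> space M. \<forall>i\<ge>n. \<sigma> * B (s i) \<omega> \<le> 0}" for n
  have [measurable]: "bad n \<in> sets M" for n unfolding bad_def by measurable
  have sub: "bad n \<subseteq> (\<Union>i\<in>{J..<J + N}. far i) \<union> (\<Inter>i\<in>{J..<J + N}. D i -` (- H i) \<inter> space M)"
    if J: "n \<le> J" "\<bar>x\<bar> < real J" and N: "0 < N" for n J N
  proof (rule subsetI, rule ccontr)
    fix \<omega> assume \<omega>: "\<omega> \<in> bad n"
      "\<omega> \<notin> (\<Union>i\<in>{J..<J + N}. far i) \<union> (\<Inter>i\<in>{J..<J + N}. D i -` (- H i) \<inter> space M)"
    then have sp: "\<omega> \<in> space M" by (simp add: bad_def)
    then obtain i where i: "J \<le> i" "\<omega> \<notin> far i" "D i \<omega> \<in> H i" using \<omega>(2) N by auto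
    \<comment> \<open>A large increment, at least \<open>2 ^ (i^2 + 2 i)\<close>, beats the
      displacement so far, below \<open>2 ^ (i^2 + i)\<close>, with \<open>i\<close> to spare; this
      surplus covers the starting point because \<open>\<bar>x\<bar> < J <= i\<close>.\<close>
    have "(2::real) ^ (i\<^sup>2 + i) * 1 + real i \<le> 2 ^ (i\<^sup>2 + i) * 2 ^ i"
    proof -
      have "real i + 1 \<le> 2 ^ i" using of_nat_mono[OF Suc_leI[OF less_exp[of i]], where 'a = real] by simp
      then have "1 * real i \<le> 2 ^ (i\<^sup>2 + i) * ((2::real) ^ i - 1)"
        by (intro mult_mono) auto
      then show ?thesis by (simp add: algebra_simps)
    qed
    also have "\<dots> = 2 ^ (i\<^sup>2 + 2 * i)" by (simp add: mult_2 flip: power_add add.assoc)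
    also have "\<dots> \<le> \<sigma> * D i \<omega>" using sqrt_s[of i] i(3) by (simp add: H_def)
    finally have "2 ^ (i\<^sup>2 + i) + real i \<le> \<sigma> * D i \<omega>" by simp
    moreover have "\<bar>B (s i) \<omega> - x\<bar> < 2 ^ (i\<^sup>2 + i)" using i(2) sp by (simp add: far_def not_le)
    moreover have "\<bar>x\<bar> < real i" using J(2) i(1) by linarith
    ultimately have "0 < \<sigma> * B (s (Suc i)) \<omega>"
      using \<sigma> unfolding D_def by (elim disjE) simp_all
    moreover have "\<sigma> * B (s (Suc i)) \<omega> \<le> 0" using \<omega>(1) J(1) i(1) by (simp add: bad_def)
    ultimately show False by simp
  qed
  have bound: "prob (bad n) \<le> 2 * (1 / 4) ^ J + (1 - p) ^ N"
    if J: "n \<le> J" "\<bar>x\<bar> < real J" and N: "0 < N" for n J N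
  proof -
    have "indep_vars (\<lambda>_. borel) D {..<J + N}"
      using BM s_inc s_pos[of 0] unfolding brownian_motion_from_def D_def by (simp add: less_imp_le)
    then have "indep_vars (\<lambda>_. borel) D {J..<J + N}" by (rule indep_vars_subset) auto
    then have "prob (\<Inter>i\<in>{J..<J + N}. D i -` (- H i) \<inter> space M) = (\<Prod>i\<in>{J..<J + N}. prob (D i -` (- H i) \<inter> space M))"
      using N by (intro indep_varsD_finite) auto
    then have 1: "prob (\<Inter>i\<in>{J..<J + N}. D i -` (- H i) \<inter> space M) = (1 - p) ^ N"
      by (simp add: pH)
    have [measurable]: "(\<Inter>i\<in>{J..<J + N}. D i -` (- H i) \<inter> space M) \<in> sets M"
      using N by (intro sets.finite_INT) (auto intro!: measurable_sets[of _ M borel])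
    have [measurable]: "(\<Union>i\<in>{J..<J + N}. far i) \<in> sets M" by (intro sets.finite_UN) auto
    have "prob (\<Union>i\<in>{J..<J + N}. far i) \<le> (\<Sum>i\<in>{J..<J + N}. prob (far i))"
      by (rule finite_measure_subadditive_finite) auto
    also have "\<dots> \<le> (\<Sum>i\<in>{J..<J + N}. (1 / 4) ^ i)" by (rule sum_mono[OF pfar])
    also have "\<dots> \<le> 2 * (1 / 4) ^ J" by (rule sum_quarter_powers_le)
    finally have 2: "prob (\<Union>i\<in>{J..<J + N}. far i) \<le> 2 * (1 / 4) ^ J" .
    have "prob (bad n) \<le> prob ((\<Union>i\<in>{J..<J + N}. far i) \<union> (\<Inter>i\<in>{J..<J + N}. D i -` (- H i) \<inter> space M))"
      by (rule finite_measure_mono[OF sub[OF that]]) (rule sets.Un; fact)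
    also have "\<dots> \<le> prob (\<Union>i\<in>{J..<J + N}. far i) + prob (\<Inter>i\<in>{J..<J + N}. D i -` (- H i) \<inter> space M)"
      by (rule measure_Un_le; fact)
    finally show ?thesis using 1 2 by simp
  qed
  have "prob (bad n) \<le> 0" for n
  \<comment> \<open>Both parameters are sent to infinity together by choosing
    \<open>N = J\<close>.\<close>
  proof (rule tendsto_lowerbound[of "\<lambda>J. 2 * (1 / 4) ^ J + (1 - p) ^ J" 0 sequentially])
    have "(\<lambda>J. 2 * (1 / 4) ^ J + (1 - p) ^ J) \<longlonglongrightarrow> 2 * 0 + 0"
      using p by (intro tendsto_intros LIMSEQ_realpow_zero) auto
    then show "(\<lambda>J. 2 * (1 / 4) ^ J + (1 - p) ^ J) \<longlonglongrightarrow> 0" by simp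
    obtain J0 :: nat where J0: "\<bar>x\<bar> < real J0" using reals_Archimedean2 by blast
    show "\<forall>\<^sub>F J in sequentially. prob (bad n) \<le> 2 * (1 / 4) ^ J + (1 - p) ^ J"
      using eventually_ge_at_top[of "max (max n J0) 1"]
    proof eventually_elim
      case (elim J)
      then show ?case using J0 by (intro bound) auto
    qed
  qed simp
  then have "bad n \<in> null_sets M" for n
    using measure_nonneg[of M "bad n"] by (intro null_setsI) (simp_all add: emeasure_eq_measure order_antisym)
  then have "AE \<omega> in M. \<forall>n. \<omega> \<notin> bad n" by (subst AE_all_countable) (intro allI AE_not_in)
  then show ?thesis
  proof (rule AE_mp, intro AE_I2 impI allI)
    fix \<omega> and n :: nat assume \<omega>: "\<omega> \<in> space M" "\<forall>n. \<omega> \<notin> bad n"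
    then have "\<omega> \<notin> bad n" by blast
    then obtain i where i: "n \<le> i" "0 < \<sigma> * B (s i) \<omega>" using \<omega>(1) by (auto simp: bad_def not_le)
    have "i \<le> i\<^sup>2" by (simp add: power2_eq_square)
    then have "(2::real) ^ i \<le> 4 ^ (i\<^sup>2)" by (intro order_trans[OF power_mono[of 2 4 i] power_increasing]) auto
    moreover have "real i \<le> 2 ^ i" using of_nat_less_two_power[of i] by (simp add: less_imp_le)
    ultimately have "real n \<le> s i" using of_nat_mono[OF i(1), where 'a = real] unfolding s_def by linarith
    then show "\<exists>r\<ge>real n. 0 < \<sigma> * B r \<omega>" using i(2) by blast
  qed
qed

section \<open>Moments of the speed measure\<close>

text \<open>For \<open>n = k div 2\<close> the block \<open>{n..<2 * n}\<close> has \<open>n\<close>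
  terms, each at least \<open>\<gamma> k\<close>, and its sum is small by the Cauchy criterion;
  finally \<open>k <= 3 n\<close>.\<close>

lemma summable_antimono_times_index_le:
  fixes \<gamma> :: "nat \<Rightarrow> real"
  assumes sm: "summable \<gamma>" and anti: "antimono \<gamma>" and nn: "\<And>k. 0 \<le> \<gamma> k" and c: "0 < c"
  shows "\<forall>\<^sub>F k in sequentially. real k * \<gamma> k \<le> c"
proof -
  obtain N where N: "\<And>m n. N \<le> m \<Longrightarrow> \<bar>sum \<gamma> {m..<n}\<bar> < c / 4"
  proof -
    have "0 < c / 4" using c by simp
    from sm[unfolded summable_Cauchy, rule_format, OF this]
    show ?thesis using that unfolding real_norm_def by blast
  qed
  show ?thesis
    using eventually_ge_at_top[of "2 * N + 2"]
  proof eventually_elim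
    case (elim k)
    define n where "n = k div 2"
    have n: "N \<le> n" "1 \<le> n" "2 * n \<le> k" "k \<le> 3 * n" using elim by (auto simp: n_def)
    have "real n * \<gamma> k = (\<Sum>i\<in>{n..<2 * n}. \<gamma> k)" by simp
    also have "\<dots> \<le> sum \<gamma> {n..<2 * n}"
      using n(3) by (intro sum_mono antimonoD[OF anti]) auto
    also have "\<dots> < c / 4" using N[OF n(1), of "2 * n"] by linarith
    finally have 1: "real n * \<gamma> k < c / 4" .
    have "real k * \<gamma> k \<le> real (3 * n) * \<gamma> k" using n(4) nn by (intro mult_right_mono) auto
    also have "\<dots> = 3 * (real n * \<gamma> k)" by simp
    finally show ?case using 1 c by linarith
  qed
qed

definition moment1 :: "real measure \<Rightarrow> real \<Rightarrow> ennreal" where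
  "moment1 m y = (\<integral>\<^sup>+z. ennreal z * indicator {0<..<y} z \<partial>m)"

definition moment2 :: "real measure \<Rightarrow> real \<Rightarrow> ennreal" where
  "moment2 m y = (\<integral>\<^sup>+z. ennreal (z\<^sup>2) * indicator {0<..<y} z \<partial>m)"

text \<open>The quantity \<open>\<gamma>\<close> of the overview, with
  \<open>x = 2 a\<close>.\<close>

definition sup_moment :: "real measure \<Rightarrow> real \<Rightarrow> ennreal" where
  "sup_moment m x = (SUP y\<in>{0<..x}. ennreal (1 / y) * moment2 m y)"

lemma sup_moment_mono: "x \<le> y \<Longrightarrow> sup_moment m x \<le> sup_moment m y"
  unfolding sup_moment_def by (intro SUP_subset_mono) auto

lemma moment_le_sup:
  assumes "0 < y" "y \<le> x" shows "moment2 m y \<le> ennreal y * sup_moment m x"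
proof -
  have "ennreal (1 / y) * moment2 m y \<le> sup_moment m x" unfolding sup_moment_def using assms by (intro SUP_upper) auto
  then have "ennreal y * (ennreal (1 / y) * moment2 m y) \<le> ennreal y * sup_moment m x" by (rule mult_left_mono) simp
  moreover have "ennreal y * (ennreal (1 / y) * moment2 m y) = moment2 m y"
    using assms by (simp add: mult.assoc[symmetric] flip: ennreal_mult')
  ultimately show ?thesis by simp
qed

text \<open>On the shell from \<open>2^-(k+1)\<close> to \<open>2^-k\<close> the weight
  \<open>1 / x\<close> is at least \<open>2^k\<close> and \<open>sup_moment\<close> is at least its
  value at the left end; the shell has length \<open>2^-(k+1)\<close>, which costs the factor
  \<open>2\<close>.\<close>

lemma dyadic_sum_le:
  "(\<Sum>k. sup_moment m ((1 / 2) ^ Suc k)) \<le> 2 * (\<integral>\<^sup>+x. ennreal (1 / x) * sup_moment m x * indicator {0<..1} x \<partial>lborel)"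
proof -
  define I where "I k = {(1 / 2) ^ Suc k<..(1 / 2 :: real) ^ k}" for k
  have disj: "disjoint_family I"
  proof -
    have "I i \<inter> I j = {}" if "i < j" for i j
    proof -
      have "(1 / 2 :: real) ^ j \<le> (1 / 2) ^ Suc i" using that by (intro power_decreasing) auto
      then show ?thesis unfolding I_def by auto
    qed
    then show ?thesis unfolding disjoint_family_on_def
      by (metis inf_commute linorder_neqE_nat)
  qed
  have I01: "I k \<subseteq> {0<..1}" for k
  proof -
    have "(0::real) < (1 / 2) ^ Suc k" "(1 / 2 :: real) ^ k \<le> 1" by (simp_all add: power_le_one)
    then show ?thesis unfolding I_def by (auto intro: less_trans order_trans)
  qed
  have [measurable]: "I k \<in> sets borel" for k by (simp add: I_def)
  have "(\<Sum>k. sup_moment m ((1 / 2) ^ Suc k)) = (\<Sum>k. 2 * (\<integral>\<^sup>+x. (ennreal (2 ^ k) * sup_moment m ((1 / 2) ^ Suc k)) * indicator (I k) x \<partial>lborel))"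
  proof (rule suminf_cong)
    fix k
    have "emeasure lborel (I k) = ennreal ((1 / 2) ^ Suc k)"
      unfolding I_def by (subst emeasure_lborel_Ioc) (simp_all add: power_decreasing)
    then have "(\<integral>\<^sup>+x. (ennreal (2 ^ k) * sup_moment m ((1 / 2) ^ Suc k)) * indicator (I k) x \<partial>lborel)
        = (ennreal (2 ^ k) * sup_moment m ((1 / 2) ^ Suc k)) * ennreal ((1 / 2) ^ Suc k)"
      by (subst nn_integral_cmult_indicator) simp_all
    also have "2 * \<dots> = (ennreal 2 * ennreal (2 ^ k) * ennreal ((1 / 2) ^ Suc k)) * sup_moment m ((1 / 2) ^ Suc k)"
      by (simp only: ennreal_numeral mult_ac)
    also have "ennreal 2 * ennreal (2 ^ k) * ennreal ((1 / 2) ^ Suc k) = 1"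
    proof -
      have "ennreal (2 * 2 ^ k * (1 / 2) ^ Suc k) = ennreal 2 * ennreal (2 ^ k) * ennreal ((1 / 2) ^ Suc k)"
        by (subst ennreal_mult', simp, subst ennreal_mult', simp, rule refl)
      moreover have "2 * 2 ^ k * (1 / 2) ^ Suc k = (1::real)" by (simp add: power_one_over)
      ultimately show ?thesis by simp
    qed
    finally show "sup_moment m ((1 / 2) ^ Suc k) = 2 * (\<integral>\<^sup>+x. (ennreal (2 ^ k) * sup_moment m ((1 / 2) ^ Suc k)) * indicator (I k) x \<partial>lborel)"
      by simp
  qed
  also have "\<dots> = 2 * (\<integral>\<^sup>+x. (\<Sum>k. (ennreal (2 ^ k) * sup_moment m ((1 / 2) ^ Suc k)) * indicator (I k) x) \<partial>lborel)"
    by (subst nn_integral_suminf) simp_all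
  also have "\<dots> \<le> 2 * (\<integral>\<^sup>+x. ennreal (1 / x) * sup_moment m x * indicator {0<..1} x \<partial>lborel)"
  proof (intro mult_left_mono nn_integral_mono)
    fix x :: real
    show "(\<Sum>k. (ennreal (2 ^ k) * sup_moment m ((1 / 2) ^ Suc k)) * indicator (I k) x) \<le> ennreal (1 / x) * sup_moment m x * indicator {0<..1} x"
    proof (cases "\<exists>k. x \<in> I k")
      case True
      then obtain k where k: "x \<in> I k" by blast
      have "x \<notin> I j" if "j \<noteq> k" for j using disj k that by (auto simp: disjoint_family_on_def)
      then have "(\<lambda>j. (ennreal (2 ^ j) * sup_moment m ((1 / 2) ^ Suc j)) * indicator (I j) x)
          = (\<lambda>j. if j = k then ennreal (2 ^ k) * sup_moment m ((1 / 2) ^ Suc k) else 0)"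
        using k by (auto simp: fun_eq_iff)
      then have "(\<Sum>j. (ennreal (2 ^ j) * sup_moment m ((1 / 2) ^ Suc j)) * indicator (I j) x) = ennreal (2 ^ k) * sup_moment m ((1 / 2) ^ Suc k)"
        using sums_unique[OF sums_single[of k "\<lambda>_. ennreal (2 ^ k) * sup_moment m ((1 / 2) ^ Suc k)"]] by (simp only:)
      also have "\<dots> \<le> ennreal (1 / x) * sup_moment m x"
      proof (intro mult_mono ennreal_leI sup_moment_mono)
        have x: "0 < x" using I01[of k] k by auto
        have "x \<le> 1 / 2 ^ k" using k by (simp add: I_def power_one_over)
        then show "2 ^ k \<le> 1 / x" using x by (simp add: field_simps)
        show "(1 / 2) ^ Suc k \<le> x" using k unfolding I_def by simp
      qed simp_all
      finally show ?thesis using I01[of k] k by (simp add: subset_iff)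
    qed simp
  qed simp
  finally show ?thesis .
qed

text \<open>On a shell \<open>y / 2 <= z < y\<close> one has \<open>z <= (2 / y) z^2\<close>, and
  the second moment below \<open>y\<close> is at most \<open>y * sup_moment m y\<close>.\<close>

lemma first_moment_le:
  assumes m: "sets m = sets borel"
  shows "moment1 m ((1 / 2) ^ n) \<le> 2 * (\<Sum>k. sup_moment m ((1 / 2) ^ (n + k)))"
proof -
  note [measurable_cong] = m
  define I where "I k = {(1 / 2) ^ Suc k..<(1 / 2 :: real) ^ k}" for k
  have "moment1 m ((1 / 2) ^ n) \<le> (\<integral>\<^sup>+z. (\<Sum>k. ennreal z * indicator (I (n + k)) z) \<partial>m)"
    unfolding moment1_def
  proof (intro nn_integral_mono)
    fix z :: real
    show "ennreal z * indicator {0<..<(1 / 2) ^ n} z \<le> (\<Sum>k. ennreal z * indicator (I (n + k)) z)"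
    proof (cases "z \<in> {0<..<(1 / 2) ^ n}")
      case True
      have "\<exists>j. (1 / 2) ^ j < z" using True by (intro real_arch_pow_inv) auto
      then obtain j0 where j0: "(1 / 2) ^ j0 < z" by blast
      \<comment> \<open>The least such exponent places \<open>z\<close> in the shell between
        \<open>2^-j\<close> and \<open>2^-(j-1)\<close>.\<close>
      define j where "j = (LEAST j. (1 / 2) ^ j \<le> z)"
      have j: "(1 / 2) ^ j \<le> z" unfolding j_def
        by (rule LeastI[of "\<lambda>j. (1 / 2) ^ j \<le> z" j0]) (use j0 in simp)
      have "n < j"
      proof (rule ccontr)
        assume "\<not> n < j"
        then have "(1 / 2 :: real) ^ n \<le> (1 / 2) ^ j" by (intro power_decreasing) auto
        then show False using j True unfolding greaterThanLessThan_iff by linarith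
      qed
      then obtain i where i: "j = Suc i" "n \<le> i" by (cases j) auto
      have "i < (LEAST j. (1 / 2) ^ j \<le> z)" using i(1) unfolding j_def by simp
      then have "\<not> (1 / 2) ^ i \<le> z" by (rule not_less_Least)
      then have "z \<in> I (n + (i - n))" using i j by (simp add: I_def)
      then have "ennreal z * indicator {0<..<(1 / 2) ^ n} z = (\<Sum>k\<in>{i - n}. ennreal z * indicator (I (n + k)) z)"
        using True by simp
      also have "\<dots> \<le> (\<Sum>k. ennreal z * indicator (I (n + k)) z)" by (intro sum_le_suminf) auto
      finally show ?thesis .
    qed simp
  qed
  also have "\<dots> = (\<Sum>k. \<integral>\<^sup>+z. ennreal z * indicator (I (n + k)) z \<partial>m)"
    by (rule nn_integral_suminf) (simp add: I_def)
  also have "\<dots> \<le> (\<Sum>k. 2 * sup_moment m ((1 / 2) ^ (n + k)))"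
  proof (intro suminf_le)
    fix k
    define y :: real where "y = (1 / 2) ^ (n + k)"
    have y: "0 < y" by (simp add: y_def)
    have "(\<integral>\<^sup>+z. ennreal z * indicator (I (n + k)) z \<partial>m) \<le> (\<integral>\<^sup>+z. ennreal (2 / y) * (ennreal (z\<^sup>2) * indicator {0<..<y} z) \<partial>m)"
    proof (intro nn_integral_mono)
      fix z
      show "ennreal z * indicator (I (n + k)) z \<le> ennreal (2 / y) * (ennreal (z\<^sup>2) * indicator {0<..<y} z)"
      proof (cases "z \<in> I (n + k)")
        case True
        then have z: "y / 2 \<le> z" "z < y" by (auto simp: I_def y_def)
        then have z0: "0 < z" using y by linarith
        have "y / 2 * z \<le> z * z" using z z0 by (intro mult_right_mono) auto
        then have "z \<le> 2 / y * z\<^sup>2" using y by (simp add: field_simps power2_eq_square)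
        then have "ennreal z \<le> ennreal (2 / y) * ennreal (z\<^sup>2)"
          using y by (simp add: ennreal_leI flip: ennreal_mult')
        then show ?thesis using z z0 True by simp
      qed simp
    qed
    also have "\<dots> = ennreal (2 / y) * moment2 m y"
      unfolding moment2_def by (rule nn_integral_cmult) simp
    also have "\<dots> \<le> ennreal (2 / y) * (ennreal y * sup_moment m y)"
      by (intro mult_left_mono moment_le_sup y) auto
    also have "\<dots> = 2 * sup_moment m y"
      using y by (simp add: mult.assoc[symmetric] flip: ennreal_mult')
    finally show "(\<integral>\<^sup>+z. ennreal z * indicator (I (n + k)) z \<partial>m) \<le> 2 * sup_moment m ((1 / 2) ^ (n + k))"
      by (simp add: y_def)
  qed auto
  also have "\<dots> = 2 * (\<Sum>k. sup_moment m ((1 / 2) ^ (n + k)))" by simp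
  finally show ?thesis .
qed

section \<open>Summing over the levels\<close>

text \<open>Contrapositive of \<open>absorption_le\<close>: if the clock never exceeds
  \<open>t\<close> while the path is positive, absorption has occurred by time
  \<open>t\<close>.\<close>

lemma survival_implies_clock:
  assumes m: "speed_measure m" and t: "0 \<le> t"
    and BM: "brownian_motion_from M x B" and L: "local_time_of M B L" and x: "0 < x"
    and \<omega>: "\<omega> \<in> space M" and pos: "\<And>n::nat. \<exists>r\<ge>real n. 0 < B r \<omega>" and neg: "\<exists>r\<ge>0. B r \<omega> < 0"
    and surv: "ereal t < absorption_time m B L \<omega>"
  shows "\<exists>s\<ge>0. (\<forall>r\<in>{0..s}. 0 < B r \<omega>) \<and> ennreal t < additive_functional m L s \<omega>"
proof (rule ccontr)
  assume *: "\<not> ?thesis"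
  interpret path_local_time "\<lambda>r. B r \<omega>" "\<lambda>y s. L y s \<omega>"
    by (rule path_local_time_of[OF BM L \<omega>])
  have A: "additive_functional m L s \<omega> = clock m s" for s
    by (simp add: additive_functional_def clock_def)
  have "B 0 \<omega> = x" using BM \<omega> by (auto simp: brownian_motion_from_def)
  obtain R where R: "0 \<le> R" "B R \<omega> \<le> 0" using neg by (auto simp: less_imp_le)
  have rec: "\<exists>r>T. 0 < B r \<omega>" if "0 \<le> T" for T
  proof -
    obtain n :: nat where "T < real n" using reals_Archimedean2 by blast
    then show ?thesis using pos[of n] less_le_trans[of T "real n"] by blast
  qed
  have le: "clock m s \<le> ennreal t" if "0 \<le> s" "\<And>r. 0 \<le> r \<Longrightarrow> r \<le> s \<Longrightarrow> 0 < B r \<omega>" for s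
  proof -
    have "\<forall>r\<in>{0..s}. 0 < B r \<omega>" using that(2) by simp
    then have "\<not> ennreal t < clock m s" using * that(1) unfolding A by blast
    then show ?thesis by (simp add: not_less)
  qed
  have "\<exists>u. 0 \<le> u \<and> u \<le> t \<and> (\<exists>s. Inf {ereal s | s. 0 \<le> s \<and> clock m s > ennreal u} = ereal s \<and> B s \<omega> = 0)"
  proof (rule absorption_le[OF m t _ R])
    show "0 < B 0 \<omega>" using x \<open>B 0 \<omega> = x\<close> by simp
  qed (fact rec, rule le)
  then obtain u s where u: "0 \<le> u" "u \<le> t" "time_change m L u \<omega> = ereal s" "B s \<omega> = 0"
    unfolding time_change_def A by blast
  have "absorption_time m B L \<omega> \<le> ereal u"
    unfolding absorption_time_def using u by (intro Inf_lower) auto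
  then have "ereal t < ereal u" using surv by (rule less_le_trans[rotated])
  then show False using u(2) by simp
qed

text \<open>For \<open>t = 0\<close> the clock condition asks only for a positive clock, leaving the
  cost of reaching \<open>a\<close> from \<open>x\<close>.\<close>

definition level_event ::
    "real measure \<Rightarrow> 'a measure \<Rightarrow> (real \<Rightarrow> 'a \<Rightarrow> real) \<Rightarrow> (real \<Rightarrow> real \<Rightarrow> 'a \<Rightarrow> real) \<Rightarrow> real \<Rightarrow> real \<Rightarrow> 'a set" where
  "level_event m M B L a t = {\<omega>\<in>space M. \<exists>s\<ge>0. (\<forall>r\<in>{0..s}. 0 < B r \<omega> \<and> B r \<omega> \<le> 2 * a) \<and>
        (\<exists>r\<in>{0..s}. a < B r \<omega>) \<and> ennreal t < additive_functional m L s \<omega>}"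

text \<open>A path exceeding \<open>w\<close> is cut at its first visit to \<open>w\<close>, where
  it satisfies the event of level \<open>w / 2\<close> with threshold \<open>0\<close>; the decay in
  \<open>t\<close> is given up there. The other paths are sorted by the dyadic interval containing
  their maximum.\<close>

lemma level_event_cover:
  assumes m: "speed_measure m" and w: "0 < w" "x < w" and x: "0 < x"
    and BM: "brownian_motion_from M x B" and L: "local_time_of M B L"
    and \<omega>: "\<omega> \<in> space M" and s: "0 \<le> s" "\<forall>r\<in>{0..s}. 0 < B r \<omega>"
    and clock: "ennreal t < additive_functional m L s \<omega>"
  shows "\<omega> \<in> level_event m M B L (w / 2) 0 \<or> (\<exists>k. \<omega> \<in> level_event m M B L (w * (1 / 2) ^ Suc k) t)"
proof -
  interpret path_local_time "\<lambda>r. B r \<omega>" "\<lambda>y s. L y s \<omega>"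
    by (rule path_local_time_of[OF BM L \<omega>])
  have A: "additive_functional m L s \<omega> = clock m s" for s
    by (simp add: additive_functional_def clock_def)
  have B0: "B 0 \<omega> = x" using BM \<omega> by (auto simp: brownian_motion_from_def)
  have "continuous_on {0..s} (\<lambda>r. B r \<omega>)" using path_cont by (rule continuous_on_subset) auto
  then obtain q where q: "q \<in> {0..s}" "\<And>r. r \<in> {0..s} \<Longrightarrow> B r \<omega> \<le> B q \<omega>"
    using continuous_attains_sup[of "{0..s}" "\<lambda>r. B r \<omega>"] s by auto
  show ?thesis
  proof (cases "w < B q \<omega>")
    case True
    obtain T where T: "0 < T" "w - B T \<omega> = 0" "\<And>r. 0 \<le> r \<Longrightarrow> r < T \<Longrightarrow> 0 < w - B r \<omega>"
    proof -
      have "continuous_on {0..} (\<lambda>r. w - B r \<omega>)" by (intro continuous_intros path_cont)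
      moreover have "0 < w - B 0 \<omega>" "0 \<le> q" "w - B q \<omega> \<le> 0" using q(1) True w B0 by auto
      ultimately show ?thesis by (rule first_zero) (rule that)
    qed
    have "T \<le> q"
    proof (rule ccontr)
      assume "\<not> T \<le> q"
      then show False using T(3)[of q] q(1) True by simp
    qed
    then have "T \<le> s" using q(1) by simp
    have "clock m 0 = 0" by (simp add: clock_def l_0)
    then have "0 < clock m T"
      using clock_increases[OF m order_refl T(1) order_refl] T(2) w by simp
    moreover have "\<forall>r\<in>{0..T}. 0 < B r \<omega> \<and> B r \<omega> \<le> 2 * (w / 2)"
    proof
      fix r assume r: "r \<in> {0..T}"
      then have "B r \<omega> \<le> w" using T(2) T(3)[of r] by (cases "r = T") auto
      moreover have "0 < B r \<omega>" using s(2) r \<open>T \<le> s\<close> by auto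
      ultimately show "0 < B r \<omega> \<and> B r \<omega> \<le> 2 * (w / 2)" by simp
    qed
    moreover have "\<exists>r\<in>{0..T}. w / 2 < B r \<omega>" using T(1,2) w by (intro bexI[of _ T]) auto
    ultimately have "0 \<le> T \<and> (\<forall>r\<in>{0..T}. 0 < B r \<omega> \<and> B r \<omega> \<le> 2 * (w / 2)) \<and>
        (\<exists>r\<in>{0..T}. w / 2 < B r \<omega>) \<and> ennreal 0 < additive_functional m L T \<omega>"
      unfolding A ennreal_0 by (intro conjI less_imp_le[OF T(1)])
    then have "\<omega> \<in> level_event m M B L (w / 2) 0"
      unfolding level_event_def by (intro CollectI conjI[OF \<omega>] exI[of _ T])
    then show ?thesis ..
  next
    case False
    have Mpos: "0 < B q \<omega>" using s(2) q(1) by blast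
    have "\<exists>k. (1 / 2) ^ k < B q \<omega> / w" using Mpos w by (intro real_arch_pow_inv) auto
    then have ex: "\<exists>k. w * (1 / 2) ^ k < B q \<omega>" using w by (simp add: field_simps)
    define j where "j = (LEAST k. w * (1 / 2) ^ k < B q \<omega>)"
    have j: "w * (1 / 2) ^ j < B q \<omega>" unfolding j_def by (rule LeastI_ex[OF ex])
    have "j \<noteq> 0"
    proof
      assume "j = 0"
      then show False using j False by simp
    qed
    then obtain k where k: "j = Suc k" by (cases j) auto
    have "k < (LEAST k. w * (1 / 2) ^ k < B q \<omega>)" using k unfolding j_def by simp
    then have "\<not> w * (1 / 2) ^ k < B q \<omega>" by (rule not_less_Least)
    then have "B q \<omega> \<le> 2 * (w * (1 / 2) ^ Suc k)" by simp
    then have "\<forall>r\<in>{0..s}. 0 < B r \<omega> \<and> B r \<omega> \<le> 2 * (w * (1 / 2) ^ Suc k)"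
      using order_trans[OF q(2)] s(2) by blast
    moreover have "\<exists>r\<in>{0..s}. w * (1 / 2) ^ Suc k < B r \<omega>" using q(1) j unfolding k by blast
    ultimately have "0 \<le> s \<and> (\<forall>r\<in>{0..s}. 0 < B r \<omega> \<and> B r \<omega> \<le> 2 * (w * (1 / 2) ^ Suc k)) \<and>
        (\<exists>r\<in>{0..s}. w * (1 / 2) ^ Suc k < B r \<omega>) \<and> ennreal t < additive_functional m L s \<omega>"
      by (intro conjI s(1) clock)
    then have "\<omega> \<in> level_event m M B L (w * (1 / 2) ^ Suc k) t"
      unfolding level_event_def by (intro CollectI conjI[OF \<omega>] exI[of _ s])
    then show ?thesis by blast
  qed
qed

lemma dyadic_moment_sequence:
  assumes "(\<integral>\<^sup>+ x. ennreal (1 / x) * sup_moment m x * indicator {0<..1} x \<partial>lborel) < \<infinity>"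
  obtains \<gamma> :: "nat \<Rightarrow> real" where "summable \<gamma>" "antimono \<gamma>" "\<And>k. 0 \<le> \<gamma> k"
    "\<And>k. sup_moment m ((1 / 2) ^ Suc k) = ennreal (\<gamma> k)"
proof -
  let ?g = "\<lambda>k. sup_moment m ((1 / 2) ^ Suc k)"
  define \<gamma> where "\<gamma> k = enn2real (?g k)" for k
  have "(\<Sum>k. ?g k) \<le> 2 * (\<integral>\<^sup>+ x. ennreal (1 / x) * sup_moment m x * indicator {0<..1} x \<partial>lborel)"
    by (rule dyadic_sum_le)
  also have "\<dots> < \<infinity>" using assms by (simp add: ennreal_mult_less_top)
  finally have fin: "(\<Sum>k. ?g k) < \<infinity>" .
  have g: "?g k = ennreal (\<gamma> k)" for k
  proof -
    have "?g k = (\<Sum>i\<in>{k}. ?g i)" by simp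
    also have "\<dots> \<le> (\<Sum>k. ?g k)" by (intro sum_le_suminf) auto
    finally have "?g k < \<infinity>" using fin by (rule le_less_trans)
    then show ?thesis by (simp add: \<gamma>_def)
  qed
  have nn: "0 \<le> \<gamma> k" for k by (simp add: \<gamma>_def)
  have "antimono \<gamma>"
  proof (rule antimonoI)
    fix i j :: nat assume "i \<le> j"
    then have "?g j \<le> ?g i" by (intro sup_moment_mono power_decreasing) auto
    then show "\<gamma> j \<le> \<gamma> i" unfolding g using nn by simp
  qed
  moreover have "summable \<gamma>"
    using fin nn unfolding g by (intro summable_suminf_not_top) (auto simp: less_top)
  ultimately show ?thesis using that nn g by blast
qed

lemma exp_minus_double_le: "exp (- (2 * real k)) \<le> (1 / 4) ^ k"
proof -
  have "2 \<le> exp (1::real)" using exp_ge_add_one_self[of 1] by simp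
  then have "4 \<le> exp (2::real)" using mult_mono[of 2 "exp 1" 2 "exp (1::real)"] by (simp flip: exp_add)
  then have "exp (-2::real) \<le> 1 / 4" by (simp add: exp_minus field_simps)
  then have "exp (-2::real) ^ k \<le> (1 / 4) ^ k" by (intro power_mono) auto
  then show ?thesis by (simp add: mult.commute flip: exp_of_nat_mult)
qed

theorem mainTheorem10:
  fixes m :: "real measure"
  assumes "speed_measure m"
    and "comes_down_from_infinity m"
    and "(\<integral>\<^sup>+ x. ennreal (1 / x) *
            (SUP y\<in>{0<..x}. ennreal (1 / y) *
               (\<integral>\<^sup>+ z. ennreal (z\<^sup>2) * indicator {0<..<y} z \<partial>m))
          * indicator {0<..1} x \<partial>lborel) < \<infinity>"
  shows "\<forall>t>0. \<exists>C<\<infinity>. \<forall>x>0. \<forall>(M :: 'a measure) B L.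
           brownian_motion_from M x B \<and> local_time_of M B L \<longrightarrow>
           (\<exists>E\<in>sets M. {\<omega>\<in>space M. ereal t < absorption_time m B L \<omega>} \<subseteq> E \<and>
                        emeasure M E \<le> C * ennreal x)"
proof (intro allI impI)
  fix t :: real assume t: "0 < t"
  note m = assms(1)
  have "(\<integral>\<^sup>+ x. ennreal (1 / x) * sup_moment m x * indicator {0<..1} x \<partial>lborel) < \<infinity>"
    using assms(3) unfolding sup_moment_def moment2_def .
  then obtain \<gamma> :: "nat \<Rightarrow> real" where \<gamma>: "summable \<gamma>" "antimono \<gamma>" "\<And>k. 0 \<le> \<gamma> k"
    "\<And>k. sup_moment m ((1 / 2) ^ Suc k) = ennreal (\<gamma> k)"
    using dyadic_moment_sequence[of m] by blast
  \<comment> \<open>The \<open>4\<close> combines the factor \<open>2\<close> of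
    \<open>first_moment_le\<close> with the factor \<open>2\<close> that \<open>level_bound\<close>
    asks for.\<close>
  define K where "K k = 4 * (\<Sum>j. \<gamma> (j + k))" for k
  \<comment> \<open>With \<open>K k <= t / 48\<close> the exponent \<open>2 l K - l t / 12\<close>
    is at most \<open>- l t / 24\<close>, which equals \<open>- 2 k\<close> for the constant
    \<open>48\<close>.\<close>
  define l where "l k = 48 / t * real k" for k
  have sk: "summable (\<lambda>j. \<gamma> (j + k))" for k using \<gamma>(1) by simp
  have K0: "0 \<le> K k" for k unfolding K_def using \<gamma>(3) suminf_nonneg[OF sk] by simp
  have K_moment: "2 * moment1 m ((1 / 2) ^ Suc k) \<le> ennreal (K k)" for k
  proof -
    have "moment1 m ((1 / 2) ^ Suc k) \<le> 2 * (\<Sum>j. sup_moment m ((1 / 2) ^ (Suc k + j)))"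
      using m by (intro first_moment_le) (simp add: speed_measure_def)
    also have "(\<Sum>j. sup_moment m ((1 / 2) ^ (Suc k + j))) = (\<Sum>j. ennreal (\<gamma> (j + k)))"
      using \<gamma>(4) by (simp add: add.commute)
    also have "\<dots> = ennreal (\<Sum>j. \<gamma> (j + k))" by (rule suminf_ennreal2[OF \<gamma>(3) sk])
    finally have "2 * moment1 m ((1 / 2) ^ Suc k) \<le> 2 * (2 * ennreal (\<Sum>j. \<gamma> (j + k)))"
      by (rule mult_left_mono) simp
    also have "\<dots> = ennreal (K k)"
      unfolding K_def by (subst ennreal_mult') (simp_all add: mult.assoc[symmetric])
    finally show ?thesis .
  qed
  \<comment> \<open>Here \<open>384 = 2 * 4 * 48\<close>: the inequality says
    \<open>4 * l k * \<gamma> k <= 1 / 2\<close>, the second moment condition of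
    \<open>level_bound\<close>.\<close>
  have "\<forall>\<^sub>F k in sequentially. real k * \<gamma> k \<le> t / 384"
    using t by (intro summable_antimono_times_index_le \<gamma>) auto
  moreover have "\<forall>\<^sub>F k in sequentially. K k \<le> t / 48"
  proof -
    have "(\<lambda>k. \<Sum>j. \<gamma> (j + k)) \<longlonglongrightarrow> 0" by (rule suminf_exist_split2[OF \<gamma>(1)])
    then have "K \<longlonglongrightarrow> 4 * 0" unfolding K_def by (intro tendsto_mult tendsto_const)
    then have "\<forall>\<^sub>F k in sequentially. K k < t / 48" using t by (intro order_tendstoD(2)) auto
    then show ?thesis by eventually_elim simp
  qed
  ultimately have "\<forall>\<^sub>F k in sequentially. 1 \<le> k \<and> real k * \<gamma> k \<le> t / 384 \<and> K k \<le> t / 48"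
    using eventually_ge_at_top[of 1] by eventually_elim simp
  then obtain k0 where k0: "\<And>k. k0 \<le> k \<Longrightarrow> 1 \<le> k \<and> real k * \<gamma> k \<le> t / 384 \<and> K k \<le> t / 48"
    unfolding eventually_sequentially by blast
  define w :: real where "w = (1 / 2) ^ Suc k0"
  have w: "0 < w" by (simp add: w_def)
  have level: "\<exists>E\<in>sets M. level_event m M B L ((1 / 2) ^ Suc (Suc k)) r \<subseteq> E \<and>
      emeasure M E \<le> ennreal (6 * exp (2 * l k * K k - l k * r / 12) * (x / (1 / 2) ^ Suc (Suc k)))"
    if k: "k0 \<le> k" and r: "0 \<le> r" and x: "0 < x"
      and BM: "brownian_motion_from M x B" and L: "local_time_of M B L"
    for k r x and M :: "'a measure" and B L
    unfolding level_event_def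
  proof (rule level_bound[OF m _ _ r K0 _ _ BM L x])
    have two: "2 * (1 / 2) ^ Suc (Suc k) = (1 / 2 :: real) ^ Suc k" by simp
    show "(0::real) < (1 / 2) ^ Suc (Suc k)" by simp
    show l0: "0 < l k" using t k0[OF k] by (simp add: l_def)
    show "2 * (\<integral>\<^sup>+z. ennreal z * indicator {0<..<2 * (1 / 2) ^ Suc (Suc k)} z \<partial>m) \<le> ennreal (K k)"
      using K_moment[of k] unfolding two moment1_def .
    fix y :: real assume y: "0 < y" "y \<le> 2 * (1 / 2) ^ Suc (Suc k)"
    have "ennreal (4 * l k) * moment2 m y \<le> ennreal (4 * l k) * (ennreal y * ennreal (\<gamma> k))"
      using moment_le_sup[OF y(1), of "(1 / 2) ^ Suc k" m] y(2) unfolding two \<gamma>(4)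
      by (intro mult_left_mono) auto
    also have "\<dots> = ennreal (4 * l k * (y * \<gamma> k))"
      using l0 y \<gamma>(3) by (simp add: ennreal_mult)
    also have "\<dots> \<le> ennreal (y / 2)"
    proof (rule ennreal_leI)
      have "4 * l k * (y * \<gamma> k) = 192 / t * y * (real k * \<gamma> k)" by (simp add: l_def)
      also have "\<dots> \<le> 192 / t * y * (t / 384)"
        using k0[OF k] t y by (intro mult_left_mono) auto
      also have "\<dots> = y / 2" using t by simp
      finally show "4 * l k * (y * \<gamma> k) \<le> y / 2" .
    qed
    finally show "ennreal (4 * l k) * (\<integral>\<^sup>+z. ennreal (z\<^sup>2) * indicator {0<..<y} z \<partial>m) \<le> ennreal (y / 2)"
      unfolding moment2_def .
  qed
  \<comment> \<open>At level \<open>k\<close> the prefactor is \<open>1 / a = 4 * 2^k\<close>;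
    against \<open>exp (- 2 k) <= 4^(- k)\<close> it leaves \<open>24 * x * 2^(- k)\<close>,
    summable over the levels.\<close>
  have level_t: "6 * exp (2 * l k * K k - l k * t / 12) * (x / (1 / 2) ^ Suc (Suc k)) \<le> 24 * x * (1 / 2) ^ k"
    if k: "k0 \<le> k" and x: "0 < x" for k x
  proof -
    have "l k * (2 * K k) \<le> l k * (t / 24)"
      using k0[OF k] t by (intro mult_left_mono) (auto simp: l_def)
    moreover have "l k * t = 48 * real k" using t by (simp add: l_def)
    ultimately have "2 * l k * K k - l k * t / 12 \<le> - (2 * real k)" by simp
    then have "exp (2 * l k * K k - l k * t / 12) \<le> exp (- (2 * real k))" by simp
    also have "\<dots> \<le> (1 / 4) ^ k" by (rule exp_minus_double_le)
    finally have "6 * exp (2 * l k * K k - l k * t / 12) * (x / (1 / 2) ^ Suc (Suc k))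
        \<le> 6 * (1 / 4) ^ k * (x / (1 / 2) ^ Suc (Suc k))"
      using x by (intro mult_right_mono mult_left_mono) auto
    also have "\<dots> = 24 * x * ((1 / 4) ^ k / (1 / 2) ^ k)" by (simp add: field_simps)
    also have "(1 / 4 :: real) ^ k / (1 / 2) ^ k = (1 / 2) ^ k" by (simp flip: power_divide)
    finally show ?thesis .
  qed
  define D where "D = 6 * exp (2 * l k0 * K k0) / (1 / 2) ^ Suc (Suc k0)"
  \<comment> \<open>\<open>1 / w\<close> serves starting points \<open>x >= w\<close>,
    \<open>D\<close> the paths exceeding \<open>w\<close>, and \<open>48 = 24 * 2\<close> is the
    geometric sum over the dyadic levels.\<close>
  define C where "C = 1 / w + (D + 48)"
  have D: "0 < D" by (simp add: D_def)
  have C: "1 / w \<le> C" "D + 48 \<le> C" "0 < C" using w D by (auto simp: C_def add_pos_pos)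
  show "\<exists>C<\<infinity>. \<forall>x>0. \<forall>(M :: 'a measure) B L.
           brownian_motion_from M x B \<and> local_time_of M B L \<longrightarrow>
           (\<exists>E\<in>sets M. {\<omega>\<in>space M. ereal t < absorption_time m B L \<omega>} \<subseteq> E \<and>
                        emeasure M E \<le> C * ennreal x)"
  proof (intro exI[of _ "ennreal C"] conjI allI impI)
    fix x :: real and M :: "'a measure" and B L
    assume x: "0 < x" and "brownian_motion_from M x B \<and> local_time_of M B L"
    then have BM: "brownian_motion_from M x B" and L: "local_time_of M B L" by auto
    interpret prob_space M using BM by (simp add: brownian_motion_from_def)
    let ?S = "{\<omega>\<in>space M. ereal t < absorption_time m B L \<omega>}"
    have Cx: "ennreal C * ennreal x = ennreal (C * x)" using C(3) by (simp add: ennreal_mult')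
    show "\<exists>E\<in>sets M. ?S \<subseteq> E \<and> emeasure M E \<le> ennreal C * ennreal x"
    proof (cases "x < w")
      case False
      have "1 \<le> 1 / w * x" using False w by simp
      also have "\<dots> \<le> C * x" using C(1) x by (intro mult_right_mono) auto
      finally have "emeasure M (space M) \<le> ennreal C * ennreal x"
        unfolding Cx emeasure_space_1 by simp
      then show ?thesis by (intro bexI[of _ "space M"]) auto
    next
      case xw: True
      have w2: "w / 2 = (1 / 2) ^ Suc (Suc k0)" by (simp add: w_def)
      have wk: "w * (1 / 2) ^ Suc k = (1 / 2) ^ Suc (Suc (k0 + k))" for k
        by (simp add: w_def power_add)
      obtain E0 where E0: "E0 \<in> sets M" "level_event m M B L (w / 2) 0 \<subseteq> E0"
        "emeasure M E0 \<le> ennreal (D * x)"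
      proof -
        have "6 * exp (2 * l k0 * K k0 - l k0 * 0 / 12) * (x / (1 / 2) ^ Suc (Suc k0)) = D * x"
          by (simp add: D_def)
        from level[OF order_refl order_refl x BM L, unfolded this] show ?thesis
          using that unfolding w2 by blast
      qed
      have "\<exists>E. \<forall>k. E k \<in> sets M \<and> level_event m M B L (w * (1 / 2) ^ Suc k) t \<subseteq> E k \<and>
          emeasure M (E k) \<le> ennreal (24 * x * (1 / 2) ^ k)"
      proof (rule choice, rule allI)
        fix k
        have k: "k0 \<le> k0 + k" by simp
        obtain E where E: "E \<in> sets M" "level_event m M B L ((1 / 2) ^ Suc (Suc (k0 + k))) t \<subseteq> E"
          "emeasure M E \<le> ennreal (6 * exp (2 * l (k0 + k) * K (k0 + k) - l (k0 + k) * t / 12) * (x / (1 / 2) ^ Suc (Suc (k0 + k))))"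
          using level[OF k less_imp_le[OF t] x BM L] by blast
        have "(1 / 2 :: real) ^ (k0 + k) \<le> (1 / 2) ^ k" by (intro power_decreasing) auto
        then have "24 * x * (1 / 2) ^ (k0 + k) \<le> 24 * x * (1 / 2) ^ k"
          using x by (intro mult_left_mono) auto
        then have "emeasure M E \<le> ennreal (24 * x * (1 / 2) ^ k)"
          using level_t[OF k x] by (intro order_trans[OF E(3)] ennreal_leI) linarith
        then show "\<exists>E. E \<in> sets M \<and> level_event m M B L (w * (1 / 2) ^ Suc k) t \<subseteq> E \<and>
          emeasure M E \<le> ennreal (24 * x * (1 / 2) ^ k)"
          using E(1,2) unfolding wk by blast
      qed
      then obtain E where E: "\<And>k. E k \<in> sets M" "\<And>k. level_event m M B L (w * (1 / 2) ^ Suc k) t \<subseteq> E k"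
        "\<And>k. emeasure M (E k) \<le> ennreal (24 * x * (1 / 2) ^ k)" by blast
      \<comment> \<open>Paths that are not unbounded in both directions form a null set, which is
        added to the envelope so that the covering holds for every \<open>\<omega>\<close>.\<close>
      have "AE \<omega> in M. (\<forall>n::nat. \<exists>r\<ge>real n. 0 < 1 * B r \<omega>) \<and> (\<forall>n::nat. \<exists>r\<ge>real n. 0 < -1 * B r \<omega>)"
        by (intro AE_conjI brownian_unbounded[OF BM]) auto
      then obtain N where N: "N \<in> null_sets M"
        "{\<omega>\<in>space M. \<not> ((\<forall>n::nat. \<exists>r\<ge>real n. 0 < 1 * B r \<omega>) \<and> (\<forall>n::nat. \<exists>r\<ge>real n. 0 < -1 * B r \<omega>))} \<subseteq> N"
        unfolding eventually_ae_filter by blast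
      have sub: "?S \<subseteq> N \<union> (E0 \<union> (\<Union>k. E k))"
      proof
        fix \<omega> assume "\<omega> \<in> ?S"
        then have \<omega>: "\<omega> \<in> space M" "ereal t < absorption_time m B L \<omega>" by auto
        show "\<omega> \<in> N \<union> (E0 \<union> (\<Union>k. E k))"
        proof (cases "\<omega> \<in> N")
          case False
          then have *: "\<forall>n::nat. \<exists>r\<ge>real n. 0 < 1 * B r \<omega>" "\<forall>n::nat. \<exists>r\<ge>real n. 0 < -1 * B r \<omega>"
            using N(2) \<omega>(1) by blast+
          have pos: "\<exists>r\<ge>real n. 0 < B r \<omega>" for n using *(1) by simp
          have neg: "\<exists>r\<ge>0. B r \<omega> < 0" using *(2)[rule_format, of 0] by simp
          obtain s where "0 \<le> s" "\<forall>r\<in>{0..s}. 0 < B r \<omega>" "ennreal t < additive_functional m L s \<omega>"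
            using survival_implies_clock[OF m less_imp_le[OF t] BM L x \<omega>(1) pos neg \<omega>(2)] by blast
          from level_event_cover[OF m w xw x BM L \<omega>(1) this] show ?thesis
            using E0(2) E(2) by blast
        qed simp
      qed
      have "emeasure M (N \<union> (E0 \<union> (\<Union>k. E k))) \<le> emeasure M N + emeasure M (E0 \<union> (\<Union>k. E k))"
        using N(1) E0(1) E(1) by (intro emeasure_subadditive) auto
      also have "\<dots> = emeasure M (E0 \<union> (\<Union>k. E k))" using null_setsD1[OF N(1)] by simp
      also have "\<dots> \<le> emeasure M E0 + emeasure M (\<Union>k. E k)"
        using E0(1) E(1) by (intro emeasure_subadditive) auto
      also have "emeasure M (\<Union>k. E k) \<le> (\<Sum>k. emeasure M (E k))"
        using E(1) by (intro emeasure_subadditive_countably) auto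
      also have "\<dots> \<le> (\<Sum>k. ennreal (24 * x * (1 / 2) ^ k))"
        by (intro suminf_le E(3)) auto
      also have "\<dots> = ennreal (24 * x * 2)"
      proof (rule suminf_ennreal_eq)
        show "(\<lambda>k. 24 * x * (1 / 2) ^ k) sums (24 * x * 2)"
          using sums_mult[OF geometric_sums[of "1 / 2 :: real"], of "24 * x"] by simp
      qed (use x in simp)
      also have "emeasure M E0 + ennreal (24 * x * 2) \<le> ennreal (D * x) + ennreal (24 * x * 2)"
        by (rule add_right_mono[OF E0(3)])
      also have "\<dots> = ennreal ((D + 48) * x)"
        using D x by (simp add: algebra_simps flip: ennreal_plus)
      also have "\<dots> \<le> ennreal (C * x)"
        using C(2) x by (intro ennreal_leI mult_right_mono) auto
      finally have "emeasure M (N \<union> (E0 \<union> (\<Union>k. E k))) \<le> ennreal C * ennreal x"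
        unfolding Cx by (simp add: add_left_mono)
      then show ?thesis
        using sub N(1) E0(1) E(1) by (intro bexI[of _ "N \<union> (E0 \<union> (\<Union>k. E k))"]) auto
    qed
  qed simp
qed

end
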